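(* Let $(\mathcal L,(\cdot,\cdot),\mathcal H)\in\mathcal T$, with $\dot R$, $\dot{\mathfrak g}$, $\dot{\mathcal H}$, $\Lambda$ as in the context. Then the core $\mathcal L_c$ is a division $(\dot R,\Lambda)$-graded Lie algebra with grading pair $(\dot{\mathfrak g},\dot{\mathcal H})$, where the $\Lambda$-grading is $\mathcal L_c^\sigma=\mathcal L_c\cap\mathcal L^\sigma$ with $\mathcal L^\sigma=\sum_{\dot\alpha\in\dot R}\mathcal L_{\dot\alpha+\sigma}$ ($\sigma\in\Lambda$), and the $\dot R$-grading is by weights with respect to $\dot{\mathcal H}$ (elements of $\dot R\subseteq\mathcal H^\star$ being restricted to $\dot{\mathcal H}$).
   Context: $\mathbb F$ is a field of characteristic $0$. If $V$ is a finite-dimensional space with a non-degenerate symmetric bilinear form and $\alpha\in V^\star$, $t_\alpha$ denotes the unique element of $V$ with $(t_\alpha,v)=\alpha(v)$ for all $v\in V$. A nonzero subalgebra $\mathcal H$ of a Lie algebra $\mathcal L$ is a (split) toral subalgebra if $\mathcal L=\bigoplus_{\alpha\in\mathcal H^\star}\mathcal L_\alpha$, where $\mathcal L_\alpha=\{x\in\mathcal L:[h,x]=\alpha(h)x\ \forall h\in\mathcal H\}$. The class $\mathcal T$ consists of triples $(\mathcal L,(\cdot,\cdot),\mathcal H)$ with: (T1) $\mathcal L$ is a Lie algebra over $\mathbb F$ with a non-degenerate symmetric invariant bilinear form $(\cdot,\cdot)$; (T2) $\mathcal H$ is a finite-dimensional toral subalgebra of $\mathcal L$ and $(\cdot,\cdot)|_{\mathcal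 H\times\mathcal H}$ is non-degenerate. Put $R=\{\alpha\in\mathcal H^\star:\mathcal L_\alpha\neq0\}$ (root system), transfer the form to $\mathcal H^\star$ by $(\alpha,\beta):=(t_\alpha,t_\beta)$, and let $R^\times=\{\alpha\in R:(\alpha,\alpha)\ne0\}$, $R^0=\{\alpha\in R:(\alpha,\alpha)=0\}$; (T3) for each $\delta\in R^0$ there are $x\in\mathcal L_\delta$, $y\in\mathcal L_{-\delta}$ with $[x,y]=t_\delta$, and for each $\alpha\in R^\times$ and each $0\ne x\in\mathcal L_\alpha$ there is $y\in\mathcal L_{-\alpha}$ with $[x,y]=t_\alpha$; (T4) for $\alpha\in R^\times$ and $x\in\mathcal L_\alpha$, $\mathrm{ad}\,x$ acts locally nilpotently on $\mathcal L$; (T5) (a) $R^\times$ is not a disjoint union of two nonempty mutually orthogonal subsets, (b) for each $\delta\in R^0$ there is $\alpha\in R^\times$ with $\alpha+\delta\in R$; (T6) $\Lambda:=\mathrm{span}_{\mathbb Z}(R^0)$ is a free abelian group of finite rank. The core $\mathcal L_c$ is the subalgebra generated by the $\mathcal L_\alpha$, $\alpha\in R^\times$. A finite root system is a subset $\Delta$ containing $0$ with $\Delta^\times:=\Delta\setminus\{0\}$ a finite root system in the sense of Bourbaki; $\Delta_{red}=\{0\}\cup\{\alpha\in\Delta:\alpha/2\notin\Delta\}$. Standard setup: normalize the form so that $(\alpha_0,\alpha_0)=1$ for some $\alpha_0\in R^\times$; then $(R,R)\subseteq\mathbb Q$. Let $\mathcal V=\mathbb R\otimes_{\mathbb Q}\mathrm{span}_{\mathbb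 Q}(R)$ with the induced real positive semidefinite form, $\mathcal V^0$ its radical, $\bar{\ }:\mathcal V\to\mathcal V/\mathcal V^0$. The image $\bar R$ is an irreducible finite root system; fix a base $\{\bar\alpha_i\}_{i=1}^\ell$ and preimages $\dot\alpha_i\in R$. With $\dot{\mathcal V}=\mathrm{span}_{\mathbb R}\{\dot\alpha_i\}$, $\mathcal V=\dot{\mathcal V}\oplus\mathcal V^0$, and $\dot R:=\{\dot\alpha\in\dot{\mathcal V}:\dot\alpha+\delta\in R$ for some $\delta\in\mathcal V^0\}$ is an irreducible finite root system with base $\{\dot\alpha_i\}$, $\dot R\subseteq\mathrm{span}_{\mathbb Z}\{\dot\alpha_i\}\subseteq\mathcal H^\star$, $\dot R_{red}\subseteq R$, and $R\subseteq\dot R+\Lambda$. Let $h_\alpha=2t_\alpha/(t_\alpha,t_\alpha)$ for $\alpha\in R^\times$; fix $e_{\pm\dot\alpha_i}\in\mathcal L_{\pm\dot\alpha_i}$ with $[h_{\dot\alpha_i},e_{\pm\dot\alpha_i}]=\pm2e_{\pm\dot\alpha_i}$, $[e_{\dot\alpha_i},e_{-\dot\alpha_i}]=h_{\dot\alpha_i}$; $\dot{\mathfrak g}$ is the subalgebra generated by $\{e_{\pm\dot\alpha_i}\}$ and $\dot{\mathcal H}=\sum_i\mathbb F t_{\dot\alpha_i}=\sum_i\mathbb F h_{\dot\alpha_i}$; the form restricted to $\dot{\mathcal H}$ is non-degenerate and $t_\mu$ ($\mu\in\dot R$) is taken in $\dot{\mathcal H}$. Graded algebras: let $\Delta$ be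 an irreducible finite root system, $\mathfrak g$ a finite-dimensional split simple Lie algebra with splitting Cartan subalgebra $\mathfrak h$ and root system $\Delta_{red}$. A $\Delta$-graded Lie algebra with grading pair $(\mathfrak g,\mathfrak h)$ is a Lie algebra $\mathcal L$ containing $\mathfrak g$ as a subalgebra with $\mathcal L=\bigoplus_{\mu\in\Delta}\mathcal L_\mu$, $\mathcal L_\mu=\{x:[h,x]=\mu(h)x\ \forall h\in\mathfrak h\}$, and $\mathcal L_0=\sum_{\mu\in\Delta^\times}[\mathcal L_\mu,\mathcal L_{-\mu}]$. For an abelian group $G$ it is $(\Delta,G)$-graded if moreover $\mathcal L=\bigoplus_{g\in G}\mathcal L^g$ is a $G$-graded Lie algebra with $\mathfrak g\subseteq\mathcal L^0$ and $\{g:\mathcal L^g\ne0\}$ generating $G$; then $\mathcal L=\bigoplus_{\mu,g}\mathcal L^g_\mu$, $\mathcal L^g_\mu=\mathcal L^g\cap\mathcal L_\mu$. It is division if for all $\mu\in\Delta^\times$, $g\in G$, $0\ne x\in\mathcal L^g_\mu$ there is $y\in\mathcal L^{-g}_{-\mu}$ with $[x,y]\equiv t_\mu\pmod{Z(\mathcal L)}$. *)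

theory Defs
  imports Complex_Main "HOL-Library.Function_Algebras"
begin

text \<open>Conventions.  The ground field F is a type 'k of class field_char_0.
  The Lie algebra L is a type 'l (an abelian group) with scalar multiplication
  sc, bracket br and bilinear form B.  A linear functional on a subspace H is
  represented as a function 'l => 'k that is linear on H and vanishes off H
  (so that H-star is a set of functions and equality of functionals is
  equality of functions).  Pointwise +, -, uminus on functionals come from
  Function_Algebras.\<close>

definition is_lie :: "('k::field \<Rightarrow> 'l::ab_group_add \<Rightarrow> 'l) \<Rightarrow> ('l \<Rightarrow> 'l \<Rightarrow> 'l) \<Rightarrow> bool" where
  "is_lie sc br \<longleftrightarrow> module sc \<and>
     (\<forall>a x y z. br (sc a x + y) z = sc a (br x z) + br y z) \<and>
     (\<forall>x. br x x = 0) \<and>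
     (\<forall>x y z. br x (br y z) + br y (br z x) + br z (br x y) = 0)"

definition inv_form :: "('k::field \<Rightarrow> 'l::ab_group_add \<Rightarrow> 'l) \<Rightarrow> ('l \<Rightarrow> 'l \<Rightarrow> 'l) \<Rightarrow> ('l \<Rightarrow> 'l \<Rightarrow> 'k) \<Rightarrow> bool" where
  "inv_form sc br B \<longleftrightarrow> (\<forall>a x y z. B (sc a x + y) z = a * B x z + B y z) \<and>
     (\<forall>x y. B x y = B y x) \<and> (\<forall>x y z. B (br x y) z = B x (br y z)) \<and>
     (\<forall>x. (\<forall>y. B x y = 0) \<longrightarrow> x = 0)"

definition lsubalg :: "('k::field \<Rightarrow> 'l::ab_group_add \<Rightarrow> 'l) \<Rightarrow> ('l \<Rightarrow> 'l \<Rightarrow> 'l) \<Rightarrow> 'l set \<Rightarrow> bool" where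
  "lsubalg sc br K \<longleftrightarrow> module.subspace sc K \<and> (\<forall>x\<in>K. \<forall>y\<in>K. br x y \<in> K)"

definition gen_subalg :: "('k::field \<Rightarrow> 'l::ab_group_add \<Rightarrow> 'l) \<Rightarrow> ('l \<Rightarrow> 'l \<Rightarrow> 'l) \<Rightarrow> 'l set \<Rightarrow> 'l set" where
  "gen_subalg sc br S = \<Inter>{K. lsubalg sc br K \<and> S \<subseteq> K}"

definition ldual :: "('k::field \<Rightarrow> 'l::ab_group_add \<Rightarrow> 'l) \<Rightarrow> 'l set \<Rightarrow> ('l \<Rightarrow> 'k) set" where
  "ldual sc H = {\<alpha>. (\<forall>a. \<forall>x\<in>H. \<forall>y\<in>H. \<alpha> (sc a x + y) = a * \<alpha> x + \<alpha> y) \<and> (\<forall>x. x \<notin> H \<longrightarrow> \<alpha> x = 0)}"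

definition wsp :: "('k::field \<Rightarrow> 'l::ab_group_add \<Rightarrow> 'l) \<Rightarrow> ('l \<Rightarrow> 'l \<Rightarrow> 'l) \<Rightarrow> 'l set \<Rightarrow> 'l set \<Rightarrow> ('l \<Rightarrow> 'k) \<Rightarrow> 'l set" where
  "wsp sc br K X \<alpha> = {x\<in>X. \<forall>h\<in>K. br h x = sc (\<alpha> h) x}"

definition is_dsum :: "('i \<Rightarrow> 'l::ab_group_add set) \<Rightarrow> 'i set \<Rightarrow> 'l set \<Rightarrow> bool" where
  "is_dsum A I V \<longleftrightarrow> (\<forall>i\<in>I. A i \<subseteq> V) \<and>
     (\<forall>v\<in>V. \<exists>S f. finite S \<and> S \<subseteq> I \<and> (\<forall>i\<in>S. f i \<in> A i) \<and> v = (\<Sum>i\<in>S. f i)) \<and>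
     (\<forall>S f. finite S \<and> S \<subseteq> I \<and> (\<forall>i\<in>S. f i \<in> A i) \<and> (\<Sum>i\<in>S. f i) = 0 \<longrightarrow> (\<forall>i\<in>S. f i = 0))"

definition toral :: "('k::field \<Rightarrow> 'l::ab_group_add \<Rightarrow> 'l) \<Rightarrow> ('l \<Rightarrow> 'l \<Rightarrow> 'l) \<Rightarrow> 'l set \<Rightarrow> bool" where
  "toral sc br H \<longleftrightarrow> lsubalg sc br H \<and> H \<noteq> {0} \<and>
     is_dsum (\<lambda>\<alpha>. wsp sc br H UNIV \<alpha>) (ldual sc H) UNIV"

definition teeH :: "('l \<Rightarrow> 'l \<Rightarrow> 'k) \<Rightarrow> 'l set \<Rightarrow> ('l \<Rightarrow> 'k) \<Rightarrow> 'l" where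
  "teeH B H \<alpha> = (THE t. t \<in> H \<and> (\<forall>h\<in>H. B t h = \<alpha> h))"

definition fD :: "('l \<Rightarrow> 'l \<Rightarrow> 'k) \<Rightarrow> 'l set \<Rightarrow> ('l \<Rightarrow> 'k) \<Rightarrow> ('l \<Rightarrow> 'k) \<Rightarrow> 'k" where
  "fD B H \<alpha> \<beta> = B (teeH B H \<alpha>) (teeH B H \<beta>)"

definition lroots :: "('k::field \<Rightarrow> 'l::ab_group_add \<Rightarrow> 'l) \<Rightarrow> ('l \<Rightarrow> 'l \<Rightarrow> 'l) \<Rightarrow> 'l set \<Rightarrow> ('l \<Rightarrow> 'k) set" where
  "lroots sc br H = {\<alpha>\<in>ldual sc H. wsp sc br H UNIV \<alpha> \<noteq> {0}}"

definition rootsX :: "('k::field \<Rightarrow> 'l::ab_group_add \<Rightarrow> 'l) \<Rightarrow> ('l \<Rightarrow> 'l \<Rightarrow> 'l) \<Rightarrow> ('l \<Rightarrow> 'l \<Rightarrow> 'k) \<Rightarrow> 'l set \<Rightarrow> ('l \<Rightarrow> 'k) set" where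
  "rootsX sc br B H = {\<alpha>\<in>lroots sc br H. fD B H \<alpha> \<alpha> \<noteq> 0}"

definition roots0 :: "('k::field \<Rightarrow> 'l::ab_group_add \<Rightarrow> 'l) \<Rightarrow> ('l \<Rightarrow> 'l \<Rightarrow> 'l) \<Rightarrow> ('l \<Rightarrow> 'l \<Rightarrow> 'k) \<Rightarrow> 'l set \<Rightarrow> ('l \<Rightarrow> 'k) set" where
  "roots0 sc br B H = {\<alpha>\<in>lroots sc br H. fD B H \<alpha> \<alpha> = 0}"

definition zspan :: "('l \<Rightarrow> 'k::ring_1) set \<Rightarrow> ('l \<Rightarrow> 'k) set" where
  "zspan S = {v. \<exists>T c. finite T \<and> T \<subseteq> S \<and> v = (\<lambda>h. \<Sum>s\<in>T. of_int (c s) * s h)}"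

definition free_fin_rank :: "('l \<Rightarrow> 'k::ring_1) set \<Rightarrow> bool" where
  "free_fin_rank G \<longleftrightarrow> (\<exists>Bs. finite Bs \<and> Bs \<subseteq> G \<and> zspan Bs = G \<and>
     (\<forall>c. (\<lambda>h. \<Sum>s\<in>Bs. of_int (c s) * s h) = 0 \<longrightarrow> (\<forall>s\<in>Bs. c s = 0)))"

definition lLam :: "('k::field \<Rightarrow> 'l::ab_group_add \<Rightarrow> 'l) \<Rightarrow> ('l \<Rightarrow> 'l \<Rightarrow> 'l) \<Rightarrow> ('l \<Rightarrow> 'l \<Rightarrow> 'k) \<Rightarrow> 'l set \<Rightarrow> ('l \<Rightarrow> 'k) set" where
  "lLam sc br B H = zspan (roots0 sc br B H)"

definition classT :: "('k::field_char_0 \<Rightarrow> 'l::ab_group_add \<Rightarrow> 'l) \<Rightarrow> ('l \<Rightarrow> 'l \<Rightarrow> 'l) \<Rightarrow> ('l \<Rightarrow> 'l \<Rightarrow> 'k) \<Rightarrow> 'l set \<Rightarrow> bool" where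
  "classT sc br B H \<longleftrightarrow>
     is_lie sc br \<and> inv_form sc br B \<and>
     (\<exists>S. finite S \<and> module.span sc S = H) \<and> toral sc br H \<and>
     (\<forall>x\<in>H. (\<forall>y\<in>H. B x y = 0) \<longrightarrow> x = 0) \<and>
     (\<forall>\<delta>\<in>roots0 sc br B H. \<exists>x\<in>wsp sc br H UNIV \<delta>. \<exists>y\<in>wsp sc br H UNIV (- \<delta>).
         br x y = teeH B H \<delta>) \<and>
     (\<forall>\<alpha>\<in>rootsX sc br B H. \<forall>x\<in>wsp sc br H UNIV \<alpha>. x \<noteq> 0 \<longrightarrow>
         (\<exists>y\<in>wsp sc br H UNIV (- \<alpha>). br x y = teeH B H \<alpha>)) \<and>
     (\<forall>\<alpha>\<in>rootsX sc br B H. \<forall>x\<in>wsp sc br H UNIV \<alpha>. \<forall>y. \<exists>n. (br x ^^ n) y = 0) \<and>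
     \<not> (\<exists>P Q. P \<noteq> {} \<and> Q \<noteq> {} \<and> P \<inter> Q = {} \<and> P \<union> Q = rootsX sc br B H \<and>
           (\<forall>a\<in>P. \<forall>b\<in>Q. fD B H a b = 0)) \<and>
     (\<forall>\<delta>\<in>roots0 sc br B H. \<exists>\<alpha>\<in>rootsX sc br B H. \<alpha> + \<delta> \<in> lroots sc br H) \<and>
     free_fin_rank (lLam sc br B H)"

definition lcore :: "('k::field \<Rightarrow> 'l::ab_group_add \<Rightarrow> 'l) \<Rightarrow> ('l \<Rightarrow> 'l \<Rightarrow> 'l) \<Rightarrow> ('l \<Rightarrow> 'l \<Rightarrow> 'k) \<Rightarrow> 'l set \<Rightarrow> 'l set" where
  "lcore sc br B H = gen_subalg sc br (\<Union>\<alpha>\<in>rootsX sc br B H. wsp sc br H UNIV \<alpha>)"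

definition lrad :: "('l \<Rightarrow> 'l \<Rightarrow> 'k::field) \<Rightarrow> 'l set \<Rightarrow> ('l \<Rightarrow> 'k) set \<Rightarrow> ('l \<Rightarrow> 'k) set" where
  "lrad B H R = {v. \<forall>\<beta>\<in>R. fD B H v \<beta> = 0}"

definition qcomb :: "nat \<Rightarrow> (nat \<Rightarrow> 'l \<Rightarrow> 'k::field_char_0) \<Rightarrow> (nat \<Rightarrow> rat) \<Rightarrow> 'l \<Rightarrow> 'k" where
  "qcomb l al c = (\<lambda>h. \<Sum>i<l. of_rat (c i) * al i h)"

definition zcomb :: "nat \<Rightarrow> (nat \<Rightarrow> 'l \<Rightarrow> 'k::ring_1) \<Rightarrow> (nat \<Rightarrow> int) \<Rightarrow> 'l \<Rightarrow> 'k" where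
  "zcomb l al c = (\<lambda>h. \<Sum>i<l. of_int (c i) * al i h)"

text \<open>al 0, ..., al (l-1) are elements of R whose images in V/V0 form a
  (Bourbaki) base of the finite root system R-bar: they are linearly
  independent modulo the radical, and every root is, modulo the radical, an
  integral combination of them with coefficients all >= 0 or all <= 0.
  (Since V is the real extension of span_Q R and the form is defined over Q,
  real independence mod the radical equals rational independence mod the radical.)\<close>
definition std_base :: "('k::field_char_0 \<Rightarrow> 'l::ab_group_add \<Rightarrow> 'l) \<Rightarrow> ('l \<Rightarrow> 'l \<Rightarrow> 'l) \<Rightarrow> ('l \<Rightarrow> 'l \<Rightarrow> 'k) \<Rightarrow> 'l set \<Rightarrow> nat \<Rightarrow> (nat \<Rightarrow> 'l \<Rightarrow> 'k) \<Rightarrow> bool" where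
  "std_base sc br B H l al \<longleftrightarrow>
     (\<forall>i<l. al i \<in> lroots sc br H) \<and>
     (\<forall>c. qcomb l al c \<in> lrad B H (lroots sc br H) \<longrightarrow> (\<forall>i<l. c i = 0)) \<and>
     (\<forall>r\<in>lroots sc br H. \<exists>n. ((\<forall>i<l. 0 \<le> n i) \<or> (\<forall>i<l. n i \<le> 0)) \<and>
         r - zcomb l al n \<in> lrad B H (lroots sc br H))"

definition Rdot :: "('k::field_char_0 \<Rightarrow> 'l::ab_group_add \<Rightarrow> 'l) \<Rightarrow> ('l \<Rightarrow> 'l \<Rightarrow> 'l) \<Rightarrow> ('l \<Rightarrow> 'l \<Rightarrow> 'k) \<Rightarrow> 'l set \<Rightarrow> nat \<Rightarrow> (nat \<Rightarrow> 'l \<Rightarrow> 'k) \<Rightarrow> ('l \<Rightarrow> 'k) set" where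
  "Rdot sc br B H l al = {\<mu>. (\<exists>c. \<mu> = qcomb l al c) \<and>
      (\<exists>r\<in>lroots sc br H. r - \<mu> \<in> lrad B H (lroots sc br H))}"

definition Rred :: "('l \<Rightarrow> 'k::field) set \<Rightarrow> ('l \<Rightarrow> 'k) set" where
  "Rred D = {0} \<union> {\<alpha>\<in>D. (\<lambda>h. \<alpha> h / 2) \<notin> D}"

definition hcor :: "('k::field \<Rightarrow> 'l::ab_group_add \<Rightarrow> 'l) \<Rightarrow> ('l \<Rightarrow> 'l \<Rightarrow> 'k) \<Rightarrow> 'l set \<Rightarrow> ('l \<Rightarrow> 'k) \<Rightarrow> 'l" where
  "hcor sc B H \<alpha> = sc (2 / fD B H \<alpha> \<alpha>) (teeH B H \<alpha>)"

definition chev_gens :: "('k::field \<Rightarrow> 'l::ab_group_add \<Rightarrow> 'l) \<Rightarrow> ('l \<Rightarrow> 'l \<Rightarrow> 'l) \<Rightarrow> ('l \<Rightarrow> 'l \<Rightarrow> 'k) \<Rightarrow> 'l set \<Rightarrow> nat \<Rightarrow> (nat \<Rightarrow> 'l \<Rightarrow> 'k) \<Rightarrow> (nat \<Rightarrow> 'l) \<Rightarrow> (nat \<Rightarrow> 'l) \<Rightarrow> bool" where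
  "chev_gens sc br B H l al ep em \<longleftrightarrow> (\<forall>i<l.
     ep i \<in> wsp sc br H UNIV (al i) \<and> em i \<in> wsp sc br H UNIV (- al i) \<and>
     br (hcor sc B H (al i)) (ep i) = sc 2 (ep i) \<and>
     br (hcor sc B H (al i)) (em i) = sc (- 2) (em i) \<and>
     br (ep i) (em i) = hcor sc B H (al i))"

definition gdot :: "('k::field \<Rightarrow> 'l::ab_group_add \<Rightarrow> 'l) \<Rightarrow> ('l \<Rightarrow> 'l \<Rightarrow> 'l) \<Rightarrow> nat \<Rightarrow> (nat \<Rightarrow> 'l) \<Rightarrow> (nat \<Rightarrow> 'l) \<Rightarrow> 'l set" where
  "gdot sc br l ep em = gen_subalg sc br ({ep i | i. i < l} \<union> {em i | i. i < l})"

definition Hdot :: "('k::field \<Rightarrow> 'l::ab_group_add \<Rightarrow> 'l) \<Rightarrow> ('l \<Rightarrow> 'l \<Rightarrow> 'k) \<Rightarrow> 'l set \<Rightarrow> nat \<Rightarrow> (nat \<Rightarrow> 'l \<Rightarrow> 'k) \<Rightarrow> 'l set" where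
  "Hdot sc B H l al = module.span sc {teeH B H (al i) | i. i < l}"

fun lcs :: "('k::field \<Rightarrow> 'l::ab_group_add \<Rightarrow> 'l) \<Rightarrow> ('l \<Rightarrow> 'l \<Rightarrow> 'l) \<Rightarrow> 'l set \<Rightarrow> nat \<Rightarrow> 'l set" where
  "lcs sc br K 0 = K"
| "lcs sc br K (Suc n) = module.span sc {br x y | x y. x \<in> K \<and> y \<in> lcs sc br K n}"

text \<open>g is a finite-dimensional split simple Lie algebra (subalgebra of the
  ambient algebra) with splitting Cartan subalgebra h (nilpotent and
  self-normalizing, ad h diagonalizable) whose root system is Dred (elements of
  Dred being functionals on H, restricted to h)\<close>
definition split_simple_pair :: "('k::field \<Rightarrow> 'l::ab_group_add \<Rightarrow> 'l) \<Rightarrow> ('l \<Rightarrow> 'l \<Rightarrow> 'l) \<Rightarrow> 'l set \<Rightarrow> 'l set \<Rightarrow> ('l \<Rightarrow> 'k) set \<Rightarrow> bool" where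
  "split_simple_pair sc br g h Dred \<longleftrightarrow>
     lsubalg sc br g \<and> (\<exists>S. finite S \<and> module.span sc S = g) \<and>
     (\<exists>x\<in>g. \<exists>y\<in>g. br x y \<noteq> 0) \<and>
     (\<forall>I. module.subspace sc I \<and> I \<subseteq> g \<and> (\<forall>x\<in>g. \<forall>y\<in>I. br x y \<in> I) \<longrightarrow> I = {0} \<or> I = g) \<and>
     lsubalg sc br h \<and> h \<subseteq> g \<and> (\<exists>n. lcs sc br h n = {0}) \<and>
     {x\<in>g. \<forall>y\<in>h. br x y \<in> h} = h \<and>
     is_dsum (\<lambda>\<mu>. wsp sc br h g \<mu>) Dred g \<and>
     (\<forall>\<mu>\<in>Dred. \<mu> \<noteq> 0 \<longrightarrow> wsp sc br h g \<mu> \<noteq> {0})"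

definition root_graded :: "('k::field \<Rightarrow> 'l::ab_group_add \<Rightarrow> 'l) \<Rightarrow> ('l \<Rightarrow> 'l \<Rightarrow> 'l) \<Rightarrow> 'l set \<Rightarrow> 'l set \<Rightarrow> 'l set \<Rightarrow> ('l \<Rightarrow> 'k) set \<Rightarrow> bool" where
  "root_graded sc br Lc g h D \<longleftrightarrow>
     lsubalg sc br Lc \<and> split_simple_pair sc br g h (Rred D) \<and> g \<subseteq> Lc \<and>
     is_dsum (\<lambda>\<mu>. wsp sc br h Lc \<mu>) D Lc \<and>
     wsp sc br h Lc 0 = module.span sc {br x y | x y \<mu>. \<mu> \<in> D - {0} \<and>
        x \<in> wsp sc br h Lc \<mu> \<and> y \<in> wsp sc br h Lc (- \<mu>)}"

definition group_graded :: "('k::field \<Rightarrow> 'l::ab_group_add \<Rightarrow> 'l) \<Rightarrow> ('l \<Rightarrow> 'l \<Rightarrow> 'l) \<Rightarrow> 'l set \<Rightarrow> 'l set \<Rightarrow> (('l \<Rightarrow> 'k) \<Rightarrow> 'l set) \<Rightarrow> ('l \<Rightarrow> 'k) set \<Rightarrow> bool" where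
  "group_graded sc br Lc g Gr G \<longleftrightarrow>
     (\<forall>\<sigma>\<in>G. module.subspace sc (Gr \<sigma>)) \<and> is_dsum Gr G Lc \<and>
     (\<forall>\<sigma>\<in>G. \<forall>\<tau>\<in>G. \<forall>x\<in>Gr \<sigma>. \<forall>y\<in>Gr \<tau>. br x y \<in> Gr (\<sigma> + \<tau>)) \<and>
     g \<subseteq> Gr 0 \<and> zspan {\<sigma>\<in>G. Gr \<sigma> \<noteq> {0}} = G"

definition lcenter :: "('l \<Rightarrow> 'l \<Rightarrow> 'l::zero) \<Rightarrow> 'l set \<Rightarrow> 'l set" where
  "lcenter br X = {z\<in>X. \<forall>x\<in>X. br z x = 0}"

definition division_graded :: "('k::field \<Rightarrow> 'l::ab_group_add \<Rightarrow> 'l) \<Rightarrow> ('l \<Rightarrow> 'l \<Rightarrow> 'l) \<Rightarrow> ('l \<Rightarrow> 'l \<Rightarrow> 'k) \<Rightarrow> 'l set \<Rightarrow> 'l set \<Rightarrow> 'l set \<Rightarrow> 'l set \<Rightarrow> ('l \<Rightarrow> 'k) set \<Rightarrow> (('l \<Rightarrow> 'k) \<Rightarrow> 'l set) \<Rightarrow> ('l \<Rightarrow> 'k) set \<Rightarrow> bool" where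
  "division_graded sc br B H Lc g h D Gr G \<longleftrightarrow>
     root_graded sc br Lc g h D \<and> group_graded sc br Lc g Gr G \<and>
     (\<forall>\<mu>\<in>D - {0}. \<forall>\<sigma>\<in>G. \<forall>x\<in>Gr \<sigma> \<inter> wsp sc br h Lc \<mu>. x \<noteq> 0 \<longrightarrow>
        (\<exists>y\<in>Gr (- \<sigma>) \<inter> wsp sc br h Lc (- \<mu>). br x y - teeH B H \<mu> \<in> lcenter br Lc))"

definition Lsig :: "('k::field \<Rightarrow> 'l::ab_group_add \<Rightarrow> 'l) \<Rightarrow> ('l \<Rightarrow> 'l \<Rightarrow> 'l) \<Rightarrow> 'l set \<Rightarrow> ('l \<Rightarrow> 'k) set \<Rightarrow> ('l \<Rightarrow> 'k) \<Rightarrow> 'l set" where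
  "Lsig sc br H D \<sigma> = module.span sc (\<Union>\<mu>\<in>D. wsp sc br H UNIV (\<mu> + \<sigma>))"

end

theory Submission
  imports Defs "HOL-Library.FuncSet"
begin

text \<open>The representation theory of sl2 makes root strings unbroken and the Cartan numbers integral;
  the Heisenberg pairs \<open>[x, y] = t\<close> of isotropic roots force these roots into the radical. Rank two
  arguments then bound the Cartan numbers and make all norms of nonisotropic roots positive
  rational multiples of each other, so heights in the base can be lowered by simple reflections.
  This descent identifies the weights of the subalgebra generated by the Chevalley generators with
  the reduced roots (each of multiplicity one) and yields its simplicity. Finally, roots that agree
  modulo the radical differ by an isotropic root, which gives the grading of the core by the
  lattice of isotropic roots; the elements \<open>t\<close> of that lattice are central, which is the division
  property.\<close>

text \<open>Signs and bounds are extracted from integrality. The decisive point is that reflecting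
  two roots in each other multiplies their product by a b - 3, with a and b the Cartan numbers; for
  a b < 0 this would make the Cartan numbers too large. Connectedness of the nonisotropic roots then
  spreads positivity of norm ratios, and a bound on Cartan numbers gives finiteness. The facts of
  the standard setup on the finite root system (finiteness, reduced roots lying in R, all roots
  lying in the finite system plus the lattice) are derived here. Since the finite system may be
  non-reduced, doubles of simple roots accompany every descent.\<close>

subsection \<open>Linear algebra\<close>

context vector_space
begin

text \<open>Cutting down to the kernel of one functional at a time reduces the vanishing condition
  to the empty family. Serves both to produce the vectors \<open>tee \<alpha>\<close> from the form
  on H and to invert a rational matrix.\<close>

lemma functional_in_span_of_functionals:
  fixes \<phi> :: "'i \<Rightarrow> 'b \<Rightarrow> 'a"
  assumes "finite S" "subspace K"
    and "\<And>s a x y. s \<in> S \<Longrightarrow> x \<in> K \<Longrightarrow> y \<in> K \<Longrightarrow> \<phi> s (scale a x + y) = a * \<phi> s x + \<phi> s y"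
    and "\<And>a x y. x \<in> K \<Longrightarrow> y \<in> K \<Longrightarrow> \<alpha> (scale a x + y) = a * \<alpha> x + \<alpha> y"
    and "\<And>x. x \<in> K \<Longrightarrow> (\<forall>s\<in>S. \<phi> s x = 0) \<Longrightarrow> \<alpha> x = 0"
  shows "\<exists>c. \<forall>x\<in>K. \<alpha> x = (\<Sum>s\<in>S. c s * \<phi> s x)"
  using assms
proof (induction S arbitrary: K \<alpha> rule: finite_induct)
  case empty
  then show ?case by auto
next
  case (insert s S)
  let ?K = "{x\<in>K. \<phi> s x = 0}"
  have z: "\<phi> s 0 = 0"
    using insert.prems(2)[of s 0 0 "- 1"] subspace_0[OF insert.prems(1)] by simp
  have "\<phi> s (x + y) = \<phi> s x + \<phi> s y" "\<phi> s (scale c x) = c * \<phi> s x" if "x \<in> K" "y \<in> K" for x y c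
    using insert.prems(2)[of s x y 1] insert.prems(2)[of s x 0 c] z that subspace_0[OF insert.prems(1)] by simp_all
  then have subK: "subspace ?K" using insert.prems(1) z by (auto simp: subspace_def)
  have "\<exists>c. \<forall>x\<in>?K. \<alpha> x = (\<Sum>s\<in>S. c s * \<phi> s x)"
    by (rule insert.IH[OF subK]) (use insert.prems in auto)
  then obtain c where c: "\<And>x. x \<in> ?K \<Longrightarrow> \<alpha> x = (\<Sum>s\<in>S. c s * \<phi> s x)" by blast
  show ?case
  proof (cases "\<forall>x\<in>K. \<phi> s x = 0")
    case True
    then show ?thesis
      using c insert.hyps by (intro exI[of _ c]) auto
  next
    case False
    then obtain u where u: "u \<in> K" "\<phi> s u \<noteq> 0" by blast
    \<comment> \<open>The value at \<open>u\<close> forces this coefficient. Every other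
      \<open>x\<close> is corrected by the multiple of \<open>u\<close> that moves it into the
      kernel of \<open>\<phi> s\<close>, where the induction hypothesis applies.\<close>
    define d where "d = (\<alpha> u - (\<Sum>t\<in>S. c t * \<phi> t u)) / \<phi> s u"
    have "\<alpha> x = (\<Sum>t\<in>insert s S. (c(s := d)) t * \<phi> t x)" if x: "x \<in> K" for x
    proof -
      define a where "a = - (\<phi> s x / \<phi> s u)"
      let ?y = "scale a u + x"
      have y: "?y \<in> ?K"
        using u x insert.prems(2)[of s u x a] insert.prems(1)
        by (auto simp: a_def subspace_add subspace_scale subspace_diff)
      have "a * \<alpha> u + \<alpha> x = (\<Sum>t\<in>S. c t * \<phi> t ?y)"
        using c[OF y] insert.prems(3)[OF u(1) x, of a] by simp
      also have "\<dots> = (\<Sum>t\<in>S. a * (c t * \<phi> t u) + c t * \<phi> t x)"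
        using insert.prems(2) u x by (intro sum.cong) (auto simp: algebra_simps)
      also have "\<dots> = a * (\<Sum>t\<in>S. c t * \<phi> t u) + (\<Sum>t\<in>S. c t * \<phi> t x)"
        by (simp add: sum.distrib sum_distrib_left)
      finally have "\<alpha> x = d * \<phi> s x + (\<Sum>t\<in>S. c t * \<phi> t x)"
        using u by (simp add: a_def d_def field_simps)
      also have "(\<Sum>t\<in>S. c t * \<phi> t x) = (\<Sum>t\<in>S. (c(s := d)) t * \<phi> t x)"
        using insert.hyps by (intro sum.cong) auto
      finally show ?thesis using insert.hyps by simp
    qed
    then show ?thesis by blast
  qed
qed

end

text \<open>A trivial kernel over the rationals is witnessed by a rational identity: the k-th
  coordinate is a rational combination of the column sums. Such an identity persists over every
  field of characteristic 0.\<close>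

lemma rat_kernel_extension:
  fixes M :: "nat \<Rightarrow> nat \<Rightarrow> rat" and c :: "nat \<Rightarrow> 'k::field_char_0"
  assumes ker: "\<And>d :: nat \<Rightarrow> rat. (\<And>j. j < l \<Longrightarrow> (\<Sum>i<l. d i * M i j) = 0) \<Longrightarrow> \<forall>i<l. d i = 0"
    and c: "\<And>j. j < l \<Longrightarrow> (\<Sum>i<l. c i * of_rat (M i j)) = 0"
    and k: "k < l"
  shows "c k = 0"
proof -
  interpret V: vector_space "\<lambda>a (f :: nat \<Rightarrow> rat) i. a * f i"
    by unfold_locales (auto simp: fun_eq_iff algebra_simps)
  have "\<exists>N. \<forall>d\<in>UNIV. d k = (\<Sum>j\<in>{..<l}. N j * (\<Sum>i<l. d i * M i j))"
    by (rule V.functional_in_span_of_functionals)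
       (use ker k in \<open>auto simp: V.subspace_def algebra_simps sum.distrib sum_distrib_left\<close>)
  then obtain N where N: "\<And>d :: nat \<Rightarrow> rat. d k = (\<Sum>j<l. N j * (\<Sum>i<l. d i * M i j))" by blast
  \<comment> \<open>Evaluation at unit vectors shows that \<open>N\<close> is the k-th column of a
    right inverse of \<open>M\<close>.\<close>
  have inv: "(\<Sum>j<l. N j * M i j) = (if i = k then 1 else 0)" if "i < l" for i
  proof -
    have "(\<Sum>i'<l. (if i' = i then 1 else 0) * M i' j) = M i j" for j
      using that by (simp add: sum.delta' if_distrib[of "\<lambda>x. x * _"] cong: if_cong)
    then show ?thesis using N[of "\<lambda>i'. if i' = i then 1 else 0"] by auto
  qed
  have "0 = (\<Sum>j<l. of_rat (N j) * (\<Sum>i<l. c i * of_rat (M i j)))"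
    using c by simp
  also have "\<dots> = (\<Sum>j<l. \<Sum>i<l. c i * (of_rat (N j) * of_rat (M i j)))"
    by (simp add: sum_distrib_left algebra_simps)
  also have "\<dots> = (\<Sum>i<l. \<Sum>j<l. c i * (of_rat (N j) * of_rat (M i j)))"
    by (rule sum.swap)
  also have "\<dots> = (\<Sum>i<l. c i * of_rat (\<Sum>j<l. N j * M i j))"
    by (simp add: sum_distrib_left of_rat_sum of_rat_mult)
  also have "\<dots> = (\<Sum>i<l. c i * (if i = k then 1 else 0))"
    using inv by (intro sum.cong) auto
  also have "\<dots> = c k"
    using k by (simp add: sum.delta if_distrib[of "\<lambda>x. _ * x"] cong: if_cong)
  finally show ?thesis by simp
qed

subsection \<open>Integrable representations of sl2\<close>

text \<open>\<open>W \<lambda>\<close> is the eigenspace of the operator \<open>h = [e, f]\<close> for the eigenvalue \<open>\<lambda>\<close>.\<close>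

locale sl2_module = vector_space sc
  for sc :: "'k::field_char_0 \<Rightarrow> 'v::ab_group_add \<Rightarrow> 'v" +
  fixes e f :: "'v \<Rightarrow> 'v" and W :: "'k \<Rightarrow> 'v set"
  assumes e_lin: "e (x + y) = e x + e y" "e (sc a x) = sc a (e x)"
    and f_lin: "f (x + y) = f x + f y" "f (sc a x) = sc a (f x)"
    and e_W: "v \<in> W a \<Longrightarrow> e v \<in> W (a + 2)"
    and f_W: "v \<in> W a \<Longrightarrow> f v \<in> W (a - 2)"
    and ef: "v \<in> W a \<Longrightarrow> e (f v) = f (e v) + sc a v"
    and e_nil: "\<exists>n. (e ^^ n) v = 0"
    and f_nil: "\<exists>n. (f ^^ n) v = 0"
begin

text \<open>The Chevalley involution: exchanging e and f and negating weights keeps all axioms, so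
  each statement about lowering yields one about raising.\<close>

lemma flip: "sl2_module sc f e (\<lambda>a. W (- a))"
proof unfold_locales
  fix v a assume v: "v \<in> W (- a)"
  show "f v \<in> W (- (a + 2))" using f_W[OF v] by simp
  show "e v \<in> W (- (a - 2))" using e_W[OF v] by simp
  show "f (e v) = e (f v) + sc a v" using ef[OF v] by simp
qed (use e_lin f_lin e_nil f_nil in auto)

lemma e0 [simp]: "e 0 = 0" using e_lin(2)[of 0 0] by simp
lemma f0 [simp]: "f 0 = 0" using f_lin(2)[of 0 0] by simp

lemma f_pow_W: "v \<in> W a \<Longrightarrow> (f ^^ n) v \<in> W (a - 2 * of_nat n)"
proof (induction n)
  case (Suc n)
  from f_W[OF Suc.IH[OF Suc.prems]] show ?case by (simp add: algebra_simps)
qed simp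

text \<open>The scalar is the sum of the weights a, a - 2, ..., a - 2 n met while e is moved past
  the factors f.\<close>

lemma e_f_pow:
  assumes "v \<in> W a"
  shows "e ((f ^^ Suc n) v) = (f ^^ Suc n) (e v) + sc (of_nat (Suc n) * (a - of_nat n)) ((f ^^ n) v)"
proof (induction n)
  case 0
  then show ?case using ef[OF assms] by simp
next
  case (Suc n)
  have "e ((f ^^ Suc (Suc n)) v) = f (e ((f ^^ Suc n) v)) + sc (a - 2 * of_nat (Suc n)) ((f ^^ Suc n) v)"
    using ef[OF f_pow_W[OF assms, of "Suc n"]] by simp
  also have "f (e ((f ^^ Suc n) v)) =
      (f ^^ Suc (Suc n)) (e v) + sc (of_nat (Suc n) * (a - of_nat n)) ((f ^^ Suc n) v)"
    unfolding Suc.IH by (simp add: f_lin)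
  finally show ?case
    by (simp add: scale_left_distrib[symmetric] add.assoc) (simp add: algebra_simps)
qed

text \<open>At the last nonzero power \<open>(f ^^ n) v\<close> the commutation formula leaves only
  the scalar (n + 1) (a - n), which must vanish.\<close>

lemma highest_weight_nat:
  assumes "v \<in> W a" "v \<noteq> 0" "e v = 0"
  shows "\<exists>n::nat. a = of_nat n"
proof -
  define m where "m = (LEAST n. (f ^^ n) v = 0)"
  have m: "(f ^^ m) v = 0" unfolding m_def using f_nil by (rule LeastI_ex)
  then have "m \<noteq> 0" using assms by (metis funpow_0)
  then obtain n where n: "m = Suc n" by (cases m) auto
  have "(f ^^ n) v \<noteq> 0" using not_less_Least[of n "\<lambda>n. (f ^^ n) v = 0"] n m_def by simp
  moreover have "(f ^^ k) 0 = 0" for k by (induction k) auto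
  ultimately have "of_nat (Suc n) * (a - of_nat n) = (0::'k)"
    using e_f_pow[OF assms(1), of n] m n assms(3) by (simp del: of_nat_Suc funpow.simps)
  then have "a = of_nat n" by (simp del: of_nat_Suc)
  then show ?thesis by blast
qed

lemma e_pow_W: "v \<in> W a \<Longrightarrow> (e ^^ n) v \<in> W (a + 2 * of_nat n)"
  using sl2_module.f_pow_W[OF flip, of v "- a" n] by (simp add: algebra_simps)

text \<open>Raising v until the next step gives 0 reaches a highest weight vector, and the weight
  changes by even integers only.\<close>

lemma weight_int:
  assumes "v \<in> W a" "v \<noteq> 0"
  shows "\<exists>k::int. a = of_int k"
proof -
  define m where "m = (LEAST n. (e ^^ n) v = 0)"
  have m: "(e ^^ m) v = 0" unfolding m_def using e_nil by (rule LeastI_ex)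
  then have "m \<noteq> 0" using assms by (metis funpow_0)
  then obtain n where n: "m = Suc n" by (cases m) auto
  have "(e ^^ n) v \<noteq> 0" using not_less_Least[of n "\<lambda>n. (e ^^ n) v = 0"] n m_def by simp
  from highest_weight_nat[OF e_pow_W[OF assms(1)] this] m n
  obtain k :: nat where "a + 2 * of_nat n = of_nat k" by auto
  then have "a = of_int (int k - 2 * int n)" by (simp add: algebra_simps)
  then show ?thesis by blast
qed

text \<open>Induction on the order of nilpotency of \<open>f\<close> on \<open>v\<close>: the vector \<open>f v\<close> has weight
  \<open>- (m + 2)\<close> and is killed by \<open>e ^^ (m + 2)\<close>, so \<open>v\<close> is a lowest weight vector.\<close>

lemma e_pow_inj:
  assumes "v \<in> W (- of_nat m)" "(e ^^ m) v = 0"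
  shows "v = 0"
proof -
  note fe = sl2_module.e_f_pow[OF flip]
  obtain n where "(f ^^ n) v = 0" using f_nil by blast
  then show ?thesis using assms
  proof (induction n arbitrary: v m)
    case 0
    then show ?case by simp
  next
    case (Suc n)
    have v: "v \<in> W (- of_nat m)" by fact
    have fv: "f v \<in> W (- of_nat (m + 2))"
      using f_W[OF v] by (simp add: algebra_simps)
    have e1: "(e ^^ Suc m) v = 0" "(e ^^ Suc (Suc m)) v = 0" using Suc.prems by auto
    \<comment> \<open>The correction term contains \<open>(e ^^ Suc m) v\<close>, which is already
      0.\<close>
    have "f ((e ^^ Suc (Suc m)) v) = (e ^^ Suc (Suc m)) (f v)
        + sc (of_nat (Suc (Suc m)) * (of_nat m - of_nat (Suc m))) ((e ^^ Suc m) v)"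
      by (rule fe) (use v in simp)
    then have "(e ^^ (m + 2)) (f v) = 0" using e1 by (simp del: of_nat_Suc)
    moreover have "(f ^^ n) (f v) = 0" using Suc.prems(1) by (simp add: funpow_swap1)
    ultimately have "f v = 0" using Suc.IH fv by blast
    moreover have "(e ^^ n) 0 = 0" for n by (induction n) auto
    ultimately have step: "f ((e ^^ Suc k) v) = sc (of_nat (Suc k) * (of_nat m - of_nat k)) ((e ^^ k) v)" for k
      using fe[of v "of_nat m" k] v by (simp del: funpow.simps of_nat_Suc)
    \<comment> \<open>For k < m the scalar (k + 1) (m - k) is nonzero in characteristic 0, so
      vanishing passes from each power of e to the previous one, from exponent m down to v
      itself.\<close>
    have down: "(e ^^ k) v = 0" if "(e ^^ Suc k) v = 0" "k < m" for k
    proof -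
      have "sc (of_nat (Suc k) * (of_nat m - of_nat k)) ((e ^^ k) v) = 0"
        using step[of k] that(1) by simp
      moreover have "of_nat (Suc k) * (of_nat m - of_nat k) \<noteq> (0::'k)"
        using that(2) by (simp del: of_nat_Suc)
      ultimately show ?thesis by simp
    qed
    have "(e ^^ (m - k)) v = 0" for k
    proof (induction k)
      case 0
      then show ?case using Suc.prems by simp
    next
      case (Suc k)
      show ?case
      proof (cases "k < m")
        case True
        then show ?thesis using down[of "m - Suc k"] Suc.IH by (simp add: Suc_diff_Suc)
      next
        case False
        then show ?thesis using Suc.IH by simp
      qed
    qed
    from this[of m] show ?case by simp
  qed
qed

lemma f_pow_inj:
  assumes "v \<in> W (of_nat m)" "(f ^^ m) v = 0"
  shows "v = 0"
  using sl2_module.e_pow_inj[OF flip, of v m] assms by simp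

end

subsection \<open>Lie algebras with a toral subalgebra\<close>

locale toral_lie = vector_space sc
  for sc :: "'k::field_char_0 \<Rightarrow> 'l::ab_group_add \<Rightarrow> 'l" +
  fixes br :: "'l \<Rightarrow> 'l \<Rightarrow> 'l" and B :: "'l \<Rightarrow> 'l \<Rightarrow> 'k" and H :: "'l set"
  assumes classT: "classT sc br B H"
begin

abbreviation "L \<equiv> wsp sc br H UNIV"
abbreviation "Hs \<equiv> ldual sc H"
abbreviation "R \<equiv> lroots sc br H"
abbreviation "RX \<equiv> rootsX sc br B H"
abbreviation "R0 \<equiv> roots0 sc br B H"
abbreviation "tee \<equiv> teeH B H"
abbreviation "ip \<equiv> fD B H"

lemmas classT_conj = classT[unfolded classT_def]

lemma lie: "is_lie sc br" and form: "inv_form sc br B" and tor: "toral sc br H"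
  and H_fin: "\<exists>S. finite S \<and> span S = H"
  and H_nondeg_ball: "\<forall>x\<in>H. (\<forall>y\<in>H. B x y = 0) \<longrightarrow> x = 0"
  and root_div0: "\<forall>\<delta>\<in>R0. \<exists>x\<in>L \<delta>. \<exists>y\<in>L (- \<delta>). br x y = tee \<delta>"
  and root_divX: "\<forall>\<alpha>\<in>RX. \<forall>x\<in>L \<alpha>. x \<noteq> 0 \<longrightarrow> (\<exists>y\<in>L (- \<alpha>). br x y = tee \<alpha>)"
  and ad_nil: "\<forall>\<alpha>\<in>RX. \<forall>x\<in>L \<alpha>. \<forall>y. \<exists>n. (br x ^^ n) y = 0"
  and RX_conn: "\<not> (\<exists>P Q. P \<noteq> {} \<and> Q \<noteq> {} \<and> P \<inter> Q = {} \<and> P \<union> Q = RX \<and> (\<forall>a\<in>P. \<forall>b\<in>Q. ip a b = 0))"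
  and R0_nonisolated: "\<forall>\<delta>\<in>R0. \<exists>\<alpha>\<in>RX. \<alpha> + \<delta> \<in> R"
  by (insert classT_conj, (elim conjE, assumption)+)

section \<open>Bilinearity, antisymmetry and the derivation rule\<close>

lemma br_add_left: "br (x + y) z = br x z + br y z"
  and br_scale_left: "br (sc a x) z = sc a (br x z)"
  and br_self [simp]: "br x x = 0"
proof -
  have l: "br (sc a x + y) z = sc a (br x z) + br y z" for a x y z
    using lie unfolding is_lie_def by blast
  show add: "br (x + y) z = br x z + br y z" for x y
    using l[of 1 x y] by simp
  have "br 0 z = 0" using add[of 0 0] by simp
  then show "br (sc a x) z = sc a (br x z)"
    using l[of a x 0] by simp
  show "br x x = 0" using lie unfolding is_lie_def by blast
qed

lemma B_add_left: "B (x + y) z = B x z + B y z"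
  and B_scale_left: "B (sc a x) z = a * B x z"
  and B_sym: "B x y = B y x"
  and B_inv: "B (br x y) z = B x (br y z)"
  and B_nondeg: "(\<And>y. B x y = 0) \<Longrightarrow> x = 0"
proof -
  have l: "B (sc a x + y) z = a * B x z + B y z" for a x y z
    using form unfolding inv_form_def by blast
  show add: "B (x + y) z = B x z + B y z" for x y
    using l[of 1 x y] by simp
  have "B 0 z = 0" using add[of 0 0] by simp
  then show "B (sc a x) z = a * B x z"
    using l[of a x 0] by simp
  show "B x y = B y x" "B (br x y) z = B x (br y z)" "(\<And>y. B x y = 0) \<Longrightarrow> x = 0"
    using form unfolding inv_form_def by blast+
qed

lemma B_add_right: "B z (x + y) = B z x + B z y"
  and B_scale_right: "B z (sc a x) = a * B z x"
  using B_add_left[of x y z] B_scale_left[of a x z] by (simp_all add: B_sym)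

lemma B_zero [simp]: "B 0 z = 0" "B z 0 = 0"
  using B_scale_left[of 0 0 z] B_scale_right[of z 0 0] by simp_all

lemma B_diff_left: "B (x - y) z = B x z - B y z"
  using B_add_left[of "x - y" y z] by simp

lemma B_sum_left: "B (\<Sum>i\<in>S. f i) z = (\<Sum>i\<in>S. B (f i) z)"
  by (induction S rule: infinite_finite_induct) (auto simp: B_add_left)

lemma B_eqI: "(\<And>w. B w x = B w y) \<Longrightarrow> x = y"
  using B_nondeg[of "x - y"] B_diff_left by (metis B_sym cancel_comm_monoid_add_class.diff_cancel eq_iff_diff_eq_0)

text \<open>The axioms give linearity of the bracket in the first argument only; linearity in the
  second argument comes from the invariant form.\<close>

lemma br_add_right: "br z (x + y) = br z x + br z y"
  by (rule B_eqI) (simp add: B_inv[symmetric] B_add_right)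

lemma br_scale_right: "br z (sc a x) = sc a (br z x)"
  by (rule B_eqI) (simp add: B_inv[symmetric] B_scale_right)

lemma br_zero [simp]: "br 0 z = 0" "br z 0 = 0"
  using br_scale_left[of 0 0 z] br_scale_right[of z 0 0] by simp_all

lemma br_minus_left: "br (- x) z = - br x z"
  and br_minus_right: "br z (- x) = - br z x"
  using br_scale_left[of "- 1" x z] br_scale_right[of z "- 1" x] by simp_all

lemma br_sum_right: "br z (\<Sum>i\<in>S. f i) = (\<Sum>i\<in>S. br z (f i))"
  by (induction S rule: infinite_finite_induct) (auto simp: br_add_right)

lemma br_anti: "br x y = - br y x"
proof -
  have "0 = br (x + y) (x + y)" by simp
  also have "\<dots> = br x y + br y x"
    by (simp add: br_add_left br_add_right del: br_self) (simp)
  finally show ?thesis by (simp add: eq_neg_iff_add_eq_0)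
qed

lemma br_br: "br x (br y z) = br (br x y) z + br y (br x z)"
proof -
  have "br x (br y z) + br y (br z x) + br z (br x y) = 0"
    using lie unfolding is_lie_def by blast
  moreover have "br y (br z x) = - br y (br x z)"
    using br_anti[of z x] by (simp add: br_minus_right)
  moreover have "br z (br x y) = - br (br x y) z" by (rule br_anti)
  ultimately show ?thesis by (simp add: algebra_simps)
qed

section \<open>Generated subalgebras, spans and weight components\<close>

lemma lsubalg_subspace: "lsubalg sc br K \<Longrightarrow> subspace K"
  and lsubalg_br: "lsubalg sc br K \<Longrightarrow> x \<in> K \<Longrightarrow> y \<in> K \<Longrightarrow> br x y \<in> K"
  unfolding lsubalg_def by auto

lemma gen_subalg_lsubalg: "lsubalg sc br (gen_subalg sc br S)"
  unfolding lsubalg_def gen_subalg_def by (auto intro!: subspace_Inter)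

lemma gen_subalg_base: "x \<in> S \<Longrightarrow> x \<in> gen_subalg sc br S"
  unfolding gen_subalg_def by auto

lemma gen_subalg_least: "lsubalg sc br K \<Longrightarrow> S \<subseteq> K \<Longrightarrow> gen_subalg sc br S \<subseteq> K"
  unfolding gen_subalg_def by auto

text \<open>ad h is a derivation, so the elements of the generated subalgebra that it keeps inside
  form a subalgebra; checking generators suffices. Meant for h in H, which may lie outside the
  subalgebra.\<close>

lemma gen_subalg_stable_ad:
  assumes "\<And>s. s \<in> S \<Longrightarrow> br h s \<in> gen_subalg sc br S" "x \<in> gen_subalg sc br S"
  shows "br h x \<in> gen_subalg sc br S"
proof -
  let ?G = "gen_subalg sc br S"
  let ?K = "{x \<in> ?G. br h x \<in> ?G}"
  note sG = lsubalg_subspace[OF gen_subalg_lsubalg[of S]]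
  have "lsubalg sc br ?K"
    unfolding lsubalg_def
  proof
    show "subspace ?K"
      using sG unfolding subspace_def by (auto simp: br_add_right br_scale_right)
    show "\<forall>x\<in>?K. \<forall>y\<in>?K. br x y \<in> ?K"
      by (auto simp: br_br[of h] intro!: lsubalg_br[OF gen_subalg_lsubalg] subspace_add[OF sG])
  qed
  then have "?G \<subseteq> ?K" by (rule gen_subalg_least) (use assms(1) gen_subalg_base in auto)
  then show ?thesis using assms(2) by auto
qed

lemma span_stable:
  assumes "\<And>s. s \<in> S \<Longrightarrow> br x s \<in> span T" "y \<in> span S"
  shows "br x y \<in> span T"
proof -
  have "span S \<subseteq> {y. br x y \<in> span T}"
    by (rule span_minimal)
       (use assms(1) in \<open>auto simp: subspace_def br_add_right br_scale_right span_zero span_add span_scale\<close>)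
  then show ?thesis using assms(2) by auto
qed

lemma span_span_br:
  assumes "\<And>s t. s \<in> S \<Longrightarrow> t \<in> T \<Longrightarrow> br s t \<in> span U" "x \<in> span S" "y \<in> span T"
  shows "br x y \<in> span U"
proof -
  have "br s y \<in> span U" if "s \<in> S" for s
    using span_stable[of T s U y] assms that by blast
  then have "br y s \<in> span U" if "s \<in> S" for s
    using that span_neg[of "br s y" U] br_anti[of y s] by simp
  then have "br y x \<in> span U" using span_stable[of S y U x] assms(2) by blast
  then show ?thesis using span_neg[of "br y x" U] br_anti[of x y] by simp
qed

text \<open>For \<open>M = {0}\<close> this is the independence of weight spaces.\<close>

lemma components_in_stable_subspace:
  assumes M: "subspace M" "\<And>h x. h \<in> K \<Longrightarrow> x \<in> M \<Longrightarrow> br h x \<in> M"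
    and "finite S"
    and "\<And>\<mu> \<nu>. \<mu> \<in> S \<Longrightarrow> \<nu> \<in> S \<Longrightarrow> (\<And>h. h \<in> K \<Longrightarrow> \<mu> h = \<nu> h) \<Longrightarrow> \<mu> = \<nu>"
    and "\<And>\<mu>. \<mu> \<in> S \<Longrightarrow> f \<mu> \<in> wsp sc br K UNIV \<mu>"
    and "(\<Sum>\<mu>\<in>S. f \<mu>) \<in> M"
  shows "\<forall>\<mu>\<in>S. f \<mu> \<in> M"
  using assms(3-)
proof (induction S arbitrary: f rule: finite_induct)
  case (insert \<mu> S)
  have wt: "br h (f \<nu>) = sc (\<nu> h) (f \<nu>)" if "h \<in> K" "\<nu> \<in> insert \<mu> S" for h \<nu>
    using insert.prems(2)[OF that(2)] that(1) by (auto simp: wsp_def)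
  have "f \<nu> \<in> M" if \<nu>: "\<nu> \<in> S" for \<nu>
  proof -
    have "\<nu> \<noteq> \<mu>" using insert.hyps \<nu> by auto
    then obtain h where h: "h \<in> K" "\<nu> h \<noteq> \<mu> h"
      using insert.prems(1)[of \<nu> \<mu>] \<nu> by blast
    let ?g = "\<lambda>\<rho>. sc (\<rho> h - \<mu> h) (f \<rho>)"
    \<comment> \<open>Applying ad h minus the scalar \<open>\<mu> h\<close> kills the component at
      \<open>\<mu>\<close> and multiplies the one at \<open>\<nu>\<close> by a nonzero scalar, so a
      sum with one term fewer remains.\<close>
    have "br h (\<Sum>\<rho>\<in>insert \<mu> S. f \<rho>) - sc (\<mu> h) (\<Sum>\<rho>\<in>insert \<mu> S. f \<rho>) \<in> M"
      using M h insert.prems(3) by (intro subspace_diff subspace_scale) auto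
    also have "br h (\<Sum>\<rho>\<in>insert \<mu> S. f \<rho>) = (\<Sum>\<rho>\<in>insert \<mu> S. sc (\<rho> h) (f \<rho>))"
      unfolding br_sum_right by (rule sum.cong[OF refl]) (rule wt[OF h(1)])
    also have "(\<Sum>\<rho>\<in>insert \<mu> S. sc (\<rho> h) (f \<rho>)) - sc (\<mu> h) (\<Sum>\<rho>\<in>insert \<mu> S. f \<rho>) = (\<Sum>\<rho>\<in>insert \<mu> S. ?g \<rho>)"
      by (simp only: sum_subtractf scale_left_diff_distrib scale_sum_right)
    also have "\<dots> = (\<Sum>\<rho>\<in>S. ?g \<rho>)" using insert.hyps by simp
    finally have "(\<Sum>\<rho>\<in>S. ?g \<rho>) \<in> M" .
    moreover have "?g \<rho> \<in> wsp sc br K UNIV \<rho>" if "\<rho> \<in> S" for \<rho>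
      using wt that by (auto simp: wsp_def br_scale_right mult.commute)
    ultimately have "\<forall>\<rho>\<in>S. ?g \<rho> \<in> M"
      by (intro insert.IH) (use insert.prems(1) in auto)
    then have "sc (inverse (\<nu> h - \<mu> h)) (?g \<nu>) \<in> M"
      using \<nu> M(1) subspace_scale by blast
    then show ?thesis using h by simp
  qed
  moreover have "f \<mu> = (\<Sum>\<rho>\<in>insert \<mu> S. f \<rho>) - (\<Sum>\<rho>\<in>S. f \<rho>)"
    using insert.hyps by simp
  ultimately show ?case
    using M(1) insert.prems(3) by (metis (no_types, lifting) insert_iff subspace_diff subspace_sum)
qed simp

lemma weight_components_zero:
  assumes "finite S"
    and "\<And>\<mu> \<nu>. \<mu> \<in> S \<Longrightarrow> \<nu> \<in> S \<Longrightarrow> (\<And>h. h \<in> K \<Longrightarrow> \<mu> h = \<nu> h) \<Longrightarrow> \<mu> = \<nu>"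
    and "\<And>\<mu>. \<mu> \<in> S \<Longrightarrow> f \<mu> \<in> wsp sc br K UNIV \<mu>"
    and "(\<Sum>\<mu>\<in>S. f \<mu>) = 0"
  shows "\<forall>\<mu>\<in>S. f \<mu> = 0"
  using components_in_stable_subspace[of "{0}" K S f] assms by (auto simp: subspace_def)

lemma wsp_subspace: "subspace X \<Longrightarrow> subspace (wsp sc br K X \<mu>)"
  unfolding subspace_def wsp_def
  by (auto simp: br_add_right br_scale_right scale_right_distrib mult.commute)

text \<open>The map \<open>\<phi>\<close> lets a decomposition into root components serve for a
  coarser grading: terms of equal degree are collected into one summand.\<close>

lemma is_dsum_regroup:
  fixes A :: "'i \<Rightarrow> 'l set"
  assumes "\<And>i. i \<in> I \<Longrightarrow> A i \<subseteq> V" "\<And>i. i \<in> I \<Longrightarrow> subspace (A i)"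
    and "\<And>v. v \<in> V \<Longrightarrow> \<exists>T (g :: 'j \<Rightarrow> 'l) \<phi>. finite T \<and> (\<forall>t\<in>T. \<phi> t \<in> I \<and> g t \<in> A (\<phi> t)) \<and> v = (\<Sum>t\<in>T. g t)"
    and "\<And>S f. finite S \<Longrightarrow> S \<subseteq> I \<Longrightarrow> (\<And>i. i \<in> S \<Longrightarrow> f i \<in> A i) \<Longrightarrow> (\<Sum>i\<in>S. f i) = 0 \<Longrightarrow> \<forall>i\<in>S. f i = 0"
  shows "is_dsum A I V"
  unfolding is_dsum_def
proof (intro conjI ballI allI impI)
  fix v assume "v \<in> V"
  from assms(3)[OF this] obtain T and g :: "'j \<Rightarrow> 'l" and \<phi> where
    T: "finite T" "\<forall>t\<in>T. \<phi> t \<in> I \<and> g t \<in> A (\<phi> t)" "v = (\<Sum>t\<in>T. g t)" by auto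
  let ?f = "\<lambda>i. \<Sum>t\<in>{t\<in>T. \<phi> t = i}. g t"
  have "v = (\<Sum>i\<in>\<phi> ` T. ?f i)"
    using sum.image_gen[OF T(1), of g \<phi>] T(3) by simp
  moreover have "?f i \<in> A i" if "i \<in> \<phi> ` T" for i
    using that T(2) assms(2)[of i] by (intro subspace_sum) auto
  ultimately show "\<exists>S f. finite S \<and> S \<subseteq> I \<and> (\<forall>i\<in>S. f i \<in> A i) \<and> v = (\<Sum>i\<in>S. f i)"
    using T by (intro exI[of _ "\<phi> ` T"] exI[of _ ?f]) auto
next
  fix S f i assume "finite S \<and> S \<subseteq> I \<and> (\<forall>i\<in>S. f i \<in> A i) \<and> sum f S = 0" "i \<in> S"
  then show "f i = 0" using assms(4)[of S f] by blast
qed (use assms(1) in auto)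

subsection \<open>Functionals and the transferred form\<close>

lemma H_subalg: "lsubalg sc br H" and H_nz: "H \<noteq> {0}"
  and H_dsum: "is_dsum L Hs UNIV"
  using tor unfolding toral_def by auto

lemma H_subspace: "subspace H" using H_subalg lsubalg_subspace by blast

lemma HsD: "\<alpha> \<in> Hs \<Longrightarrow> x \<in> H \<Longrightarrow> y \<in> H \<Longrightarrow> \<alpha> (sc a x + y) = a * \<alpha> x + \<alpha> y"
  and Hs_off: "\<alpha> \<in> Hs \<Longrightarrow> x \<notin> H \<Longrightarrow> \<alpha> x = 0"
  unfolding ldual_def by auto

lemma Hs_zero_arg: "\<alpha> \<in> Hs \<Longrightarrow> \<alpha> 0 = 0"
  using HsD[of \<alpha> 0 0 "- 1"] subspace_0[OF H_subspace] by simp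

lemma Hs_scale_arg: "\<alpha> \<in> Hs \<Longrightarrow> x \<in> H \<Longrightarrow> \<alpha> (sc a x) = a * \<alpha> x"
  using HsD[of \<alpha> x 0 a] subspace_0[OF H_subspace] Hs_zero_arg by simp

lemma Hs_zero [simp]: "0 \<in> Hs"
  by (auto simp: ldual_def)

lemma Hs_add: "\<alpha> \<in> Hs \<Longrightarrow> \<beta> \<in> Hs \<Longrightarrow> \<alpha> + \<beta> \<in> Hs"
  and Hs_uminus: "\<alpha> \<in> Hs \<Longrightarrow> - \<alpha> \<in> Hs"
  and Hs_diff: "\<alpha> \<in> Hs \<Longrightarrow> \<beta> \<in> Hs \<Longrightarrow> \<alpha> - \<beta> \<in> Hs"
  by (auto simp: ldual_def algebra_simps)

lemma Hs_scale: "\<alpha> \<in> Hs \<Longrightarrow> (\<lambda>h. c * \<alpha> h) \<in> Hs"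
  by (auto simp: ldual_def algebra_simps)

lemma Hs_sum: "(\<And>i. i \<in> S \<Longrightarrow> g i \<in> Hs) \<Longrightarrow> (\<lambda>h. \<Sum>i\<in>S. c i * g i h) \<in> Hs"
proof (induction S rule: infinite_finite_induct)
  case (insert i S)
  have "(\<lambda>h. \<Sum>i\<in>insert i S. c i * g i h) = (\<lambda>h. c i * g i h) + (\<lambda>h. \<Sum>i\<in>S. c i * g i h)"
    using insert.hyps by (auto simp: fun_eq_iff)
  then show ?case using insert by (simp add: Hs_add Hs_scale)
qed (auto simp: ldual_def)

lemma Hs_eqI:
  assumes "\<alpha> \<in> Hs" "\<beta> \<in> Hs" "\<And>h. h \<in> H \<Longrightarrow> \<alpha> h = \<beta> h"
  shows "\<alpha> = \<beta>"
proof
  fix x show "\<alpha> x = \<beta> x"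
    using assms Hs_off[of \<alpha> x] Hs_off[of \<beta> x] by (cases "x \<in> H") simp_all
qed

lemma H_nondeg: "x \<in> H \<Longrightarrow> (\<And>y. y \<in> H \<Longrightarrow> B x y = 0) \<Longrightarrow> x = 0"
  using H_nondeg_ball by simp

text \<open>By nondegeneracy on H the functionals \<open>B s\<close>, with s in a finite spanning
  set, have common kernel 0 in H, so every functional on H is a combination of them.\<close>

lemma tee_ex1:
  assumes "\<alpha> \<in> Hs"
  shows "\<exists>!t. t \<in> H \<and> (\<forall>h\<in>H. B t h = \<alpha> h)"
proof -
  obtain S where S: "finite S" "span S = H" using H_fin by blast
  have SH: "S \<subseteq> H" using S span_superset by blast
  have "\<exists>c. \<forall>x\<in>H. \<alpha> x = (\<Sum>s\<in>S. c s * B s x)"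
  proof (rule functional_in_span_of_functionals[OF S(1) H_subspace])
    fix x assume x: "x \<in> H" "\<forall>s\<in>S. B s x = 0"
    have "subspace {y. B x y = 0}"
      by (auto simp: subspace_def B_add_right B_scale_right)
    then have "span S \<subseteq> {y. B x y = 0}"
      by (intro span_minimal) (use x B_sym in auto)
    then have "x = 0" using H_nondeg[of x] x S by auto
    then show "\<alpha> x = 0" using Hs_zero_arg assms by simp
  qed (use HsD[OF assms] in \<open>auto simp: B_add_right B_scale_right\<close>)
  then obtain c where c: "\<And>x. x \<in> H \<Longrightarrow> \<alpha> x = (\<Sum>s\<in>S. c s * B s x)" by blast
  let ?t = "\<Sum>s\<in>S. sc (c s) s"
  have "?t \<in> H" using SH H_subspace by (intro subspace_sum subspace_scale) auto
  moreover have "B ?t h = \<alpha> h" if "h \<in> H" for h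
    using c[OF that] by (simp add: B_sum_left B_scale_left)
  ultimately show ?thesis
  proof (intro ex1I[of _ ?t])
    fix t assume t: "t \<in> H \<and> (\<forall>h\<in>H. B t h = \<alpha> h)"
    have "t - ?t = 0"
      using H_nondeg[of "t - ?t"] t \<open>?t \<in> H\<close> \<open>\<And>h. h \<in> H \<Longrightarrow> B ?t h = \<alpha> h\<close> H_subspace
      by (auto simp: B_diff_left subspace_diff)
    then show "t = ?t" by simp
  qed auto
qed

lemma tee_H: "\<alpha> \<in> Hs \<Longrightarrow> tee \<alpha> \<in> H"
  and B_tee: "\<alpha> \<in> Hs \<Longrightarrow> h \<in> H \<Longrightarrow> B (tee \<alpha>) h = \<alpha> h"
  using theI'[OF tee_ex1] unfolding teeH_def by auto

lemma teeI: "\<alpha> \<in> Hs \<Longrightarrow> t \<in> H \<Longrightarrow> (\<And>h. h \<in> H \<Longrightarrow> B t h = \<alpha> h) \<Longrightarrow> tee \<alpha> = t"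
  using tee_ex1[of \<alpha>] tee_H[of \<alpha>] B_tee[of \<alpha>] by blast

lemma tee_add: "\<alpha> \<in> Hs \<Longrightarrow> \<beta> \<in> Hs \<Longrightarrow> tee (\<alpha> + \<beta>) = tee \<alpha> + tee \<beta>"
  by (rule teeI) (auto simp: Hs_add tee_H H_subspace subspace_add B_add_left B_tee)

lemma tee_diff: "\<alpha> \<in> Hs \<Longrightarrow> \<beta> \<in> Hs \<Longrightarrow> tee (\<alpha> - \<beta>) = tee \<alpha> - tee \<beta>"
  using tee_add[of "\<alpha> - \<beta>" \<beta>] Hs_diff by simp

lemma tee_scale: "\<alpha> \<in> Hs \<Longrightarrow> tee (\<lambda>h. c * \<alpha> h) = sc c (tee \<alpha>)"
  by (rule teeI) (auto simp: Hs_scale tee_H H_subspace subspace_scale B_scale_left B_tee)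

lemma tee_sum: "(\<And>i. i \<in> S \<Longrightarrow> g i \<in> Hs) \<Longrightarrow> tee (\<lambda>h. \<Sum>i\<in>S. c i * g i h) = (\<Sum>i\<in>S. sc (c i) (tee (g i)))"
proof (rule teeI)
  assume g: "\<And>i. i \<in> S \<Longrightarrow> g i \<in> Hs"
  show "(\<lambda>h. \<Sum>i\<in>S. c i * g i h) \<in> Hs" using g by (rule Hs_sum)
  show "(\<Sum>i\<in>S. sc (c i) (tee (g i))) \<in> H"
    using g by (intro subspace_sum subspace_scale H_subspace tee_H)
  show "B (\<Sum>i\<in>S. sc (c i) (tee (g i))) h = (\<Sum>i\<in>S. c i * g i h)" if "h \<in> H" for h
    using g that by (simp add: B_sum_left B_scale_left B_tee)
qed

lemma tee_eq_0: "\<alpha> \<in> Hs \<Longrightarrow> tee \<alpha> = 0 \<Longrightarrow> \<alpha> = 0"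
  using B_tee[of \<alpha>] Hs_eqI[of \<alpha> 0] by simp

lemma ip_eq1: "\<alpha> \<in> Hs \<Longrightarrow> \<beta> \<in> Hs \<Longrightarrow> ip \<alpha> \<beta> = \<alpha> (tee \<beta>)"
  by (simp add: fD_def B_tee tee_H)

lemma ip_sym: "ip \<alpha> \<beta> = ip \<beta> \<alpha>"
  by (simp add: fD_def B_sym)

lemma ip_add_left: "\<alpha> \<in> Hs \<Longrightarrow> \<beta> \<in> Hs \<Longrightarrow> ip (\<alpha> + \<beta>) \<gamma> = ip \<alpha> \<gamma> + ip \<beta> \<gamma>"
  and ip_diff_left: "\<alpha> \<in> Hs \<Longrightarrow> \<beta> \<in> Hs \<Longrightarrow> ip (\<alpha> - \<beta>) \<gamma> = ip \<alpha> \<gamma> - ip \<beta> \<gamma>"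
  and ip_scale_left: "\<alpha> \<in> Hs \<Longrightarrow> ip (\<lambda>h. c * \<alpha> h) \<gamma> = c * ip \<alpha> \<gamma>"
  by (simp_all add: fD_def tee_add tee_diff tee_scale B_add_left B_diff_left B_scale_left)

lemma ip_sum_left: "(\<And>i. i \<in> S \<Longrightarrow> g i \<in> Hs) \<Longrightarrow>
    ip (\<lambda>h. \<Sum>i\<in>S. c i * g i h) \<gamma> = (\<Sum>i\<in>S. c i * ip (g i) \<gamma>)"
  by (simp add: fD_def tee_sum B_sum_left B_scale_left)

lemma ip_add_right: "\<alpha> \<in> Hs \<Longrightarrow> \<beta> \<in> Hs \<Longrightarrow> ip \<gamma> (\<alpha> + \<beta>) = ip \<gamma> \<alpha> + ip \<gamma> \<beta>"
  and ip_diff_right: "\<alpha> \<in> Hs \<Longrightarrow> \<beta> \<in> Hs \<Longrightarrow> ip \<gamma> (\<alpha> - \<beta>) = ip \<gamma> \<alpha> - ip \<gamma> \<beta>"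
  and ip_scale_right: "\<alpha> \<in> Hs \<Longrightarrow> ip \<gamma> (\<lambda>h. c * \<alpha> h) = c * ip \<gamma> \<alpha>"
  unfolding ip_sym[of \<gamma>] by (simp_all add: ip_add_left ip_diff_left ip_scale_left)

lemma tee_zero [simp]: "tee 0 = 0"
  by (rule teeI) (auto simp: subspace_0 H_subspace)

lemma ip_zero [simp]: "ip 0 \<alpha> = 0" "ip \<alpha> 0 = 0"
  by (simp_all add: fD_def)

lemma ip_uminus_left: "\<alpha> \<in> Hs \<Longrightarrow> ip (- \<alpha>) \<gamma> = - ip \<alpha> \<gamma>"
  and ip_uminus_right: "\<alpha> \<in> Hs \<Longrightarrow> ip \<gamma> (- \<alpha>) = - ip \<gamma> \<alpha>"
  using ip_diff_left[of 0 \<alpha> \<gamma>] ip_diff_right[of 0 \<alpha> \<gamma>] by simp_all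

lemmas ip_simps = ip_add_left ip_diff_left ip_scale_left ip_add_right ip_diff_right ip_scale_right
  ip_uminus_left ip_uminus_right Hs_add Hs_diff Hs_scale Hs_uminus

subsection \<open>Root space decomposition\<close>

lemma L_subspace: "subspace (L \<alpha>)"
  by (rule wsp_subspace) (simp add: subspace_UNIV)

lemma LD: "x \<in> L \<alpha> \<Longrightarrow> h \<in> H \<Longrightarrow> br h x = sc (\<alpha> h) x"
  by (simp add: wsp_def)

lemma L_br:
  assumes "x \<in> L \<alpha>" "y \<in> L \<beta>"
  shows "br x y \<in> L (\<alpha> + \<beta>)"
  using assms
  by (auto simp: wsp_def br_br[of _ x y] br_scale_left br_scale_right scale_left_distrib)

lemma L_unique:
  assumes "x \<in> L \<alpha>" "x \<in> L \<beta>" "\<alpha> \<in> Hs" "\<beta> \<in> Hs" "x \<noteq> 0"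
  shows "\<alpha> = \<beta>"
proof (rule Hs_eqI)
  fix h assume "h \<in> H"
  then have "sc (\<alpha> h) x = sc (\<beta> h) x" using assms LD by metis
  then show "\<alpha> h = \<beta> h" using assms(5) by simp
qed (use assms in auto)

text \<open>The whole family of components is chosen at once, with value 0 off a finite set, so that
  \<open>pr \<alpha>\<close> is defined for every functional; \<open>pr_eqI\<close> shows that the
  choice is unique.\<close>

definition pr :: "('l \<Rightarrow> 'k) \<Rightarrow> 'l \<Rightarrow> 'l" where
  "pr \<alpha> x = (SOME f. (\<forall>\<alpha>. f \<alpha> \<in> L \<alpha>) \<and> finite {\<alpha>. f \<alpha> \<noteq> 0} \<and> {\<alpha>. f \<alpha> \<noteq> 0} \<subseteq> Hs \<and>
      x = (\<Sum>\<alpha> | f \<alpha> \<noteq> 0. f \<alpha>)) \<alpha>"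

abbreviation "supp x \<equiv> {\<alpha>. pr \<alpha> x \<noteq> 0}"

lemma pr_props: "(\<forall>\<alpha>. pr \<alpha> x \<in> L \<alpha>) \<and> finite (supp x) \<and> supp x \<subseteq> Hs \<and> x = (\<Sum>\<alpha>\<in>supp x. pr \<alpha> x)"
proof -
  have "\<exists>S f. finite S \<and> S \<subseteq> Hs \<and> (\<forall>i\<in>S. f i \<in> L i) \<and> x = (\<Sum>i\<in>S. f i)"
    using H_dsum unfolding is_dsum_def by blast
  then obtain S f where f: "finite S" "S \<subseteq> Hs" "\<forall>i\<in>S. f i \<in> L i" "x = (\<Sum>i\<in>S. f i)" by blast
  let ?P = "\<lambda>f. (\<forall>\<alpha>. f \<alpha> \<in> L \<alpha>) \<and> finite {\<alpha>. f \<alpha> \<noteq> 0} \<and> {\<alpha>. f \<alpha> \<noteq> 0} \<subseteq> Hs \<and> x = (\<Sum>\<alpha> | f \<alpha> \<noteq> 0. f \<alpha>)"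
  let ?g = "\<lambda>\<alpha>. if \<alpha> \<in> S then f \<alpha> else 0"
  have sub: "{\<alpha>. ?g \<alpha> \<noteq> 0} \<subseteq> S" by auto
  have "x = (\<Sum>i\<in>S. ?g i)" using f by simp
  also have "\<dots> = (\<Sum>\<alpha> | ?g \<alpha> \<noteq> 0. ?g \<alpha>)"
    using sub f(1) by (intro sum.mono_neutral_right) auto
  finally have "?P ?g"
    using f sub finite_subset[OF sub f(1)] subspace_0[OF L_subspace] by auto
  then have "?P (SOME f. ?P f)" by (rule someI[of ?P])
  then show ?thesis unfolding pr_def .
qed

lemma pr_L: "pr \<alpha> x \<in> L \<alpha>" and supp_fin: "finite (supp x)"
  and supp_Hs: "\<alpha> \<in> supp x \<Longrightarrow> \<alpha> \<in> Hs"
  using pr_props by blast+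

lemma sum_pr: "(\<Sum>\<alpha>\<in>supp x. pr \<alpha> x) = x"
  using pr_props[of x, THEN conjunct2, THEN conjunct2, THEN conjunct2] by (rule sym)

text \<open>The difference of two decompositions is a vanishing sum of weight vectors, and weight
  spaces are independent.\<close>

lemma pr_eqI:
  assumes "finite T" "T \<subseteq> Hs" "\<And>\<alpha>. \<alpha> \<in> T \<Longrightarrow> f \<alpha> \<in> L \<alpha>" "x = (\<Sum>\<alpha>\<in>T. f \<alpha>)"
  shows "pr \<alpha> x = (if \<alpha> \<in> T then f \<alpha> else 0)"
proof -
  let ?S = "T \<union> supp x"
  let ?g = "\<lambda>\<alpha>. (if \<alpha> \<in> T then f \<alpha> else 0) - pr \<alpha> x"
  have fin: "finite ?S" using assms(1) supp_fin by simp
  have "(\<Sum>\<alpha>\<in>?S. ?g \<alpha>) = (\<Sum>\<alpha>\<in>?S. if \<alpha> \<in> T then f \<alpha> else 0) - (\<Sum>\<alpha>\<in>?S. pr \<alpha> x)"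
    by (rule sum_subtractf)
  also have "(\<Sum>\<alpha>\<in>?S. if \<alpha> \<in> T then f \<alpha> else 0) = (\<Sum>\<alpha>\<in>T. if \<alpha> \<in> T then f \<alpha> else 0)"
    using fin by (intro sum.mono_neutral_right) auto
  also have "\<dots> = x" using assms(4) by simp
  also have "(\<Sum>\<alpha>\<in>?S. pr \<alpha> x) = (\<Sum>\<alpha>\<in>supp x. pr \<alpha> x)"
    using fin by (intro sum.mono_neutral_right) auto
  also have "\<dots> = x" by (rule sum_pr)
  finally have s0: "(\<Sum>\<alpha>\<in>?S. ?g \<alpha>) = 0" by simp
  have "\<forall>\<alpha>\<in>?S. ?g \<alpha> = 0"
  proof (rule weight_components_zero[OF fin _ _ s0])
    show "\<And>\<mu> \<nu>. \<mu> \<in> ?S \<Longrightarrow> \<nu> \<in> ?S \<Longrightarrow> (\<And>h. h \<in> H \<Longrightarrow> \<mu> h = \<nu> h) \<Longrightarrow> \<mu> = \<nu>"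
      using assms(2) supp_Hs by (intro Hs_eqI) blast+
    show "\<And>\<mu>. \<mu> \<in> ?S \<Longrightarrow> ?g \<mu> \<in> L \<mu>"
      using assms(3) pr_L subspace_0[OF L_subspace] by (intro subspace_diff[OF L_subspace]) auto
  qed
  then show ?thesis by (cases "\<alpha> \<in> ?S") auto
qed

lemma pr_hom: "x \<in> L \<alpha> \<Longrightarrow> \<alpha> \<in> Hs \<Longrightarrow> pr \<beta> x = (if \<beta> = \<alpha> then x else 0)"
  using pr_eqI[of "{\<alpha>}" "\<lambda>_. x" x \<beta>] by auto

lemma sum_pr_superset: "finite T \<Longrightarrow> supp x \<subseteq> T \<Longrightarrow> (\<Sum>\<alpha>\<in>T. pr \<alpha> x) = x"
proof -
  assume "finite T" "supp x \<subseteq> T"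
  then have "(\<Sum>\<alpha>\<in>T. pr \<alpha> x) = (\<Sum>\<alpha>\<in>supp x. pr \<alpha> x)"
    by (intro sum.mono_neutral_right) auto
  then show ?thesis using sum_pr by simp
qed

lemma pr_add: "pr \<alpha> (x + y) = pr \<alpha> x + pr \<alpha> y"
proof -
  let ?T = "supp x \<union> supp y"
  have fin: "finite ?T" using supp_fin by simp
  have "x + y = (\<Sum>\<alpha>\<in>?T. pr \<alpha> x + pr \<alpha> y)"
    using fin by (simp add: sum.distrib sum_pr_superset)
  then have "pr \<alpha> (x + y) = (if \<alpha> \<in> ?T then pr \<alpha> x + pr \<alpha> y else 0)"
    by (intro pr_eqI) (use fin supp_Hs in \<open>auto intro: subspace_add[OF L_subspace] pr_L\<close>)
  then show ?thesis by auto
qed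

lemma pr_scale: "pr \<alpha> (sc a x) = sc a (pr \<alpha> x)"
proof -
  have "sc a x = (\<Sum>\<alpha>\<in>supp x. sc a (pr \<alpha> x))"
    by (simp add: scale_sum_right[symmetric] sum_pr)
  then have "pr \<alpha> (sc a x) = (if \<alpha> \<in> supp x then sc a (pr \<alpha> x) else 0)"
    by (intro pr_eqI) (use supp_fin supp_Hs in \<open>auto intro: subspace_scale[OF L_subspace] pr_L\<close>)
  then show ?thesis by auto
qed

lemma pr_zero [simp]: "pr \<alpha> 0 = 0"
  using pr_scale[of \<alpha> 0 0] by simp

lemma pr_sum: "pr \<alpha> (\<Sum>i\<in>S. f i) = (\<Sum>i\<in>S. pr \<alpha> (f i))"
  by (induction S rule: infinite_finite_induct) (auto simp: pr_add)

lemma pr_br_H: "h \<in> H \<Longrightarrow> pr \<alpha> (br h x) = sc (\<alpha> h) (pr \<alpha> x)"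
proof -
  assume h: "h \<in> H"
  have "br h x = (\<Sum>\<alpha>\<in>supp x. br h (pr \<alpha> x))"
    by (simp add: br_sum_right[symmetric] sum_pr)
  also have "\<dots> = (\<Sum>\<alpha>\<in>supp x. sc (\<alpha> h) (pr \<alpha> x))"
    using LD[OF pr_L h] by simp
  finally have "pr \<alpha> (br h x) = (if \<alpha> \<in> supp x then sc (\<alpha> h) (pr \<alpha> x) else 0)"
    by (intro pr_eqI) (use supp_fin supp_Hs in \<open>auto intro: subspace_scale[OF L_subspace] pr_L\<close>)
  then show ?thesis by auto
qed

lemma RI: "x \<in> L \<alpha> \<Longrightarrow> x \<noteq> 0 \<Longrightarrow> \<alpha> \<in> Hs \<Longrightarrow> \<alpha> \<in> R"
  by (auto simp: lroots_def)

lemma R_Hs: "\<alpha> \<in> R \<Longrightarrow> \<alpha> \<in> Hs"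
  by (simp add: lroots_def)

lemma R_ex: "\<alpha> \<in> R \<Longrightarrow> \<exists>x\<in>L \<alpha>. x \<noteq> 0"
  using subspace_0[OF L_subspace, of \<alpha>] by (auto simp: lroots_def)

lemma supp_R: "\<alpha> \<in> supp x \<Longrightarrow> \<alpha> \<in> R"
  using RI[OF pr_L] supp_Hs by blast

text \<open>Each projection sends a homogeneous spanning vector to itself or to 0, so a span of
  homogeneous vectors is a graded subspace.\<close>

lemma span_hom:
  assumes "\<And>s. s \<in> S \<Longrightarrow> \<exists>\<gamma>\<in>Hs. s \<in> L \<gamma>" "x \<in> span S"
  shows "pr \<alpha> x \<in> span (S \<inter> L \<alpha>)"
proof -
  have "pr \<alpha> s \<in> span (S \<inter> L \<alpha>)" if "s \<in> S" for s
    using assms(1)[OF that] that pr_hom span_base[of s "S \<inter> L \<alpha>"] span_zero by auto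
  moreover have "subspace {x. pr \<alpha> x \<in> span (S \<inter> L \<alpha>)}"
    by (auto simp: subspace_def pr_add pr_scale span_zero span_add span_scale)
  ultimately have "span S \<subseteq> {x. pr \<alpha> x \<in> span (S \<inter> L \<alpha>)}"
    by (intro span_minimal) auto
  then show ?thesis using assms(2) by auto
qed

lemma span_hom_L:
  assumes "\<And>s. s \<in> S \<Longrightarrow> \<exists>\<gamma>\<in>Hs. s \<in> L \<gamma>" "x \<in> span S" "x \<in> L \<alpha>" "\<alpha> \<in> Hs"
  shows "x \<in> span (S \<inter> L \<alpha>)"
  using span_hom[OF assms(1,2), of \<alpha>] pr_hom[OF assms(3,4), of \<alpha>] by simp

text \<open>Every element of \<open>H\<close> is a sum of eigenvectors of \<open>ad y\<close> (\<open>y \<in> H\<close>), so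
  \<open>(ad y)^2 x = [y, [y, x]] = 0\<close> forces \<open>[y, x] = 0\<close>.\<close>

lemma H_abelian:
  assumes x: "x \<in> H" and y: "y \<in> H"
  shows "br x y = 0"
proof -
  have vy: "sc (\<alpha> y) (pr \<alpha> y) = 0" for \<alpha>
    using pr_br_H[OF y, of \<alpha> y] by simp
  have "pr \<alpha> (br y (br x y)) = 0" for \<alpha>
    using vy[of \<alpha>] x y by (auto simp: pr_br_H)
  then have "br y (br x y) = 0" using sum_pr[of "br y (br x y)"] by simp
  then have "br y (br y x) = 0" using br_anti[of y x] by (simp add: br_minus_right)
  then have "sc (\<alpha> y * \<alpha> y) (pr \<alpha> x) = 0" for \<alpha>
    using y pr_br_H[of y \<alpha> "br y x"] pr_br_H[of y \<alpha> x] by simp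
  then have "pr \<alpha> (br y x) = 0" for \<alpha>
    using y pr_br_H[of y \<alpha> x] by auto
  then have "br y x = 0" using sum_pr[of "br y x"] by simp
  then show ?thesis using br_anti[of x y] by simp
qed

lemma H_L0: "h \<in> H \<Longrightarrow> h \<in> L 0"
  by (auto simp: wsp_def H_abelian)

lemma zero_R: "0 \<in> R"
proof -
  obtain h where "h \<in> H" "h \<noteq> 0" using H_nz subspace_0[OF H_subspace] by blast
  then show ?thesis using RI[of h 0] H_L0 by auto
qed

end

subsection \<open>Root strings\<close>

definition fsc :: "'k::field \<Rightarrow> ('l \<Rightarrow> 'k) \<Rightarrow> 'l \<Rightarrow> 'k" where
  "fsc c \<alpha> = (\<lambda>h. c * \<alpha> h)"

lemma fsc_simps [simp]: "fsc 0 \<alpha> = 0" "fsc 1 \<alpha> = \<alpha>" "fsc (- 1) \<alpha> = - \<alpha>" "fsc (- c) \<alpha> = - fsc c \<alpha>"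
    "fsc c 0 = 0" "fsc a (fsc c \<alpha>) = fsc (a * c) \<alpha>"
  by (auto simp: fsc_def fun_eq_iff)

context toral_lie
begin

lemma Hs_fsc: "\<alpha> \<in> Hs \<Longrightarrow> fsc c \<alpha> \<in> Hs"
  unfolding fsc_def by (rule Hs_scale)

lemma ip_fsc: "\<alpha> \<in> Hs \<Longrightarrow> ip (fsc c \<alpha>) \<gamma> = c * ip \<alpha> \<gamma>" "\<alpha> \<in> Hs \<Longrightarrow> ip \<gamma> (fsc c \<alpha>) = c * ip \<gamma> \<alpha>"
  unfolding fsc_def by (simp_all add: ip_scale_left ip_scale_right)

lemma RX_iff: "\<alpha> \<in> RX \<longleftrightarrow> \<alpha> \<in> R \<and> ip \<alpha> \<alpha> \<noteq> 0"
  and R0_iff: "\<alpha> \<in> R0 \<longleftrightarrow> \<alpha> \<in> R \<and> ip \<alpha> \<alpha> = 0"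
  by (auto simp: rootsX_def roots0_def)

lemma RX_Hs: "\<alpha> \<in> RX \<Longrightarrow> \<alpha> \<in> Hs"
  by (simp add: RX_iff R_Hs)

lemma ad_pow_L:
  assumes "x \<in> L \<alpha>" "v \<in> L \<beta>"
  shows "(br x ^^ n) v \<in> L (\<beta> + fsc (of_nat n) \<alpha>)"
proof (induction n)
  case 0
  then show ?case using assms by simp
next
  case (Suc n)
  note L_br[OF assms(1) Suc.IH]
  moreover have "\<alpha> + (\<beta> + fsc (of_nat n) \<alpha>) = \<beta> + fsc (of_nat (Suc n)) \<alpha>"
    by (auto simp: fsc_def fun_eq_iff algebra_simps)
  ultimately show ?case by (simp only: funpow.simps o_apply)
qed

lemma ad_pow_lin: "(br x ^^ n) (u + v) = (br x ^^ n) u + (br x ^^ n) v"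
    "(br x ^^ n) (sc a v) = sc a ((br x ^^ n) v)"
  by (induction n) (auto simp: br_add_right br_scale_right)

lemma ad_pow_zero: "(br x ^^ n) 0 = 0"
  by (induction n) auto

lemma ad_pow_stable: "(\<And>v. v \<in> M \<Longrightarrow> br x v \<in> M) \<Longrightarrow> v \<in> M \<Longrightarrow> (br x ^^ n) v \<in> M"
  by (induction n) auto

section \<open>Coroots, sl2-triples and reflections\<close>

abbreviation hc where "hc \<equiv> hcor sc B H"

definition cart where "cart \<beta> \<alpha> = 2 * ip \<beta> \<alpha> / ip \<alpha> \<alpha>"

definition refl where "refl \<alpha> \<beta> = \<beta> - fsc (cart \<beta> \<alpha>) \<alpha>"

lemma hc_H: "\<alpha> \<in> Hs \<Longrightarrow> hc \<alpha> \<in> H"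
  by (simp add: hcor_def tee_H H_subspace subspace_scale)

lemma apply_hc: "\<alpha> \<in> Hs \<Longrightarrow> \<beta> \<in> Hs \<Longrightarrow> \<beta> (hc \<alpha>) = cart \<beta> \<alpha>"
  by (simp add: hcor_def cart_def Hs_scale_arg tee_H ip_eq1)

lemma cart_self: "\<alpha> \<in> RX \<Longrightarrow> cart \<alpha> \<alpha> = 2"
  by (simp add: cart_def RX_iff)

lemma cart_add: "\<beta> \<in> Hs \<Longrightarrow> \<gamma> \<in> Hs \<Longrightarrow> cart (\<beta> + \<gamma>) \<alpha> = cart \<beta> \<alpha> + cart \<gamma> \<alpha>"
  and cart_diff: "\<beta> \<in> Hs \<Longrightarrow> \<gamma> \<in> Hs \<Longrightarrow> cart (\<beta> - \<gamma>) \<alpha> = cart \<beta> \<alpha> - cart \<gamma> \<alpha>"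
  and cart_fsc: "\<beta> \<in> Hs \<Longrightarrow> cart (fsc c \<beta>) \<alpha> = c * cart \<beta> \<alpha>"
  and cart_uminus: "\<beta> \<in> Hs \<Longrightarrow> cart (- \<beta>) \<alpha> = - cart \<beta> \<alpha>"
  and cart_uminus_right: "\<alpha> \<in> Hs \<Longrightarrow> cart \<beta> (- \<alpha>) = - cart \<beta> \<alpha>"
  by (simp_all add: cart_def ip_simps ip_fsc Hs_fsc add_divide_distrib diff_divide_distrib algebra_simps)

lemma hc_nz:
  assumes "\<alpha> \<in> RX"
  shows "hc \<alpha> \<noteq> 0"
proof
  assume "hc \<alpha> = 0"
  then have "cart \<alpha> \<alpha> = 0"
    using apply_hc[of \<alpha> \<alpha>] RX_Hs[OF assms] Hs_zero_arg[of \<alpha>] by simp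
  then show False using cart_self[OF assms] by simp
qed

lemma triple_ex:
  assumes "\<alpha> \<in> RX"
  shows "\<exists>x y. x \<in> L \<alpha> \<and> y \<in> L (- \<alpha>) \<and> br x y = hc \<alpha>"
proof -
  obtain x where x: "x \<in> L \<alpha>" "x \<noteq> 0" using R_ex assms RX_iff by blast
  then obtain y where y: "y \<in> L (- \<alpha>)" "br x y = tee \<alpha>"
    using root_divX assms by blast
  then have "br x (sc (2 / ip \<alpha> \<alpha>) y) = hc \<alpha>"
    by (simp add: br_scale_right hcor_def)
  then show ?thesis using x y subspace_scale[OF L_subspace] by blast
qed

lemma RX_uminus:
  assumes "\<alpha> \<in> RX"
  shows "- \<alpha> \<in> RX"
proof -
  obtain x y where xy: "x \<in> L \<alpha>" "y \<in> L (- \<alpha>)" "br x y = hc \<alpha>"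
    using triple_ex[OF assms] by blast
  then have "y \<noteq> 0" using hc_nz[OF assms] by auto
  then have "- \<alpha> \<in> R" using RI[OF xy(2)] RX_Hs[OF assms] Hs_uminus by blast
  then show ?thesis using assms RX_Hs[OF assms] by (simp add: RX_iff ip_simps)
qed

text \<open>For \<open>\<alpha> \<noteq> 0\<close> both axioms on root vectors write a nonzero
  element of H as a bracket with a factor from \<open>L (- \<alpha>)\<close>, which therefore cannot
  vanish.\<close>

lemma R_uminus:
  assumes "\<alpha> \<in> R"
  shows "- \<alpha> \<in> R"
proof (cases "\<alpha> \<in> RX")
  case True
  then show ?thesis using RX_uminus RX_iff by blast
next
  case False
  then have a0: "\<alpha> \<in> R0" using assms by (simp add: RX_iff R0_iff)
  show ?thesis
  proof (cases "\<alpha> = 0")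
    case False
    obtain x y where xy: "x \<in> L \<alpha>" "y \<in> L (- \<alpha>)" "br x y = tee \<alpha>"
      using root_div0 a0 by blast
    then have "y \<noteq> 0" using tee_eq_0[OF R_Hs[OF assms]] False by auto
    then show ?thesis using RI[OF xy(2)] R_Hs[OF assms] Hs_uminus by blast
  qed (use assms in simp)
qed

text \<open>\<open>\<alpha>\<close> and \<open>- \<alpha>\<close> are both nonisotropic, so both
  root vectors act locally nilpotently and the whole Lie algebra is an integrable module.\<close>

lemma triple_sl2:
  assumes \<alpha>: "\<alpha> \<in> RX" and x: "x \<in> L \<alpha>" and y: "y \<in> L (- \<alpha>)" and xy: "br x y = hc \<alpha>"
  shows "sl2_module sc (br x) (br y) (\<lambda>a. {v. br (hc \<alpha>) v = sc a v})"
proof unfold_locales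
  have aH: "\<alpha> \<in> Hs" using RX_Hs \<alpha> by blast
  have hx: "br (hc \<alpha>) x = sc 2 x"
    using LD[OF x hc_H[OF aH]] apply_hc[OF aH aH] cart_self[OF \<alpha>] by simp
  have hy: "br (hc \<alpha>) y = sc (- 2) y"
    using LD[OF y hc_H[OF aH]] apply_hc[OF aH aH] cart_self[OF \<alpha>] by simp
  fix v a assume v: "v \<in> {v. br (hc \<alpha>) v = sc a v}"
  show "br x v \<in> {v. br (hc \<alpha>) v = sc (a + 2) v}"
    using v by (simp add: br_br[of "hc \<alpha>"] hx br_scale_left br_scale_right scale_left_distrib add.commute)
  show "br y v \<in> {v. br (hc \<alpha>) v = sc (a - 2) v}"
    using v by (simp add: br_br[of "hc \<alpha>"] hy br_scale_left br_scale_right br_minus_left scale_left_diff_distrib)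
  show "br x (br y v) = br y (br x v) + sc a v"
    using v by (simp add: br_br[of x y] xy add.commute)
next
  show "\<exists>n. (br x ^^ n) v = 0" for v using ad_nil \<alpha> x by blast
  show "\<exists>n. (br y ^^ n) v = 0" for v using ad_nil RX_uminus[OF \<alpha>] y by blast
qed (auto simp: br_add_right br_scale_right)

lemma L_hc: "\<alpha> \<in> Hs \<Longrightarrow> \<beta> \<in> Hs \<Longrightarrow> v \<in> L \<beta> \<Longrightarrow> br (hc \<alpha>) v = sc (cart \<beta> \<alpha>) v"
  using LD[of v \<beta> "hc \<alpha>"] hc_H apply_hc by simp

lemma cart_int:
  assumes \<alpha>: "\<alpha> \<in> RX" and \<beta>: "\<beta> \<in> R"
  shows "\<exists>k. cart \<beta> \<alpha> = of_int k"
proof -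
  obtain x y where xy: "x \<in> L \<alpha>" "y \<in> L (- \<alpha>)" "br x y = hc \<alpha>"
    using triple_ex[OF \<alpha>] by blast
  interpret sl2_module sc "br x" "br y" "\<lambda>a. {v. br (hc \<alpha>) v = sc a v}"
    by (rule triple_sl2[OF \<alpha> xy])
  obtain v where v: "v \<in> L \<beta>" "v \<noteq> 0" using R_ex \<beta> by blast
  show ?thesis
    using weight_int[of v "cart \<beta> \<alpha>"] v L_hc RX_Hs[OF \<alpha>] R_Hs[OF \<beta>] by blast
qed

text \<open>Stand-in for a Weyl group element on a single weight space. The clause on the sets M
  makes the map respect every subalgebra or ideal stable under bracketing with \<open>X\<close>;
  this is how reflections act inside the generated subalgebra and its ideals.\<close>

definition weight_map :: "'l set \<Rightarrow> ('l \<Rightarrow> 'l) \<Rightarrow> ('l \<Rightarrow> 'k) \<Rightarrow> ('l \<Rightarrow> 'k) \<Rightarrow> bool" where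
  "weight_map X T \<beta> \<gamma> \<longleftrightarrow> (\<forall>u v. T (u + v) = T u + T v) \<and> (\<forall>a v. T (sc a v) = sc a (T v)) \<and>
     (\<forall>M. (\<forall>x\<in>X. \<forall>v\<in>M. br x v \<in> M) \<longrightarrow> (\<forall>v\<in>M. T v \<in> M)) \<and>
     (\<forall>v\<in>L \<beta>. T v \<in> L \<gamma> \<and> (T v = 0 \<longrightarrow> v = 0))"

lemma weight_mapD:
  assumes "weight_map X T \<beta> \<gamma>"
  shows "T (u + v) = T u + T v" "T (sc a v) = sc a (T v)"
    "(\<And>x v. x \<in> X \<Longrightarrow> v \<in> M \<Longrightarrow> br x v \<in> M) \<Longrightarrow> w \<in> M \<Longrightarrow> T w \<in> M"
    "w \<in> L \<beta> \<Longrightarrow> T w \<in> L \<gamma>" "w \<in> L \<beta> \<Longrightarrow> T w = 0 \<Longrightarrow> w = 0"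
  using assms unfolding weight_map_def by auto

lemma weight_map_mono: "weight_map X T \<beta> \<gamma> \<Longrightarrow> X \<subseteq> Y \<Longrightarrow> weight_map Y T \<beta> \<gamma>"
  unfolding weight_map_def by (meson subsetD)

text \<open>The power of \<open>ad y\<close> or \<open>ad x\<close> that realises the reflection on the weight space
  \<open>L \<beta>\<close>; it replaces the usual product of three exponentials.\<close>

lemma reflection_weight_map:
  assumes \<alpha>: "\<alpha> \<in> RX" and xy: "x \<in> L \<alpha>" "y \<in> L (- \<alpha>)" "br x y = hc \<alpha>"
    and \<beta>: "\<beta> \<in> Hs" and k: "cart \<beta> \<alpha> = of_int k"
  shows "\<exists>T. weight_map {x, y} T \<beta> (refl \<alpha> \<beta>)"
proof -
  interpret S: sl2_module sc "br x" "br y" "\<lambda>a. {v. br (hc \<alpha>) v = sc a v}"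
    by (rule triple_sl2[OF \<alpha> xy])
  have aH: "\<alpha> \<in> Hs" using RX_Hs \<alpha> by blast
  have w: "br (hc \<alpha>) v = sc (of_int k) v" if "v \<in> L \<beta>" for v
    using L_hc[OF aH \<beta> that] k by simp
  show ?thesis
  proof (cases "k \<ge> 0")
    case True
    then obtain n where n: "k = int n" using nonneg_int_cases by blast
    have r: "refl \<alpha> \<beta> = \<beta> + fsc (of_nat n) (- \<alpha>)"
      by (auto simp: refl_def k n fsc_def fun_eq_iff)
    have "weight_map {x, y} (br y ^^ n) \<beta> (refl \<alpha> \<beta>)"
      unfolding weight_map_def r
      using ad_pow_lin ad_pow_stable[of _ y _ n] ad_pow_L[OF xy(2), of _ \<beta> n] S.f_pow_inj[of _ n] w n
      by auto
    then show ?thesis by blast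
  next
    case False
    then obtain n where n: "k = - int n" using int_cases2[of k] by auto
    have r: "refl \<alpha> \<beta> = \<beta> + fsc (of_nat n) \<alpha>"
      by (auto simp: refl_def k n fsc_def fun_eq_iff)
    have "weight_map {x, y} (br x ^^ n) \<beta> (refl \<alpha> \<beta>)"
      unfolding weight_map_def r
      using ad_pow_lin ad_pow_stable[of _ x _ n] ad_pow_L[OF xy(1), of _ \<beta> n] S.e_pow_inj[of _ n] w n
      by auto
    then show ?thesis by blast
  qed
qed

lemma refl_Hs: "\<alpha> \<in> Hs \<Longrightarrow> \<beta> \<in> Hs \<Longrightarrow> refl \<alpha> \<beta> \<in> Hs"
  by (simp add: refl_def Hs_diff Hs_fsc)

lemma refl_R:
  assumes \<alpha>: "\<alpha> \<in> RX" and \<beta>: "\<beta> \<in> R"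
  shows "refl \<alpha> \<beta> \<in> R"
proof -
  obtain x y where xy: "x \<in> L \<alpha>" "y \<in> L (- \<alpha>)" "br x y = hc \<alpha>"
    using triple_ex[OF \<alpha>] by blast
  obtain k where "cart \<beta> \<alpha> = of_int k" using cart_int[OF \<alpha> \<beta>] by blast
  then obtain T where "weight_map {x, y} T \<beta> (refl \<alpha> \<beta>)"
    using reflection_weight_map[OF \<alpha> xy R_Hs[OF \<beta>]] by blast
  note T = weight_mapD(4,5)[OF this]
  obtain v where "v \<in> L \<beta>" "v \<noteq> 0" using R_ex \<beta> by blast
  then show ?thesis
    using T RI[of "T v" "refl \<alpha> \<beta>"] refl_Hs RX_Hs[OF \<alpha>] R_Hs[OF \<beta>] by blast
qed

lemma refl_ip:
  assumes "\<alpha> \<in> RX" "\<beta> \<in> Hs" "\<gamma> \<in> Hs"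
  shows "ip (refl \<alpha> \<beta>) (refl \<alpha> \<gamma>) = ip \<beta> \<gamma>"
proof -
  have a: "\<alpha> \<in> Hs" "ip \<alpha> \<alpha> \<noteq> 0" using assms RX_iff RX_Hs by auto
  then show ?thesis
    using assms ip_sym[of \<gamma> \<alpha>]
    by (simp add: refl_def ip_simps ip_fsc Hs_fsc cart_def algebra_simps)
qed

lemma refl_RX: "\<alpha> \<in> RX \<Longrightarrow> \<beta> \<in> RX \<Longrightarrow> refl \<alpha> \<beta> \<in> RX"
  using refl_R[of \<alpha> \<beta>] refl_ip[of \<alpha> \<beta> \<beta>] RX_iff RX_Hs by simp

text \<open>The k-th power of ad y is injective on weight k, so no smaller power can kill v.\<close>

lemma string_down:
  assumes \<alpha>: "\<alpha> \<in> RX" and \<beta>: "\<beta> \<in> R" and k: "cart \<beta> \<alpha> = of_nat k" and j: "j \<le> k"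
  shows "\<beta> - fsc (of_nat j) \<alpha> \<in> R"
proof -
  obtain x y where xy: "x \<in> L \<alpha>" "y \<in> L (- \<alpha>)" "br x y = hc \<alpha>"
    using triple_ex[OF \<alpha>] by blast
  interpret S: sl2_module sc "br x" "br y" "\<lambda>a. {v. br (hc \<alpha>) v = sc a v}"
    by (rule triple_sl2[OF \<alpha> xy])
  obtain v where v: "v \<in> L \<beta>" "v \<noteq> 0" using R_ex \<beta> by blast
  have "br (hc \<alpha>) v = sc (of_nat k) v"
    using L_hc[OF RX_Hs[OF \<alpha>] R_Hs[OF \<beta>] v(1)] k by simp
  then have "(br y ^^ k) v \<noteq> 0" using S.f_pow_inj[of v k] v by auto
  moreover have "(br y ^^ k) v = (br y ^^ (k - j)) ((br y ^^ j) v)"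
    using j by (metis funpow_add o_apply le_add_diff_inverse2)
  ultimately have "(br y ^^ j) v \<noteq> 0" using ad_pow_zero by metis
  then have "\<beta> + fsc (of_nat j) (- \<alpha>) \<in> R"
    using RI[OF ad_pow_L[OF xy(2) v(1), of j]] Hs_add Hs_fsc Hs_uminus RX_Hs[OF \<alpha>] R_Hs[OF \<beta>] by blast
  moreover have "\<beta> + fsc (of_nat j) (- \<alpha>) = \<beta> - fsc (of_nat j) \<alpha>"
    by (auto simp: fsc_def fun_eq_iff)
  ultimately show ?thesis by simp
qed

lemma string_up:
  assumes \<alpha>: "\<alpha> \<in> RX" and \<beta>: "\<beta> \<in> R" and k: "cart \<beta> \<alpha> = - of_nat k" and j: "j \<le> k"
  shows "\<beta> + fsc (of_nat j) \<alpha> \<in> R"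
proof -
  have "\<beta> - fsc (of_nat j) (- \<alpha>) \<in> R"
    by (rule string_down[OF RX_uminus[OF \<alpha>] \<beta> _ j]) (simp add: cart_uminus_right RX_Hs[OF \<alpha>] k)
  moreover have "\<beta> - fsc (of_nat j) (- \<alpha>) = \<beta> + fsc (of_nat j) \<alpha>"
    by (auto simp: fsc_def fun_eq_iff)
  ultimately show ?thesis by simp
qed

lemma diff_R:
  assumes "\<alpha> \<in> RX" "\<beta> \<in> R" "cart \<beta> \<alpha> = of_int k" "k > 0"
  shows "\<beta> - \<alpha> \<in> R"
  using string_down[of \<alpha> \<beta> "nat k" 1] assms by simp

lemma add_R:
  assumes "\<alpha> \<in> RX" "\<beta> \<in> R" "cart \<beta> \<alpha> = of_int k" "k < 0"
  shows "\<beta> + \<alpha> \<in> R"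
  using string_up[of \<alpha> \<beta> "nat (- k)" 1] assms by simp

subsection \<open>Isotropic roots lie in the radical\<close>

text \<open>A pair \<open>[x, y] = t\<close> with \<open>t\<close> acting by a nonzero scalar is a Heisenberg algebra, whose
  modules have infinite weight strings.\<close>

lemma isotropic_string:
  assumes \<delta>: "\<delta> \<in> R0" and \<alpha>: "\<alpha> \<in> R" and c: "ip \<alpha> \<delta> \<noteq> 0"
  shows "\<exists>s \<epsilon>. (\<epsilon> = 1 \<or> \<epsilon> = - 1) \<and> (\<forall>n. \<alpha> + fsc (of_int (s + \<epsilon> * int n)) \<delta> \<in> R)"
proof -
  have dH: "\<delta> \<in> Hs" and d0: "ip \<delta> \<delta> = 0" using \<delta> R0_iff R_Hs by auto
  have aH: "\<alpha> \<in> Hs" using \<alpha> R_Hs by blast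
  obtain x y where xy: "x \<in> L \<delta>" "y \<in> L (- \<delta>)" "br x y = tee \<delta>"
    using root_div0 \<delta> by blast
  obtain z where z: "z \<in> L \<alpha>" "z \<noteq> 0" using R_ex \<alpha> by blast
  have ex: "(br x ^^ n) z \<in> L (\<alpha> + fsc (of_nat n) \<delta>)" for n
    by (rule ad_pow_L[OF xy(1) z(1)])
  show ?thesis
  proof (cases "\<forall>n. (br x ^^ n) z \<noteq> 0")
    case True
    then have "\<alpha> + fsc (of_nat n) \<delta> \<in> R" for n
      using RI[OF ex] aH dH Hs_add Hs_fsc by blast
    then show ?thesis by (intro exI[of _ 0] exI[of _ 1]) simp
  next
    case False
    define m where "m = (LEAST n. (br x ^^ n) z = 0)"
    have m: "(br x ^^ m) z = 0" unfolding m_def using False LeastI_ex by (metis (mono_tags, lifting))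
    then have "m \<noteq> 0" using z by (metis funpow_0)
    then obtain s where s: "m = Suc s" by (cases m) auto
    \<comment> \<open>The last nonzero raised vector; x kills it, so it plays the part of a vacuum
      for the lowering operator ad y.\<close>
    let ?u = "(br x ^^ s) z"
    have u: "?u \<noteq> 0" using not_less_Least[of s "\<lambda>n. (br x ^^ n) z = 0"] s m_def by simp
    have xu: "br x ?u = 0" using m s by simp
    have yL: "(br y ^^ n) ?u \<in> L (\<alpha> + fsc (of_nat s) \<delta> + fsc (of_nat n) (- \<delta>))" for n
      by (rule ad_pow_L[OF xy(2) ex])
    \<comment> \<open>Since \<open>\<delta>\<close> is isotropic, \<open>tee \<delta>\<close> acts
      by one and the same scalar along the whole string.\<close>
    have tee_act: "br (tee \<delta>) ((br y ^^ n) ?u) = sc (ip \<alpha> \<delta>) ((br y ^^ n) ?u)" for n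
    proof -
      have "(\<alpha> + fsc (of_nat s) \<delta> + fsc (of_nat n) (- \<delta>)) (tee \<delta>)
          = ip (\<alpha> + fsc (of_nat s) \<delta> + fsc (of_nat n) (- \<delta>)) \<delta>"
        by (rule ip_eq1[symmetric]) (intro Hs_add Hs_fsc Hs_uminus aH dH)+
      also have "\<dots> = ip \<alpha> \<delta>" using aH dH d0 by (simp add: ip_simps ip_fsc Hs_fsc)
      finally show ?thesis using LD[OF yL tee_H[OF dH], of n] by simp
    qed
    \<comment> \<open>Heisenberg commutation: the scalars (n + 1) (\<open>\<alpha>\<close>,
      \<open>\<delta>\<close>) never vanish, so no power of ad y kills the vacuum.\<close>
    have xy_pow: "br x ((br y ^^ Suc n) ?u) = sc (of_nat (Suc n) * ip \<alpha> \<delta>) ((br y ^^ n) ?u)" for n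
    proof (induction n)
      case 0
      then show ?case using tee_act[of 0] xu by (simp add: br_br[of x y] xy(3))
    next
      case (Suc n)
      have "br x ((br y ^^ Suc (Suc n)) ?u)
          = br (tee \<delta>) ((br y ^^ Suc n) ?u) + br y (br x ((br y ^^ Suc n) ?u))"
        by (simp add: br_br[of x y] xy(3))
      also have "\<dots> = sc (ip \<alpha> \<delta>) ((br y ^^ Suc n) ?u) + sc (of_nat (Suc n) * ip \<alpha> \<delta>) ((br y ^^ Suc n) ?u)"
        unfolding Suc.IH tee_act by (simp add: br_scale_right)
      also have "\<dots> = sc (of_nat (Suc (Suc n)) * ip \<alpha> \<delta>) ((br y ^^ Suc n) ?u)"
        unfolding scale_left_distrib[symmetric] by (simp add: algebra_simps)
      finally show ?case .
    qed
    have "(br y ^^ n) ?u \<noteq> 0" for n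
    proof (induction n)
      case (Suc n)
      show ?case
      proof
        assume "(br y ^^ Suc n) ?u = 0"
        then have "sc (of_nat (Suc n) * ip \<alpha> \<delta>) ((br y ^^ n) ?u) = 0" using xy_pow[of n] by (metis br_zero(2))
        then show False using Suc.IH c by (simp del: of_nat_Suc)
      qed
    qed (use u in simp)
    then have "\<alpha> + fsc (of_nat s) \<delta> + fsc (of_nat n) (- \<delta>) \<in> R" for n
      by (intro RI[OF yL]) (auto intro!: Hs_add Hs_fsc Hs_uminus aH dH)
    moreover have "\<alpha> + fsc (of_nat s) \<delta> + fsc (of_nat n) (- \<delta>)
        = \<alpha> + fsc (of_int (int s + - 1 * int n)) \<delta>" for n
      by (auto simp: fsc_def fun_eq_iff algebra_simps)
    ultimately have "\<forall>n. \<alpha> + fsc (of_int (int s + - 1 * int n)) \<delta> \<in> R" by metis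
    then show ?thesis by blast
  qed
qed

text \<open>Dividing by k k' turns the equation into 1/k' - 1/k = d, whose left side has absolute
  value at most 2.\<close>

lemma no_two_inverse_ints:
  fixes k k' d :: int
  assumes "k - k' = d * k * k'" "k \<noteq> 0" "k' \<noteq> 0" "\<bar>d\<bar> \<ge> 3"
  shows False
proof -
  have "3 * \<bar>k * k'\<bar> \<le> \<bar>d\<bar> * \<bar>k * k'\<bar>" using assms(4) by (intro mult_right_mono) auto
  also have "\<dots> = \<bar>k - k'\<bar>" unfolding assms(1) by (simp add: abs_mult)
  also have "\<dots> \<le> \<bar>k\<bar> + \<bar>k'\<bar>" by simp
  finally have "3 * (\<bar>k\<bar> * \<bar>k'\<bar>) \<le> \<bar>k\<bar> + \<bar>k'\<bar>" by (simp add: abs_mult)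
  moreover have "\<bar>k\<bar> * 1 \<le> \<bar>k\<bar> * \<bar>k'\<bar>" "1 * \<bar>k'\<bar> \<le> \<bar>k\<bar> * \<bar>k'\<bar>"
    using assms(2,3) by (intro mult_mono; simp)+
  ultimately show False using assms(2) by linarith
qed

text \<open>Along the infinite string the norm is affine in t with slope 2 (\<open>\<alpha>\<close>,
  \<open>\<delta>\<close>), and dividing this slope by any nonzero norm gives a Cartan number of
  \<open>\<delta>\<close>, a nonzero integer. So the norms, measured in units of the slope, are
  inverses of integers, and two of them cannot differ by 3 or more.\<close>

lemma isotropic_orthogonal:
  assumes \<delta>: "\<delta> \<in> R0" and \<alpha>: "\<alpha> \<in> R"
  shows "ip \<alpha> \<delta> = 0"
proof (rule ccontr)
  assume c: "ip \<alpha> \<delta> \<noteq> 0"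
  have dH: "\<delta> \<in> Hs" and d0: "ip \<delta> \<delta> = 0" and dR: "\<delta> \<in> R" using \<delta> R0_iff R_Hs by auto
  have aH: "\<alpha> \<in> Hs" using \<alpha> R_Hs by blast
  obtain s \<epsilon> where \<epsilon>: "\<epsilon> = 1 \<or> \<epsilon> = (- 1 :: int)"
    and str: "\<And>n. \<alpha> + fsc (of_int (s + \<epsilon> * int n)) \<delta> \<in> R"
    using isotropic_string[OF \<delta> \<alpha> c] by blast
  define N where "N t = ip \<alpha> \<alpha> + 2 * of_int t * ip \<alpha> \<delta>" for t :: int
  define t where "t n = s + \<epsilon> * int n" for n
  have norm: "ip (\<alpha> + fsc (of_int (t n)) \<delta>) (\<alpha> + fsc (of_int (t n)) \<delta>) = N (t n)" for n
    using aH dH d0 ip_sym[of \<delta> \<alpha>] by (simp add: ip_simps ip_fsc Hs_fsc N_def algebra_simps)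
  have k: "\<exists>k. of_int k * N (t n) = 2 * ip \<alpha> \<delta> \<and> k \<noteq> 0" if "N (t n) \<noteq> 0" for n
  proof -
    let ?\<gamma> = "\<alpha> + fsc (of_int (t n)) \<delta>"
    have "?\<gamma> \<in> RX" using str[of n] norm[of n] that by (simp add: RX_iff t_def)
    then obtain k where "cart \<delta> ?\<gamma> = of_int k" using cart_int dR by blast
    moreover have "ip \<delta> ?\<gamma> = ip \<alpha> \<delta>"
      using aH dH d0 ip_sym[of \<delta> \<alpha>] by (simp add: ip_simps ip_fsc Hs_fsc)
    ultimately have "of_int k * N (t n) = 2 * ip \<alpha> \<delta>"
      using that norm[of n] by (simp add: cart_def field_simps)
    then show ?thesis using c by auto
  qed
  have diff: "N (t n) - N (t m) = 2 * of_int (t n - t m) * ip \<alpha> \<delta>" for m n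
    by (simp add: N_def algebra_simps)
  have two: False if "N (t n) \<noteq> 0" "N (t m) \<noteq> 0" "\<bar>t n - t m\<bar> \<ge> 3" for m n
  proof -
    note t3 = that(3)
    obtain p q where p: "of_int p * N (t n) = 2 * ip \<alpha> \<delta>" "p \<noteq> 0"
      and q: "of_int q * N (t m) = 2 * ip \<alpha> \<delta>" "q \<noteq> 0"
      using k[OF \<open>N (t n) \<noteq> 0\<close>] k[OF \<open>N (t m) \<noteq> 0\<close>] by blast
    have "of_int (q - p) * (2 * ip \<alpha> \<delta>) = of_int q * (of_int p * N (t n)) - of_int p * (of_int q * N (t m))"
      unfolding p(1) q(1) by (simp add: algebra_simps)
    also have "\<dots> = of_int p * of_int q * (N (t n) - N (t m))"
      by (simp add: algebra_simps)
    also have "\<dots> = of_int ((t n - t m) * q * p) * (2 * ip \<alpha> \<delta>)"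
      unfolding diff by simp
    finally have "(of_int (q - p) :: 'k) = of_int ((t n - t m) * q * p)" using c by simp
    then have "q - p = (t n - t m) * q * p" unfolding of_int_eq_iff .
    then show False using no_two_inverse_ints p q t3 by blast
  qed
  have one: "N (t m) \<noteq> 0" if "N (t n) = 0" "\<bar>t n - t m\<bar> \<ge> 3" for n m
    using diff[of n m] c that by auto
  \<comment> \<open>Positions 0, 3 and 6 are pairwise far enough apart; at most one of the three
    norms is 0, so two nonzero ones remain.\<close>
  have t: "\<bar>t 0 - t 3\<bar> \<ge> 3" "\<bar>t 0 - t 6\<bar> \<ge> 3" "\<bar>t 3 - t 6\<bar> \<ge> 3"
    using \<epsilon> by (auto simp: t_def)
  show False
  proof (cases "N (t 0) = 0")
    case True
    then show False using two[of 3 6] one[of 0 3] one[of 0 6] t by blast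
  next
    case False
    then show False using two[of 0 3] two[of 0 6] one[of 3 6] t by blast
  qed
qed

subsection \<open>Rank two\<close>

lemma cart_relation:
  assumes "\<alpha> \<in> RX" "\<beta> \<in> RX" "cart \<alpha> \<beta> = of_int a" "cart \<beta> \<alpha> = of_int b"
  shows "of_int a * ip \<beta> \<beta> = 2 * ip \<alpha> \<beta>" "of_int b * ip \<alpha> \<alpha> = 2 * ip \<alpha> \<beta>"
  using assms ip_sym[of \<beta> \<alpha>] by (auto simp: cart_def RX_iff field_simps)

text \<open>The root \<open>\<gamma> = \<alpha> + \<beta>\<close> satisfies \<open>b (\<gamma>, \<gamma>) = (a + a b + b) (\<beta>, \<beta>)\<close>; for \<open>a < - 2\<close> this
  contradicts the integrality of its Cartan number with \<open>\<beta>\<close>.\<close>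

lemma cart_opposite_bound:
  assumes \<alpha>: "\<alpha> \<in> RX" and \<beta>: "\<beta> \<in> RX" and a: "cart \<alpha> \<beta> = of_int a" and b: "cart \<beta> \<alpha> = of_int b"
    and ab: "a < 0" "b > 0"
  shows "a \<ge> - 2"
proof (rule ccontr)
  assume "\<not> ?thesis"
  then have a3: "a \<le> - 3" by simp
  have H: "\<alpha> \<in> Hs" "\<beta> \<in> Hs" "ip \<beta> \<beta> \<noteq> 0" using \<alpha> \<beta> RX_iff RX_Hs by auto
  note r = cart_relation[OF \<alpha> \<beta> a b]
  have "ip (\<alpha> + \<beta>) (\<alpha> + \<beta>) = ip \<alpha> \<alpha> + of_int a * ip \<beta> \<beta> + ip \<beta> \<beta>"
    using H r(1) ip_sym[of \<beta> \<alpha>] by (simp add: ip_simps)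
  then have n: "of_int b * ip (\<alpha> + \<beta>) (\<alpha> + \<beta>) = of_int (a + a * b + b) * ip \<beta> \<beta>"
    using r by (simp add: algebra_simps)
  \<comment> \<open>The coefficient to be estimated is b (a + 1) + a, where b is at least 1 and a +
    1 is negative.\<close>
  have "b * (a + 1) \<le> 1 * (a + 1)" using ab a3 by (intro mult_right_mono_neg) auto
  then have neg: "a + a * b + b < 0" using a3 by (simp add: algebra_simps)
  then have "of_int (a + a * b + b) * ip \<beta> \<beta> \<noteq> 0"
    using H(3) by (simp only: mult_eq_0_iff of_int_eq_0_iff) simp
  then have "ip (\<alpha> + \<beta>) (\<alpha> + \<beta>) \<noteq> 0" using n by (metis mult_zero_right)
  then have gX: "\<alpha> + \<beta> \<in> RX" using add_R[OF \<beta> _ a ab(1)] \<alpha> RX_iff by blast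
  obtain k where k: "cart \<beta> (\<alpha> + \<beta>) = of_int k" using cart_int[OF gX] \<beta> RX_iff by blast
  have "cart (\<alpha> + \<beta>) \<beta> = of_int (a + 2)" using a H cart_self[OF \<beta>] by (simp add: cart_add)
  from cart_relation[OF gX \<beta> this k]
  have "of_int b * (of_int k * ip (\<alpha> + \<beta>) (\<alpha> + \<beta>)) = of_int b * (of_int (a + 2) * ip \<beta> \<beta>)" by simp
  then have "of_int (k * (a + a * b + b)) * ip \<beta> \<beta> = of_int (b * (a + 2)) * ip \<beta> \<beta>"
    unfolding mult.left_commute[of "of_int b" "of_int k"] n by (simp only: of_int_mult mult.assoc)
  then have e: "k * (a + a * b + b) = b * (a + 2)" unfolding mult_right_cancel[OF H(3)] of_int_eq_iff .
  have "b * (a + 2) < 0" using ab a3 by (intro mult_pos_neg) auto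
  \<comment> \<open>Both sides of \<open>e\<close> are negative, so k is at least 1 and b (a + 2) is
    at most a + a b + b. This says that b is at most a, against the opposite signs.\<close>
  then have "k > 0" using e neg by (metis mult_nonpos_nonpos not_less order_less_imp_le)
  then have "k * (a + a * b + b) \<le> 1 * (a + a * b + b)"
    using neg by (intro mult_right_mono_neg) auto
  then have "b \<le> a" unfolding e by (simp add: algebra_simps)
  then show False using ab by simp
qed

text \<open>Reflecting each root in the other preserves both norms and multiplies
  (\<open>\<alpha>\<close>, \<open>\<beta>\<close>) by a b - 3. If a b < 0, this factor is at most
  -4 while the new Cartan numbers still have opposite signs, so they violate the bound 2 valid for
  such a pair.\<close>

lemma cart_product_nonneg:
  assumes \<alpha>: "\<alpha> \<in> RX" and \<beta>: "\<beta> \<in> RX" and a: "cart \<alpha> \<beta> = of_int a" and b: "cart \<beta> \<alpha> = of_int b"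
  shows "a * b \<ge> 0"
proof (rule ccontr)
  assume neg: "\<not> ?thesis"
  \<comment> \<open>Replacing \<open>\<alpha>\<close> by its negative changes both signs, so
    \<open>cart_opposite_bound\<close> covers either pattern.\<close>
  have bound: "\<bar>a\<bar> \<le> 2"
    if \<alpha>: "\<alpha> \<in> RX" and \<beta>: "\<beta> \<in> RX" and a: "cart \<alpha> \<beta> = of_int a" and b: "cart \<beta> \<alpha> = of_int b"
      and ab: "a * b < 0" for \<alpha> \<beta> a b
    using cart_opposite_bound[OF \<alpha> \<beta> a b] cart_opposite_bound[OF RX_uminus[OF \<alpha>] \<beta>, of "- a" "- b"] a b ab
    by (auto simp: mult_less_0_iff cart_uminus cart_uminus_right RX_Hs \<alpha>)
  let ?\<alpha> = "refl \<beta> \<alpha>" and ?\<beta> = "refl \<alpha> \<beta>"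
  have H: "\<alpha> \<in> Hs" "\<beta> \<in> Hs" "ip \<alpha> \<alpha> \<noteq> 0" "ip \<beta> \<beta> \<noteq> 0" using \<alpha> \<beta> RX_iff RX_Hs by auto
  note r = cart_relation[OF \<alpha> \<beta> a b]
  have r2: "of_int a * (2 * ip \<beta> \<beta>) = 2 * (2 * ip \<alpha> \<beta>)" "of_int b * (2 * ip \<alpha> \<alpha>) = 2 * (2 * ip \<alpha> \<beta>)"
    unfolding mult.left_commute[of "of_int a" 2] mult.left_commute[of "of_int b" 2] r by simp_all
  have "2 * ip ?\<alpha> ?\<beta> = 2 * ip \<alpha> \<beta> - of_int b * (2 * ip \<alpha> \<alpha>) - of_int a * (2 * ip \<beta> \<beta>)
      + of_int (a * b) * (2 * ip \<alpha> \<beta>)"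
    using H ip_sym[of \<beta> \<alpha>] by (simp add: refl_def a b ip_simps ip_fsc Hs_fsc algebra_simps)
  also have "\<dots> = of_int (a * b - 3) * (2 * ip \<alpha> \<beta>)"
    unfolding r2 by (simp add: algebra_simps)
  finally have e: "2 * ip ?\<alpha> ?\<beta> = of_int (a * b - 3) * (2 * ip \<alpha> \<beta>)" .
  have n: "ip ?\<alpha> ?\<alpha> = ip \<alpha> \<alpha>" "ip ?\<beta> ?\<beta> = ip \<beta> \<beta>"
    using refl_ip \<alpha> \<beta> H by auto
  have c1: "cart ?\<alpha> ?\<beta> = of_int ((a * b - 3) * a)"
    unfolding cart_def e n using a by (simp add: cart_def flip: times_divide_eq_right)
  have c2: "cart ?\<beta> ?\<alpha> = of_int ((a * b - 3) * b)"
    unfolding cart_def ip_sym[of ?\<beta> ?\<alpha>] e n using b ip_sym[of \<beta> \<alpha>]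
    by (simp add: cart_def flip: times_divide_eq_right)
  have "(a * b - 3) * a * ((a * b - 3) * b) = (a * b - 3) * (a * b - 3) * (a * b)"
    by (simp add: algebra_simps)
  also have "\<dots> < 0" using neg by (intro mult_pos_neg[OF mult_neg_neg]) auto
  finally have p: "(a * b - 3) * a * ((a * b - 3) * b) < 0" .
  have "\<bar>(a * b - 3) * a\<bar> \<le> 2"
    using bound[OF refl_RX[OF \<beta> \<alpha>] refl_RX[OF \<alpha> \<beta>] c1 c2 p] .
  moreover have "\<bar>(a * b - 3) * a\<bar> \<ge> 3 * 1"
    unfolding abs_mult using neg by (intro mult_mono) (cases "a = 0"; auto)+
  ultimately show False by simp
qed

text \<open>Two nonorthogonal roots have nonzero Cartan numbers of equal sign, and the quotient of
  these is the ratio of the norms. So the roots comparable to \<open>\<alpha>\<close> are orthogonal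
  to all others, and connectedness leaves no others.\<close>

lemma norm_ratio_pos:
  assumes \<alpha>: "\<alpha> \<in> RX" and \<beta>: "\<beta> \<in> RX"
  shows "\<exists>q>0. ip \<beta> \<beta> = of_rat q * ip \<alpha> \<alpha>"
proof -
  let ?P = "{\<beta>\<in>RX. \<exists>q>0. ip \<beta> \<beta> = of_rat q * ip \<alpha> \<alpha>}"
  have "ip \<beta> \<gamma> = 0" if b: "\<beta> \<in> ?P" and g: "\<gamma> \<in> RX - ?P" for \<beta> \<gamma>
  proof (rule ccontr)
    assume nz: "ip \<beta> \<gamma> \<noteq> 0"
    have bX: "\<beta> \<in> RX" and gX: "\<gamma> \<in> RX" using b g by auto
    obtain q where q: "q > 0" "ip \<beta> \<beta> = of_rat q * ip \<alpha> \<alpha>" using b by blast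
    obtain m where m: "cart \<beta> \<gamma> = of_int m" using cart_int[OF gX] bX RX_iff by blast
    obtain n where n: "cart \<gamma> \<beta> = of_int n" using cart_int[OF bX] gX RX_iff by blast
    note r = cart_relation[OF bX gX m n]
    have mn: "m \<noteq> 0" "n \<noteq> 0" using r nz by auto
    have "m * n \<ge> 0" by (rule cart_product_nonneg[OF bX gX m n])
    then have "(0 < m \<and> 0 < n) \<or> (m < 0 \<and> n < 0)" using mn by (auto simp: zero_le_mult_iff)
    then have pos: "of_int n / of_int m * q > (0::rat)"
      using q(1) by (intro mult_pos_pos) (auto simp: zero_less_divide_iff)
    have "of_int m * ip \<gamma> \<gamma> = of_int n * ip \<beta> \<beta>" using r by simp
    then have "ip \<gamma> \<gamma> = of_rat (of_int n / of_int m * q) * ip \<alpha> \<alpha>"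
      using mn q(2) by (simp add: of_rat_mult of_rat_divide field_simps)
    then have "\<gamma> \<in> ?P" using pos gX by blast
    then show False using g by blast
  qed
  moreover have "\<alpha> \<in> ?P" using \<alpha> by (auto intro!: exI[of _ 1])
  moreover have "?P \<inter> (RX - ?P) = {}" "?P \<union> (RX - ?P) = RX" by blast+
  ultimately have "RX - ?P = {}" using RX_conn by (metis (no_types, lifting) empty_iff)
  then show ?thesis using \<beta> by blast
qed

text \<open>For a below -4 the string contains \<open>\<alpha> + 2 \<beta>\<close>, nonisotropic
  because its Cartan number a + 4 is nonzero. Its norm is p + 2 a + 4 in units of the norm of
  \<open>\<beta>\<close>, where p, the ratio of the two norms, is at most - a; so the norm ratio
  would be negative. At a = -4 the root can be 0, namely for
  \<open>\<alpha> = - 2 \<beta>\<close>.\<close>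

lemma cart_lower_bound:
  assumes \<alpha>: "\<alpha> \<in> RX" and \<beta>: "\<beta> \<in> RX" and a: "cart \<alpha> \<beta> = of_int a"
  shows "a \<ge> - 4"
proof (rule ccontr)
  assume "\<not> ?thesis"
  then have a5: "a \<le> - 5" by simp
  have H: "\<alpha> \<in> Hs" "\<beta> \<in> Hs" "ip \<beta> \<beta> \<noteq> 0" using \<alpha> \<beta> RX_iff RX_Hs by auto
  obtain b where b: "cart \<beta> \<alpha> = of_int b" using cart_int[OF \<alpha>] \<beta> RX_iff by blast
  note r = cart_relation[OF \<alpha> \<beta> a b]
  obtain p where p: "p > 0" "ip \<alpha> \<alpha> = of_rat p * ip \<beta> \<beta>" using norm_ratio_pos[OF \<beta> \<alpha>] by blast
  have "of_int b * of_rat p * ip \<beta> \<beta> = of_int a * ip \<beta> \<beta>"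
    using r p(2) by (simp add: mult.assoc)
  then have "(of_rat (of_int b * p) :: 'k) = of_rat (of_int a)"
    using H(3) by (simp add: of_rat_mult)
  then have bp: "of_int b * p = of_int a" unfolding of_rat_eq_iff .
  then have "of_int b * p < 0" using a5 by simp
  then have "b \<le> - 1" using p(1) by (simp add: mult_less_0_iff)
  then have "of_int b \<le> (- 1 :: rat)" by (metis of_int_1 of_int_le_iff of_int_minus)
  then have pa: "p \<le> - of_int a" using mult_right_mono[of "of_int b" "- 1" p] p(1) bp by simp
  let ?\<gamma> = "\<alpha> + fsc 2 \<beta>"
  have g: "?\<gamma> \<in> R" using string_up[OF \<beta>, of \<alpha> "nat (- a)" 2] \<alpha> a a5 by (simp add: RX_iff)
  have "cart ?\<gamma> \<beta> = of_int (a + 4)"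
    using a H cart_self[OF \<beta>] by (simp add: cart_add cart_fsc Hs_fsc)
  moreover have "(of_int (a + 4) :: 'k) \<noteq> 0" using a5 by (simp only: of_int_eq_0_iff)
  ultimately have "ip ?\<gamma> \<beta> \<noteq> 0" by (auto simp: cart_def)
  then have "?\<gamma> \<in> RX"
    using g isotropic_orthogonal[of ?\<gamma> \<beta>] \<beta> ip_sym[of \<beta> ?\<gamma>] by (auto simp: RX_iff R0_iff)
  then obtain q where q: "q > 0" "ip ?\<gamma> ?\<gamma> = of_rat q * ip \<beta> \<beta>" using norm_ratio_pos[OF \<beta>] by blast
  have "ip ?\<gamma> ?\<gamma> = ip \<alpha> \<alpha> + 2 * (2 * ip \<alpha> \<beta>) + 4 * ip \<beta> \<beta>"
    using H ip_sym[of \<beta> \<alpha>] by (simp add: ip_simps ip_fsc Hs_fsc)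
  also have "\<dots> = of_rat (p + 2 * of_int a + 4) * ip \<beta> \<beta>"
    unfolding r(1)[symmetric] p(2) by (simp add: of_rat_add of_rat_mult algebra_simps)
  finally have "q = p + 2 * of_int a + 4" using q(2) H(3) by simp
  moreover have "of_int a \<le> (- 5 :: rat)" using a5 by (metis of_int_le_iff of_int_minus of_int_numeral)
  ultimately show False using q(1) pa by linarith
qed

lemma cart_bound:
  assumes \<alpha>: "\<alpha> \<in> RX" and \<beta>: "\<beta> \<in> RX" and a: "cart \<alpha> \<beta> = of_int a"
  shows "\<bar>a\<bar> \<le> 4"
  using cart_lower_bound[OF assms] cart_lower_bound[OF RX_uminus[OF \<alpha>] \<beta>, of "- a"] a
  by (simp add: cart_uminus RX_Hs \<alpha>)

end

subsection \<open>The finite root system\<close>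

locale based_toral_lie = toral_lie sc br B H
  for sc :: "'k::field_char_0 \<Rightarrow> 'l::ab_group_add \<Rightarrow> 'l"
    and br :: "'l \<Rightarrow> 'l \<Rightarrow> 'l" and B :: "'l \<Rightarrow> 'l \<Rightarrow> 'k" and H :: "'l set" +
  fixes l :: nat and al :: "nat \<Rightarrow> 'l \<Rightarrow> 'k" and ep em :: "nat \<Rightarrow> 'l"
  assumes base: "std_base sc br B H l al"
    and chev: "chev_gens sc br B H l al ep em"
begin

section \<open>Representatives of roots modulo the radical\<close>

abbreviation "Z \<equiv> zcomb l al"
abbreviation "rad \<equiv> lrad B H R"
abbreviation "D \<equiv> Rdot sc br B H l al"

lemma rad_iff: "v \<in> rad \<longleftrightarrow> (\<forall>\<beta>\<in>R. ip v \<beta> = 0)"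
  by (simp add: lrad_def)

lemma al_R: "i < l \<Longrightarrow> al i \<in> R"
  and q_indep: "qcomb l al c \<in> rad \<Longrightarrow> i < l \<Longrightarrow> c i = 0"
  and root_coeffs: "r \<in> R \<Longrightarrow> \<exists>n. ((\<forall>i<l. 0 \<le> n i) \<or> (\<forall>i<l. n i \<le> 0)) \<and> r - Z n \<in> rad"
  using base unfolding std_base_def by blast+

lemma al_Hs: "i < l \<Longrightarrow> al i \<in> Hs"
  using al_R R_Hs by blast

lemma Z_eq_qcomb: "Z n = qcomb l al (\<lambda>i. of_int (n i))"
  by (simp add: zcomb_def qcomb_def)

lemma qcomb_Hs: "qcomb l al c \<in> Hs"
  unfolding qcomb_def by (rule Hs_sum) (simp add: al_Hs)

lemma Z_Hs: "Z n \<in> Hs"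
  unfolding Z_eq_qcomb by (rule qcomb_Hs)

lemma range_Z_Hs: "\<mu> \<in> range Z \<Longrightarrow> \<mu> \<in> Hs"
  using Z_Hs by auto

lemma ip_Z: "ip (Z n) \<gamma> = (\<Sum>i<l. of_int (n i) * ip (al i) \<gamma>)"
  unfolding zcomb_def by (rule ip_sum_left) (simp add: al_Hs)

lemma Z_add: "Z (\<lambda>i. m i + n i) = Z m + Z n"
  and Z_diff: "Z (\<lambda>i. m i - n i) = Z m - Z n"
  by (auto simp: zcomb_def fun_eq_iff sum.distrib sum_subtractf algebra_simps)

lemma Z_uminus: "Z (\<lambda>i. - n i) = - Z n"
  by (auto simp: zcomb_def fun_eq_iff sum_negf)

lemma Z_single: "i < l \<Longrightarrow> Z (\<lambda>j. if j = i then k else 0) = fsc (of_int k) (al i)"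
  by (auto simp: zcomb_def fsc_def fun_eq_iff if_distrib[of of_int] if_distrib[of "\<lambda>x. x * _"] sum.delta cong: if_cong)

lemma Z_single1: "i < l \<Longrightarrow> Z (\<lambda>j. if j = i then 1 else 0) = al i"
  using Z_single[of i 1] by simp

lemma Z_zero: "Z (\<lambda>i. 0) = 0"
  by (auto simp: zcomb_def fun_eq_iff)

lemma Z_cong: "(\<And>i. i < l \<Longrightarrow> m i = n i) \<Longrightarrow> Z m = Z n"
  by (simp add: zcomb_def)

lemma Z_rad: "Z n \<in> rad \<Longrightarrow> i < l \<Longrightarrow> n i = 0"
  unfolding Z_eq_qcomb using q_indep[of "\<lambda>i. of_int (n i)" i] by simp

lemma rad_diff: "u \<in> rad \<Longrightarrow> v \<in> rad \<Longrightarrow> u \<in> Hs \<Longrightarrow> v \<in> Hs \<Longrightarrow> u - v \<in> rad"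
  and rad_add: "u \<in> rad \<Longrightarrow> v \<in> rad \<Longrightarrow> u \<in> Hs \<Longrightarrow> v \<in> Hs \<Longrightarrow> u + v \<in> rad"
  and rad_uminus: "u \<in> rad \<Longrightarrow> u \<in> Hs \<Longrightarrow> - u \<in> rad"
  by (simp_all add: rad_iff ip_simps)

lemma rad_zero [simp]: "0 \<in> rad"
  by (simp add: rad_iff)

lemma Z_inj_rad: "Z m - Z n \<in> rad \<Longrightarrow> i < l \<Longrightarrow> m i = n i"
  using Z_rad[of "\<lambda>i. m i - n i" i] by (simp add: Z_diff)

lemma Z_inj: "Z m = Z n \<Longrightarrow> i < l \<Longrightarrow> m i = n i"
  by (rule Z_inj_rad) simp_all

lemma Z_rad_eq: "\<mu> \<in> range Z \<Longrightarrow> \<nu> \<in> range Z \<Longrightarrow> \<mu> - \<nu> \<in> rad \<Longrightarrow> \<mu> = \<nu>"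
  using Z_inj_rad Z_cong by blast

text \<open>The image of a root in the quotient by the radical, realised inside the integral span of
  the base; by \<open>Z_rad_eq\<close> there is only one candidate.\<close>

definition dot where "dot r = (SOME \<mu>. \<mu> \<in> range Z \<and> r - \<mu> \<in> rad)"

lemma dot_props: "r \<in> R \<Longrightarrow> dot r \<in> range Z \<and> r - dot r \<in> rad"
proof -
  assume "r \<in> R"
  then obtain n where "r - Z n \<in> rad" using root_coeffs by blast
  then have "\<exists>\<mu>. \<mu> \<in> range Z \<and> r - \<mu> \<in> rad" by (intro exI[of _ "Z n"]) simp
  then show ?thesis unfolding dot_def by (rule someI_ex)
qed

lemma dot_Z: "r \<in> R \<Longrightarrow> dot r \<in> range Z" and dot_rad: "r \<in> R \<Longrightarrow> r - dot r \<in> rad"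
  using dot_props by blast+

lemma dot_Hs: "r \<in> R \<Longrightarrow> dot r \<in> Hs"
  using dot_Z range_Z_Hs by blast

lemma dot_eqI:
  assumes r: "r \<in> R" and \<mu>: "\<mu> \<in> range Z" "r - \<mu> \<in> rad"
  shows "dot r = \<mu>"
proof (rule Z_rad_eq[OF dot_Z[OF r] \<mu>(1)])
  have H: "r \<in> Hs" "dot r \<in> Hs" "\<mu> \<in> Hs" using R_Hs dot_Hs r \<mu> Z_Hs by auto
  have "(r - \<mu>) - (r - dot r) \<in> rad"
    by (rule rad_diff[OF \<mu>(2) dot_rad[OF r]]) (intro Hs_diff H)+
  then show "dot r - \<mu> \<in> rad" by (simp add: algebra_simps)
qed

lemma Z_in_R: "\<mu> \<in> range Z \<Longrightarrow> \<mu> \<in> R \<Longrightarrow> dot \<mu> = \<mu>"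
  by (rule dot_eqI) auto

lemma dot_al: "i < l \<Longrightarrow> dot (al i) = al i"
  using Z_in_R[of "al i"] al_R Z_single1 by (metis rangeI)

lemma ip_rad_Z: "v \<in> rad \<Longrightarrow> \<mu> \<in> range Z \<Longrightarrow> ip \<mu> v = 0"
  using al_R ip_sym[of v] by (auto simp: ip_Z rad_iff intro!: sum.neutral)

lemma ip_dot:
  assumes "\<alpha> \<in> R" "\<beta> \<in> R"
  shows "ip (dot \<alpha>) (dot \<beta>) = ip \<alpha> \<beta>" "ip (dot \<alpha>) \<beta> = ip \<alpha> \<beta>" "ip \<alpha> (dot \<beta>) = ip \<alpha> \<beta>"
proof -
  have H: "\<alpha> \<in> Hs" "\<beta> \<in> Hs" "dot \<alpha> \<in> Hs" "dot \<beta> \<in> Hs" using assms R_Hs dot_Hs by auto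
  have "ip (\<alpha> - dot \<alpha>) \<beta> = 0" using dot_rad[OF assms(1)] assms(2) by (simp add: rad_iff)
  then show 1: "ip (dot \<alpha>) \<beta> = ip \<alpha> \<beta>" using H by (simp add: ip_simps)
  have "ip (\<beta> - dot \<beta>) \<alpha> = 0" using dot_rad[OF assms(2)] assms(1) by (simp add: rad_iff)
  then show "ip \<alpha> (dot \<beta>) = ip \<alpha> \<beta>"
    using H ip_sym[of \<beta> \<alpha>] ip_sym[of "dot \<beta>" \<alpha>] by (simp add: ip_simps)
  have "ip (dot \<alpha>) (\<beta> - dot \<beta>) = 0"
    by (rule ip_rad_Z[OF dot_rad[OF assms(2)] dot_Z[OF assms(1)]])
  then show "ip (dot \<alpha>) (dot \<beta>) = ip \<alpha> \<beta>" using H 1 by (simp add: ip_simps)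
qed

text \<open>\<open>Rdot\<close> admits rational coefficients; independence modulo the radical forces
  them to agree with the integral ones of \<open>dot r\<close>.\<close>

lemma D_iff: "\<mu> \<in> D \<longleftrightarrow> (\<exists>r\<in>R. \<mu> = dot r)"
proof
  assume "\<mu> \<in> D"
  then obtain c r where c: "\<mu> = qcomb l al c" and r: "r \<in> R" "r - \<mu> \<in> rad"
    unfolding Rdot_def by blast
  obtain n where n: "dot r = Z n" using dot_Z[OF r(1)] by blast
  have H: "r \<in> Hs" "dot r \<in> Hs" "\<mu> \<in> Hs" using R_Hs dot_Hs r c qcomb_Hs by auto
  have "(r - dot r) - (r - \<mu>) \<in> rad"
    by (rule rad_diff[OF dot_rad[OF r(1)] r(2)]) (intro Hs_diff H)+
  then have "\<mu> - dot r \<in> rad" by (simp add: algebra_simps)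
  moreover have "\<mu> - dot r = qcomb l al (\<lambda>i. c i - of_int (n i))"
    unfolding n c by (auto simp: qcomb_def zcomb_def fun_eq_iff of_rat_diff sum_subtractf algebra_simps)
  ultimately have "c i = of_int (n i)" if "i < l" for i
    using q_indep[of "\<lambda>i. c i - of_int (n i)" i] that by simp
  then have "\<mu> = dot r"
    unfolding n c by (auto simp: qcomb_def zcomb_def fun_eq_iff intro!: sum.cong)
  then show "\<exists>r\<in>R. \<mu> = dot r" using r by blast
next
  assume "\<exists>r\<in>R. \<mu> = dot r"
  then obtain r where r: "r \<in> R" "\<mu> = dot r" by blast
  then obtain n where "\<mu> = qcomb l al (\<lambda>i. of_int (n i))" using dot_Z[OF r(1)] Z_eq_qcomb by auto
  then show "\<mu> \<in> D"
    using r dot_rad[OF r(1)] unfolding Rdot_def by auto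
qed

lemma D_Z: "\<mu> \<in> D \<Longrightarrow> \<mu> \<in> range Z"
  using D_iff[of \<mu>] dot_Z by auto

lemma D_Hs: "\<mu> \<in> D \<Longrightarrow> \<mu> \<in> Hs"
  using D_Z range_Z_Hs by blast

lemma R_Z_D: "\<mu> \<in> R \<Longrightarrow> \<mu> \<in> range Z \<Longrightarrow> \<mu> \<in> D"
  unfolding D_iff by (rule bexI[of _ \<mu>]) (simp_all add: Z_in_R)

lemma R0_rad: "\<delta> \<in> R0 \<Longrightarrow> \<delta> \<in> rad"
  using isotropic_orthogonal ip_sym[of \<delta>] by (simp add: rad_iff)

lemma dot_eq_0: "r \<in> R \<Longrightarrow> dot r = 0 \<longleftrightarrow> r \<in> R0"
proof
  assume r: "r \<in> R" "dot r = 0"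
  then show "r \<in> R0" using ip_dot(1)[of r r] by (simp add: R0_iff)
next
  assume r: "r \<in> R" "r \<in> R0"
  show "dot r = 0"
    by (rule dot_eqI[OF r(1)]) (use R0_rad[OF r(2)] Z_zero in \<open>auto simp: image_iff intro: sym\<close>)
qed

lemma D0_iff: "\<mu> \<in> D - {0} \<longleftrightarrow> (\<exists>r\<in>RX. \<mu> = dot r)"
  using D_iff dot_eq_0 by (auto simp: RX_iff R0_iff)

lemma zero_D: "0 \<in> D"
  using D_iff dot_eq_0[OF zero_R] zero_R by (auto simp: R0_iff)

lemma uminus_dot: "r \<in> R \<Longrightarrow> dot (- r) = - dot r"
proof (rule dot_eqI)
  assume r: "r \<in> R"
  show "- r \<in> R" by (rule R_uminus[OF r])
  show "- dot r \<in> range Z" using dot_Z[OF r] Z_uminus[symmetric] by auto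
  have "- (r - dot r) \<in> rad" by (intro rad_uminus dot_rad Hs_diff R_Hs dot_Hs r)
  then show "- r - - dot r \<in> rad" by (simp add: algebra_simps)
qed

lemma D0_uminus: "\<mu> \<in> D - {0} \<Longrightarrow> - \<mu> \<in> D - {0}"
  unfolding D0_iff using RX_uminus uminus_dot by (metis RX_iff)

lemma D_sign:
  assumes "Z n \<in> D"
  shows "(\<forall>i<l. 0 \<le> n i) \<or> (\<forall>i<l. n i \<le> 0)"
proof -
  obtain r where r: "r \<in> R" "Z n = dot r" using assms D_iff by blast
  obtain m where m: "(\<forall>i<l. 0 \<le> m i) \<or> (\<forall>i<l. m i \<le> 0)" "r - Z m \<in> rad"
    using root_coeffs[OF r(1)] by blast
  have "dot r = Z m" by (rule dot_eqI[OF r(1) _ m(2)]) simp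
  then have "Z n = Z m" using r by simp
  then have "n i = m i" if "i < l" for i using Z_inj that by blast
  then show ?thesis using m(1) by simp
qed

section \<open>Simple reflections and descent of heights\<close>

lemma al_nz: "i < l \<Longrightarrow> al i \<noteq> 0"
  using Z_inj[of "\<lambda>j. if j = i then 1 else 0" "\<lambda>_. 0" i] by (auto simp: Z_single1 Z_zero)

lemma al_RX: "i < l \<Longrightarrow> al i \<in> RX"
  using al_R dot_al al_nz dot_eq_0[of "al i"] by (auto simp: RX_iff R0_iff)

lemma cart_dot: "r \<in> R \<Longrightarrow> i < l \<Longrightarrow> cart (dot r) (al i) = cart r (al i)"
  by (simp add: cart_def ip_dot(2) al_R)

lemma Z_refl: "i < l \<Longrightarrow> cart (Z n) (al i) = of_int k \<Longrightarrow> refl (al i) (Z n) = Z (n(i := n i - k))"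
proof -
  assume i: "i < l" and k: "cart (Z n) (al i) = of_int k"
  have "refl (al i) (Z n) = Z n - Z (\<lambda>j. if j = i then k else 0)"
    unfolding refl_def k Z_single[OF i] ..
  also have "\<dots> = Z (n(i := n i - k))"
    unfolding Z_diff[symmetric] by (rule Z_cong) auto
  finally show ?thesis .
qed

lemma refl_dot:
  assumes r: "r \<in> R" and i: "i < l"
  shows "dot (refl (al i) r) = refl (al i) (dot r)"
proof (rule dot_eqI)
  show "refl (al i) r \<in> R" by (rule refl_R[OF al_RX[OF i] r])
  obtain n where n: "dot r = Z n" using dot_Z[OF r] by blast
  obtain k where "cart r (al i) = of_int k" using cart_int[OF al_RX[OF i] r] by blast
  then have "cart (Z n) (al i) = of_int k" using cart_dot[OF r i] n by simp
  then show "refl (al i) (dot r) \<in> range Z" unfolding n using Z_refl[OF i] by blast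
  have "refl (al i) r - refl (al i) (dot r) = r - dot r"
    by (simp add: refl_def cart_dot[OF r i])
  then show "refl (al i) r - refl (al i) (dot r) \<in> rad" using dot_rad[OF r] by simp
qed

lemma D0_refl: "\<mu> \<in> D - {0} \<Longrightarrow> i < l \<Longrightarrow> refl (al i) \<mu> \<in> D - {0}"
  unfolding D0_iff using refl_dot refl_RX al_RX by (metis RX_iff)

lemma D0_cart_int: "\<mu> \<in> D - {0} \<Longrightarrow> i < l \<Longrightarrow> \<exists>k. cart \<mu> (al i) = of_int k"
  unfolding D0_iff using cart_dot cart_int al_RX by (metis RX_iff)

text \<open>A root r congruent to m times \<open>al i\<close> modulo the radical makes the Cartan
  number of \<open>al i\<close> against r equal to 2 / m, so m divides 2.\<close>

lemma D0_multiple: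
  assumes i: "i < l" and m: "fsc (of_int m) (al i) \<in> D" "m > 0"
  shows "m = 1 \<or> m = 2"
proof -
  obtain r where r: "r \<in> R" "fsc (of_int m) (al i) = dot r" using m D_iff by blast
  have aH: "al i \<in> Hs" and a0: "ip (al i) (al i) \<noteq> 0" using al_RX[OF i] RX_Hs RX_iff by auto
  have n: "ip r r = of_int m * of_int m * ip (al i) (al i)"
    unfolding ip_dot(1)[OF r(1) r(1), symmetric] r(2)[symmetric] using aH by (simp add: ip_fsc Hs_fsc)
  then have "r \<in> RX" using r(1) m(2) a0 by (simp add: RX_iff)
  then obtain p where p: "cart (al i) r = of_int p" using cart_int al_R[OF i] by blast
  have "ip (al i) r = of_int m * ip (al i) (al i)"
    using ip_dot(3)[OF al_R[OF i] r(1)] unfolding r(2)[symmetric] using aH by (simp add: ip_fsc)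
  then have "of_int p * of_int m = (2 :: 'k)"
    using p n m(2) a0 by (simp add: cart_def field_simps)
  then have "of_int (p * m) = (of_int 2 :: 'k)" by simp
  then have pm: "p * m = 2" unfolding of_int_eq_iff .
  then have "m dvd 2" by (metis dvd_triv_right)
  then have "m \<le> 2" by (rule zdvd_imp_le) simp
  then show ?thesis using m(2) by linarith
qed

text \<open>Expanding (r, r) over the base and dividing by it writes 1 as the sum of the numbers n_i
  k_i q_i / 2, with k_i the Cartan numbers and q_i the norm ratios. As all q_i are positive, some
  product n_i k_i is positive; \<open>norm_ratio_pos\<close> thus does the work of a positive
  definite form.\<close>

lemma descent_index:
  assumes n: "Z n \<in> D - {0}" and pos: "\<forall>i<l. 0 \<le> n i"
  shows "\<exists>i<l. n i > 0 \<and> (\<exists>k>0. cart (Z n) (al i) = of_int k)"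
proof (rule ccontr)
  assume no: "\<not> ?thesis"
  obtain r where r: "r \<in> RX" "Z n = dot r" using n D0_iff by blast
  have rR: "r \<in> R" and r0: "ip r r \<noteq> 0" using r RX_iff by auto
  have "\<forall>i. \<exists>k. i < l \<longrightarrow> cart (Z n) (al i) = of_int k" using D0_cart_int[OF n] by blast
  then obtain k where k: "\<And>i. i < l \<Longrightarrow> cart (Z n) (al i) = of_int (k i)" by metis
  have "\<forall>i. \<exists>q. i < l \<longrightarrow> q > 0 \<and> ip (al i) (al i) = of_rat q * ip r r"
    using norm_ratio_pos[OF r(1) al_RX] by metis
  then obtain q where q: "\<And>i. i < l \<Longrightarrow> q i > 0" "\<And>i. i < l \<Longrightarrow> ip (al i) (al i) = of_rat (q i) * ip r r"
    by metis
  have le: "of_int (n i) * of_int (k i) * q i / 2 \<le> 0" if i: "i < l" for i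
  proof -
    have "n i = 0 \<or> k i \<le> 0" using no k[OF i] i pos by (metis not_less order_le_less)
    then have "n i * k i \<le> 0" using pos i by (auto simp: mult_nonneg_nonpos)
    then have "of_int (n i * k i) \<le> (0::rat)" by (simp only: of_int_le_0_iff)
    then show ?thesis using q(1)[OF i] by (simp add: mult_nonpos_nonneg)
  qed
  have ipi: "ip (al i) r = of_int (k i) * of_rat (q i) / 2 * ip r r" if i: "i < l" for i
  proof -
    have "ip (Z n) (al i) = ip (al i) r"
      unfolding r(2) ip_dot(2)[OF rR al_R[OF i]] by (rule ip_sym)
    then have "2 * ip (al i) r = of_int (k i) * ip (al i) (al i)"
      using k[OF i] al_RX[OF i] by (simp add: cart_def RX_iff field_simps)
    then show ?thesis unfolding q(2)[OF i] by (simp add: field_simps)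
  qed
  have "ip r r = ip (Z n) r" unfolding r(2) ip_dot(2)[OF rR rR] ..
  also have "\<dots> = (\<Sum>i<l. of_int (n i) * (of_int (k i) * of_rat (q i) / 2 * ip r r))"
    unfolding ip_Z by (intro sum.cong refl) (simp only: ipi lessThan_iff)
  also have "\<dots> = (\<Sum>i<l. of_rat (of_int (n i) * of_int (k i) * q i / 2) * ip r r)"
    by (simp add: of_rat_mult of_rat_divide mult.assoc)
  also have "\<dots> = of_rat (\<Sum>i<l. of_int (n i) * of_int (k i) * q i / 2) * ip r r"
    by (simp add: of_rat_sum sum_distrib_right)
  finally have "(of_rat (\<Sum>i<l. of_int (n i) * of_int (k i) * q i / 2) :: 'k) = of_rat 1"
    using r0 by simp
  then have "(\<Sum>i<l. of_int (n i) * of_int (k i) * q i / 2) = 1"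
    unfolding of_rat_eq_iff .
  moreover have "(\<Sum>i<l. of_int (n i) * of_int (k i) * q i / 2) \<le> 0"
    using le by (intro sum_nonpos) auto
  ultimately show False by simp
qed

text \<open>Induction on the height, the sum of the coefficients. Doubles of simple roots are base
  cases because \<open>D\<close> may be non-reduced.\<close>

lemma descent_pos:
  assumes base: "\<And>i. i < l \<Longrightarrow> P (al i)" "\<And>i. i < l \<Longrightarrow> P (fsc 2 (al i))"
    and step: "\<And>i \<beta>. i < l \<Longrightarrow> \<beta> \<in> D - {0} \<Longrightarrow> P (refl (al i) \<beta>) \<Longrightarrow> P \<beta>"
    and n: "Z n \<in> D - {0}" "\<forall>i<l. 0 \<le> n i"
  shows "P (Z n)"
  using n
proof (induction "nat (\<Sum>i<l. n i)" arbitrary: n rule: less_induct)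
  case less
  obtain i k where i: "i < l" "n i > 0" and k: "k > 0" "cart (Z n) (al i) = of_int k"
    using descent_index[OF less.prems] by blast
  let ?m = "n(i := n i - k)"
  have m: "refl (al i) (Z n) = Z ?m" by (rule Z_refl[OF i(1) k(2)])
  have mD: "Z ?m \<in> D - {0}" using D0_refl[OF less.prems(1) i(1)] m by simp
  show ?case
  proof (cases "\<forall>j<l. 0 \<le> ?m j")
    case True
    have "(\<Sum>j<l. ?m j) = (\<Sum>j<l. n j) - k"
      using i(1) by (simp add: sum.remove[of "{..<l}" i])
    moreover have "(\<Sum>j<l. n j) \<ge> n i"
      using i less.prems(2) member_le_sum[of i "{..<l}" n] by auto
    ultimately have "nat (\<Sum>j<l. ?m j) < nat (\<Sum>j<l. n j)" using k(1) i(2) by linarith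
    then have "P (Z ?m)" using less.hyps[of ?m] mD True by blast
    then show ?thesis using step[OF i(1) less.prems(1)] m by simp
  next
    \<comment> \<open>The reflection changes coefficient i only. If the result is no longer
      nonnegative, \<open>D_sign\<close> makes it nonpositive, so all other coefficients are 0 and
      \<open>Z n\<close> is a multiple of \<open>al i\<close>.\<close>
    case False
    then have "\<forall>j<l. ?m j \<le> 0" using D_sign[of ?m] mD by blast
    then have z: "n j = 0" if "j < l" "j \<noteq> i" for j
      using less.prems(2) that by (metis fun_upd_other order_antisym)
    have "Z n = Z (\<lambda>j. if j = i then n i else 0)" by (rule Z_cong) (use z in auto)
    then have e: "Z n = fsc (of_int (n i)) (al i)" using Z_single[OF i(1)] by simp
    then have "n i = 1 \<or> n i = 2" using D0_multiple[OF i(1), of "n i"] less.prems(1) i(2) by auto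
    then show ?thesis using base i(1) e by auto
  qed
qed

text \<open>Simple reflections lower the height until a multiple of a simple root is reached.\<close>

lemma descent:
  assumes \<beta>: "\<beta> \<in> D - {0}"
    and base: "\<And>i. i < l \<Longrightarrow> P (al i)" "\<And>i. i < l \<Longrightarrow> P (fsc 2 (al i))"
      "\<And>i. i < l \<Longrightarrow> P (- al i)" "\<And>i. i < l \<Longrightarrow> P (- fsc 2 (al i))"
    and step: "\<And>i \<beta>. i < l \<Longrightarrow> \<beta> \<in> D - {0} \<Longrightarrow> P (refl (al i) \<beta>) \<Longrightarrow> P \<beta>"
  shows "P \<beta>"
proof -
  obtain n where n: "\<beta> = Z n" using \<beta> D_Z by blast
  have refl_uminus: "refl (al i) (- \<gamma>) = - refl (al i) \<gamma>" if "\<gamma> \<in> D - {0}" for i \<gamma>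
    using D_Hs that by (auto simp: refl_def cart_uminus algebra_simps)
  consider "\<forall>i<l. 0 \<le> n i" | "\<forall>i<l. n i \<le> 0" using D_sign \<beta> n by blast
  then show ?thesis
  proof cases
    case 1
    then show ?thesis unfolding n using descent_pos[of P n] base step \<beta> n by blast
  next
    case 2
    have "P (- Z (\<lambda>i. - n i))"
    proof (rule descent_pos[of "\<lambda>\<beta>. P (- \<beta>)"])
      show "Z (\<lambda>i. - n i) \<in> D - {0}" unfolding Z_uminus using D0_uminus \<beta> n by blast
      show "P (- \<gamma>)" if "i < l" "\<gamma> \<in> D - {0}" "P (- refl (al i) \<gamma>)" for i \<gamma>
        using step[OF that(1) D0_uminus[OF that(2)]] that(3) refl_uminus[OF that(2)] by simp
    qed (use base 2 in auto)
    then show ?thesis unfolding n Z_uminus by simp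
  qed
qed

section \<open>Finiteness and irreducibility\<close>

lemma qcomb_orth_base:
  assumes "\<And>i. i < l \<Longrightarrow> ip (qcomb l al c) (al i) = 0"
  shows "qcomb l al c \<in> rad"
  unfolding rad_iff
proof
  fix r assume r: "r \<in> R"
  obtain m where m: "dot r = Z m" using dot_Z[OF r] by blast
  have "ip (al i) (r - Z m) = 0" if "i < l" for i
    using dot_rad[OF r] m ip_sym[of "al i" "r - Z m"] al_R[OF that] by (simp add: rad_iff)
  then have "ip (qcomb l al c) (r - Z m) = 0"
    unfolding qcomb_def by (subst ip_sum_left) (auto simp: al_Hs)
  moreover have "ip (qcomb l al c) (Z m) = 0"
    unfolding ip_sym[of "qcomb l al c"] ip_Z using assms ip_sym[of _ "qcomb l al c"] by simp
  ultimately show "ip (qcomb l al c) r = 0" using R_Hs[OF r] Z_Hs[of m] by (simp add: ip_diff_right)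
qed

lemma Z_orth_base:
  assumes "\<mu> \<in> range Z" "\<nu> \<in> range Z" "\<And>i. i < l \<Longrightarrow> ip \<mu> (al i) = ip \<nu> (al i)"
  shows "\<mu> = \<nu>"
proof (rule Z_rad_eq[OF assms(1,2)])
  obtain p q where pq: "\<mu> = Z p" "\<nu> = Z q" using assms by blast
  have "ip (Z (\<lambda>i. p i - q i)) (al i) = 0" if "i < l" for i
    unfolding Z_diff using assms(3)[OF that] pq Z_Hs by (simp add: ip_diff_left)
  then have "Z (\<lambda>i. p i - q i) \<in> rad" unfolding Z_eq_qcomb by (rule qcomb_orth_base)
  then show "\<mu> - \<nu> \<in> rad" unfolding pq Z_diff .
qed

text \<open>A nonzero element is determined by its Cartan numbers against the base, by
  \<open>Z_orth_base\<close>, and \<open>cart_bound\<close> leaves nine values for each of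
  them.\<close>

lemma D_finite: "finite D"
proof -
  let ?F = "{..<l} \<rightarrow>\<^sub>E {- 4..(4::int)}"
  define c where "c \<mu> = (\<lambda>i\<in>{..<l}. SOME k. cart \<mu> (al i) = of_int k)" for \<mu>
  have c: "cart \<mu> (al i) = of_int (c \<mu> i)" if "\<mu> \<in> D - {0}" "i < l" for \<mu> i
    using someI_ex[OF D0_cart_int[OF that]] that(2) by (simp add: c_def)
  have "c \<mu> \<in> ?F" if \<mu>: "\<mu> \<in> D - {0}" for \<mu>
  proof (rule PiE_I)
    fix i assume "i \<in> {..<l}"
    then have i: "i < l" by simp
    obtain r where r: "r \<in> RX" "\<mu> = dot r" using \<mu> D0_iff by blast
    then have "cart r (al i) = of_int (c \<mu> i)"
      using c[OF \<mu> i] cart_dot[of r i] i by (simp add: RX_iff)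
    then have "\<bar>c \<mu> i\<bar> \<le> 4" using cart_bound[OF r(1) al_RX[OF i]] by blast
    then show "c \<mu> i \<in> {- 4..4}" by auto
  qed (simp add: c_def)
  then have "finite (c ` (D - {0}))"
    by (intro finite_subset[OF _ finite_PiE[of "{..<l}" "\<lambda>_. {- 4..4}"]]) auto
  moreover have "inj_on c (D - {0})"
  proof (rule inj_onI)
    fix \<mu> \<nu> assume \<mu>: "\<mu> \<in> D - {0}" and \<nu>: "\<nu> \<in> D - {0}" and e: "c \<mu> = c \<nu>"
    show "\<mu> = \<nu>"
    proof (rule Z_orth_base)
      show "\<mu> \<in> range Z" "\<nu> \<in> range Z" using \<mu> \<nu> D_Z by auto
      fix i assume i: "i < l"
      have "cart \<mu> (al i) = cart \<nu> (al i)" using c[OF \<mu> i] c[OF \<nu> i] e by simp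
      then show "ip \<mu> (al i) = ip \<nu> (al i)" using al_RX[OF i] by (simp add: cart_def RX_iff)
    qed
  qed
  ultimately have "finite (D - {0})" using finite_imageD by blast
  then show ?thesis by simp
qed

text \<open>Descent shows that every nonzero element of \<open>D\<close> is orthogonal to one of the
  two parts of the base. This would split the nonisotropic roots into two nonempty orthogonal
  classes, against connectedness.\<close>

lemma base_irreducible:
  assumes I: "I \<subseteq> {..<l}" "I \<noteq> {}" and orth: "\<And>i j. i \<in> I \<Longrightarrow> j < l \<Longrightarrow> j \<notin> I \<Longrightarrow> ip (al i) (al j) = 0"
  shows "I = {..<l}"
proof (rule ccontr)
  assume "I \<noteq> {..<l}"
  then obtain j0 where j0: "j0 < l" "j0 \<notin> I" using I by auto
  obtain i0 where i0: "i0 \<in> I" "i0 < l" using I by auto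
  let ?J = "{..<l} - I"
  define perp where "perp K \<beta> \<longleftrightarrow> (\<forall>k\<in>K. ip \<beta> (al k) = 0)" for K \<beta>
  have al_perp: "i \<in> I \<Longrightarrow> perp ?J (al i)" "i \<in> ?J \<Longrightarrow> perp I (al i)" for i
    using orth[of _ i] orth[of i] ip_sym[of "al i"] by (auto simp: perp_def)
  have perp_fsc: "perp K (fsc c \<gamma>)" "perp K (- fsc c \<gamma>)" "perp K (- \<gamma>)" if "perp K \<gamma>" "\<gamma> \<in> Hs" for K c \<gamma>
    using that by (simp_all add: perp_def ip_fsc ip_uminus_left Hs_fsc)
  \<comment> \<open>If i lies in K, orthogonality of the reflected root to \<open>al i\<close> makes
    the reflection trivial; otherwise \<open>al i\<close> is itself orthogonal to K and subtracting
    a multiple of it changes nothing.\<close>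
  have step: "perp K \<beta>"
    if i: "i < l" and \<beta>: "\<beta> \<in> D - {0}" and r: "perp K (refl (al i) \<beta>)" and K: "i \<notin> K \<Longrightarrow> perp K (al i)" for i \<beta> K
  proof (cases "i \<in> K")
    case True
    have aH: "al i \<in> Hs" and a0: "ip (al i) (al i) \<noteq> 0" using al_RX[OF i] RX_Hs RX_iff by auto
    have "ip (refl (al i) \<beta>) (al i) = 0" using r True by (simp add: perp_def)
    then have "cart \<beta> (al i) = 0"
      using aH a0 D_Hs \<beta> by (simp add: refl_def ip_simps ip_fsc Hs_fsc cart_def)
    then show ?thesis using r by (simp add: refl_def)
  next
    case False
    then show ?thesis
      using r K[OF False] \<beta> D_Hs al_Hs[OF i] by (simp add: perp_def refl_def ip_simps ip_fsc Hs_fsc)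
  qed
  have split: "perp ?J \<beta> \<or> perp I \<beta>" if "\<beta> \<in> D - {0}" for \<beta>
  proof (rule descent[OF that, of "\<lambda>\<beta>. perp ?J \<beta> \<or> perp I \<beta>"])
    fix i assume i: "i < l"
    show a: "perp ?J (al i) \<or> perp I (al i)" using al_perp[of i] i by blast
    show "perp ?J (fsc 2 (al i)) \<or> perp I (fsc 2 (al i))" "perp ?J (- al i) \<or> perp I (- al i)"
      "perp ?J (- fsc 2 (al i)) \<or> perp I (- fsc 2 (al i))"
      using a perp_fsc[OF _ al_Hs[OF i]] by blast+
  next
    fix i \<beta> assume i: "i < l" "\<beta> \<in> D - {0}" "perp ?J (refl (al i) \<beta>) \<or> perp I (refl (al i) \<beta>)"
    then show "perp ?J \<beta> \<or> perp I \<beta>" using step[OF i(1,2)] al_perp[of i] by blast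
  qed
  let ?P = "{r\<in>RX. perp ?J r}" and ?Q = "{r\<in>RX. \<not> perp ?J r}"
  have perp_dot: "perp K (dot r) \<longleftrightarrow> perp K r" if "r \<in> R" "K \<subseteq> {..<l}" for K r
    using that ip_dot(2)[OF that(1) al_R] by (auto simp: perp_def subset_iff)
  have "al i0 \<in> ?P" using al_RX[OF i0(2)] al_perp(1)[OF i0(1)] by blast
  moreover have "al j0 \<in> ?Q" using al_RX[OF j0(1)] j0 by (auto simp: perp_def RX_iff)
  moreover have "ip a b = 0" if a: "a \<in> ?P" and b: "b \<in> ?Q" for a b
  proof -
    have R: "a \<in> R" "b \<in> R" using a b RX_iff by auto
    obtain n where n: "dot a = Z n" using dot_Z[OF R(1)] by blast
    \<comment> \<open>The part of \<open>dot a\<close> outside I is orthogonal to the whole base,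
      hence 0. So \<open>dot a\<close> is a combination of the \<open>al i\<close> with i in I, and
      b is orthogonal to all of these.\<close>
    let ?nI = "\<lambda>i. if i \<in> I then n i else 0" and ?nJ = "\<lambda>i. if i \<in> I then 0 else n i"
    have nn: "Z n = Z ?nI + Z ?nJ" unfolding Z_add[symmetric] by (rule Z_cong) auto
    have z: "ip (Z ?nI) x = 0" if "\<And>i. i \<in> I \<Longrightarrow> ip (al i) x = 0" for x
      unfolding ip_Z using that by (intro sum.neutral) auto
    have "ip (Z ?nJ) (al i) = 0" if i: "i < l" for i
    proof (cases "i \<in> I")
      case True
      then show ?thesis unfolding ip_Z using orth[OF True] ip_sym[of "al i"] by (intro sum.neutral) auto
    next
      case False
      then have "ip (Z n) (al i) = 0" using a i perp_dot[OF R(1), of ?J] n by (auto simp: perp_def)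
      then show ?thesis using z[of "al i"] orth[OF _ i False] Z_Hs by (simp add: nn ip_add_left)
    qed
    then have "Z ?nJ = 0" by (intro Z_orth_base) (use Z_zero in \<open>auto intro: sym\<close>)
    moreover have "dot b \<in> D - {0}" using b D0_iff by blast
    then have "perp I b" using split[of "dot b"] b perp_dot[OF R(2), of ?J] perp_dot[OF R(2) I(1)] by auto
    ultimately have "ip (dot a) b = 0"
      using z[of b] ip_sym[of b] by (simp add: n nn perp_def)
    then show ?thesis using ip_dot(2)[OF R] by simp
  qed
  moreover have "?P \<inter> ?Q = {}" "?P \<union> ?Q = RX" by blast+
  ultimately show False using RX_conn by (metis (no_types, lifting) empty_iff)
qed

text \<open>The root 0 is isotropic and not isolated, so some nonisotropic root exists; over an
  empty base its representative would be 0.\<close>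

lemma l_pos: "l > 0"
proof (rule ccontr)
  assume "\<not> ?thesis"
  then have l0: "l = 0" by simp
  have "0 \<in> R0" using zero_R by (simp add: R0_iff)
  then obtain \<alpha> where \<alpha>: "\<alpha> \<in> RX" using R0_nonisolated by blast
  then obtain n where "dot \<alpha> = Z n" using dot_Z RX_iff by blast
  then have "dot \<alpha> = 0" using l0 Z_cong[of n "\<lambda>_. 0"] Z_zero by simp
  then show False using \<alpha> dot_eq_0[of \<alpha>] by (simp add: RX_iff R0_iff)
qed

end

subsection \<open>The subalgebra generated by the Chevalley generators\<close>

text \<open>Right-normed commutators. The value at the empty list is a default, and
  \<open>words\<close> excludes that list.\<close>

fun word :: "('l \<Rightarrow> 'l \<Rightarrow> 'l::zero) \<Rightarrow> (nat \<Rightarrow> 'l) \<Rightarrow> nat list \<Rightarrow> 'l" where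
  "word b u [] = 0"
| "word b u [i] = u i"
| "word b u (i # j # is) = b (u i) (word b u (j # is))"

context based_toral_lie
begin

abbreviation "gd \<equiv> gdot sc br l ep em"
abbreviation "Hd \<equiv> Hdot sc B H l al"
abbreviation "wd \<equiv> word br"

definition "words u = {wd u is | is. is \<noteq> [] \<and> set is \<subseteq> {..<l}}"
definition "G0 = {hc (al i) | i. i < l}"
text \<open>A triangular decomposition: Cartan part, positive part, negative part. That its span
  contains \<open>gd\<close> is shown in \<open>gd_span\<close>.\<close>

definition "T0 = G0 \<union> words ep \<union> words em"

lemma ep_L: "i < l \<Longrightarrow> ep i \<in> L (al i)" and em_L: "i < l \<Longrightarrow> em i \<in> L (- al i)"
  and ep_em: "i < l \<Longrightarrow> br (ep i) (em i) = hc (al i)"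
  using chev unfolding chev_gens_def by auto

lemma hc_al_nz: "i < l \<Longrightarrow> hc (al i) \<noteq> 0"
  by (simp add: hc_nz al_RX)

lemma ep_nz: "i < l \<Longrightarrow> ep i \<noteq> 0" and em_nz: "i < l \<Longrightarrow> em i \<noteq> 0"
  using ep_em hc_al_nz by force+

lemma gd_lsubalg: "lsubalg sc br gd"
  unfolding gdot_def by (rule gen_subalg_lsubalg)

lemma gd_subspace: "subspace gd" and gd_br: "x \<in> gd \<Longrightarrow> y \<in> gd \<Longrightarrow> br x y \<in> gd"
  using gd_lsubalg lsubalg_subspace lsubalg_br by blast+

lemma ep_gd: "i < l \<Longrightarrow> ep i \<in> gd" and em_gd: "i < l \<Longrightarrow> em i \<in> gd"
  unfolding gdot_def by (rule gen_subalg_base, blast)+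

lemma hc_gd: "i < l \<Longrightarrow> hc (al i) \<in> gd"
  using gd_br[OF ep_gd em_gd] ep_em by metis

lemma tee_hc: "i < l \<Longrightarrow> tee (al i) = sc (ip (al i) (al i) / 2) (hc (al i))"
  using al_RX[of i] by (simp add: hcor_def RX_iff)

lemma Hd_eq: "Hd = span G0"
proof
  show "Hd \<subseteq> span G0"
    unfolding Hdot_def
  proof (rule span_minimal[OF _ subspace_span])
    show "{tee (al i) |i. i < l} \<subseteq> span G0"
      unfolding G0_def by (auto simp: tee_hc intro!: span_scale) (blast intro: span_base)
  qed
  show "span G0 \<subseteq> Hd"
    unfolding Hdot_def
  proof (rule span_minimal[OF _ subspace_span])
    show "G0 \<subseteq> span {tee (al i) |i. i < l}"
      unfolding G0_def hcor_def by (auto intro!: span_scale) (blast intro: span_base)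
  qed
qed

section \<open>The Cartan subalgebra and its weights\<close>

lemma G0_H: "G0 \<subseteq> H"
  by (auto simp: G0_def hc_H al_Hs)

lemma Hd_H: "Hd \<subseteq> H"
  unfolding Hd_eq by (rule span_minimal[OF G0_H H_subspace])

lemma Hd_subspace: "subspace Hd"
  unfolding Hd_eq by (rule subspace_span)

lemma Hd_gd: "Hd \<subseteq> gd"
  unfolding Hd_eq by (rule span_minimal) (auto simp: G0_def hc_gd gd_subspace)

lemma tee_Hd: "i < l \<Longrightarrow> tee (al i) \<in> Hd"
  unfolding Hdot_def by (rule span_base) blast

lemma Hd_explicit:
  assumes "x \<in> Hd"
  shows "\<exists>c. x = (\<Sum>i<l. sc (c i) (tee (al i)))"
proof -
  let ?t = "\<lambda>i. tee (al i)"
  have inj: "inj_on ?t {..<l}"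
  proof (rule inj_onI)
    fix i j assume ij: "i \<in> {..<l}" "j \<in> {..<l}" "?t i = ?t j"
    then have "al i - al j = 0" by (intro tee_eq_0) (auto simp: Hs_diff al_Hs tee_diff)
    then have "Z (\<lambda>k. if k = i then 1 else 0) = Z (\<lambda>k. if k = j then 1 else 0)"
      using ij by (simp add: Z_single1)
    from Z_inj[OF this, of i] show "i = j" using ij by (simp split: if_splits)
  qed
  have "Hd = span (?t ` {..<l})" unfolding Hdot_def by (rule arg_cong[of _ _ span]) auto
  then obtain u where "x = (\<Sum>v\<in>?t ` {..<l}. sc (u v) v)" using assms span_finite[of "?t ` {..<l}"] by auto
  then show ?thesis by (intro exI[of _ "\<lambda>i. u (?t i)"]) (simp add: sum.reindex[OF inj])
qed

text \<open>The Gram matrix of the base is rational up to a scalar, so its nondegeneracy over the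
  rationals passes to the ground field.\<close>

lemma Hd_nondeg:
  assumes x: "x \<in> Hd" and z: "\<And>i. i < l \<Longrightarrow> al i x = 0"
  shows "x = 0"
proof -
  define c0 where "c0 = ip (al 0) (al 0)"
  have a0: "al 0 \<in> RX" using al_RX l_pos by blast
  have c0: "c0 \<noteq> 0" using a0 by (simp add: c0_def RX_iff)
  have "\<exists>m. ip (al i) (al j) = of_rat m * c0" if ij: "i < l" "j < l" for i j
  proof -
    obtain q where q: "ip (al j) (al j) = of_rat q * c0"
      using norm_ratio_pos[OF a0 al_RX[OF ij(2)]] c0_def by blast
    obtain k where k: "cart (al i) (al j) = of_int k"
      using cart_int[OF al_RX[OF ij(2)] al_R[OF ij(1)]] by blast
    have "ip (al i) (al j) = of_int k / 2 * ip (al j) (al j)"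
      using k al_RX[OF ij(2)] by (simp add: cart_def RX_iff field_simps)
    then have "ip (al i) (al j) = of_rat (of_int k / 2 * q) * c0"
      unfolding q by (simp add: of_rat_mult of_rat_divide)
    then show ?thesis by blast
  qed
  then obtain M where M: "\<And>i j. i < l \<Longrightarrow> j < l \<Longrightarrow> ip (al i) (al j) = of_rat (M i j) * c0" by metis
  obtain c where c: "x = (\<Sum>i<l. sc (c i) (tee (al i)))" using Hd_explicit[OF x] by blast
  have "c k = 0" if k: "k < l" for k
  proof (rule rat_kernel_extension[of l M c, OF _ _ k])
    fix d :: "nat \<Rightarrow> rat" assume d: "\<And>j. j < l \<Longrightarrow> (\<Sum>i<l. d i * M i j) = 0"
    have "ip (qcomb l al d) (al j) = 0" if j: "j < l" for j
    proof -
      have "ip (qcomb l al d) (al j) = (\<Sum>i<l. of_rat (d i) * ip (al i) (al j))"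
        unfolding qcomb_def by (rule ip_sum_left) (simp add: al_Hs)
      also have "\<dots> = (\<Sum>i<l. of_rat (d i * M i j) * c0)"
        by (intro sum.cong) (auto simp: M[OF _ j] of_rat_mult)
      also have "\<dots> = of_rat (\<Sum>i<l. d i * M i j) * c0"
        by (simp add: of_rat_sum sum_distrib_right)
      finally show ?thesis using d[OF j] by simp
    qed
    then show "\<forall>i<l. d i = 0" using q_indep[OF qcomb_orth_base] by blast
  next
    fix j assume j: "j < l"
    have "B x (tee (al j)) = al j x"
      using B_tee[OF al_Hs[OF j], of x] x Hd_H B_sym[of x] by auto
    also have "B x (tee (al j)) = (\<Sum>i<l. c i * ip (al i) (al j))"
      unfolding c B_sum_left by (simp add: B_scale_left fD_def)
    also have "\<dots> = (\<Sum>i<l. c i * of_rat (M i j)) * c0"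
      unfolding sum_distrib_right by (intro sum.cong) (auto simp: M[OF _ j])
    finally show "(\<Sum>i<l. c i * of_rat (M i j)) = 0" using z[OF j] c0 by simp
  qed
  then show ?thesis unfolding c by (intro sum.neutral) auto
qed

lemma Hd_separates:
  assumes "\<mu> \<in> range Z" "\<nu> \<in> range Z" "\<And>h. h \<in> Hd \<Longrightarrow> \<mu> h = \<nu> h"
  shows "\<mu> = \<nu>"
  by (rule Z_orth_base[OF assms(1,2)])
    (use assms range_Z_Hs al_Hs in \<open>simp add: ip_eq1 tee_Hd\<close>)

text \<open>The difference of a root and its representative lies in the radical, and orthogonality
  to \<open>al i\<close> means vanishing at \<open>tee (al i)\<close>; these vectors span
  \<open>Hd\<close>.\<close>

lemma dot_restrict:
  assumes \<alpha>: "\<alpha> \<in> R" and h: "h \<in> Hd"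
  shows "\<alpha> h = dot \<alpha> h"
proof -
  have H: "\<alpha> \<in> Hs" "dot \<alpha> \<in> Hs" using R_Hs dot_Hs \<alpha> by auto
  obtain c where c: "h = (\<Sum>i<l. sc (c i) (tee (al i)))" using Hd_explicit[OF h] by blast
  have lin: "\<gamma> h = (\<Sum>i<l. c i * ip \<gamma> (al i))" if \<gamma>: "\<gamma> \<in> Hs" for \<gamma>
  proof -
    have "h \<in> H" using h Hd_H by blast
    then have "\<gamma> h = B h (tee \<gamma>)" using B_tee[OF \<gamma>] B_sym by metis
    also have "\<dots> = (\<Sum>i<l. c i * ip (al i) \<gamma>)" unfolding c B_sum_left by (simp add: B_scale_left fD_def)
    finally show ?thesis by (simp only: ip_sym[of \<gamma>])
  qed
  have "ip \<alpha> (al i) = ip (dot \<alpha>) (al i)" if "i < l" for i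
    using ip_dot(2)[OF \<alpha> al_R[OF that]] by simp
  then show ?thesis unfolding lin[OF H(1)] lin[OF H(2)] by simp
qed

text \<open>Passes from components for H to weights for \<open>Hd\<close>, where the root space of
  \<open>\<alpha>\<close> has weight \<open>dot \<alpha>\<close>. Applied both to \<open>gd\<close>
  and to the core.\<close>

lemma Hd_dsum:
  assumes M: "subspace M" and I: "I \<subseteq> range Z"
    and comp: "\<And>v \<alpha>. v \<in> M \<Longrightarrow> \<alpha> \<in> supp v \<Longrightarrow> dot \<alpha> \<in> I \<and> pr \<alpha> v \<in> M"
  shows "is_dsum (wsp sc br Hd M) I M"
proof (rule is_dsum_regroup)
  show "wsp sc br Hd M \<mu> \<subseteq> M" for \<mu> by (auto simp: wsp_def)
  show "subspace (wsp sc br Hd M \<mu>)" for \<mu> by (rule wsp_subspace[OF M])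
  fix v assume v: "v \<in> M"
  have "pr \<alpha> v \<in> wsp sc br Hd M (dot \<alpha>)" if \<alpha>: "\<alpha> \<in> supp v" for \<alpha>
    using comp[OF v \<alpha>] LD[OF pr_L] dot_restrict[OF supp_R[OF \<alpha>]] Hd_H by (auto simp: wsp_def)
  then show "\<exists>T (g :: ('l \<Rightarrow> 'k) \<Rightarrow> 'l) \<phi>. finite T \<and> (\<forall>t\<in>T. \<phi> t \<in> I \<and> g t \<in> wsp sc br Hd M (\<phi> t)) \<and> v = sum g T"
    using comp[OF v] supp_fin sum_pr
    by (intro exI[of _ "supp v"] exI[of _ "\<lambda>\<alpha>. pr \<alpha> v"] exI[of _ dot]) auto
next
  fix S f assume S: "finite S" "S \<subseteq> I" and f: "\<And>i. i \<in> S \<Longrightarrow> f i \<in> wsp sc br Hd M i" and s: "sum f S = 0"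
  show "\<forall>i\<in>S. f i = 0"
  proof (rule weight_components_zero[OF S(1) _ _ s])
    show "\<And>\<mu> \<nu>. \<mu> \<in> S \<Longrightarrow> \<nu> \<in> S \<Longrightarrow> (\<And>h. h \<in> Hd \<Longrightarrow> \<mu> h = \<nu> h) \<Longrightarrow> \<mu> = \<nu>"
      by (rule Hd_separates) (use I S(2) in blast)+
    show "\<And>\<mu>. \<mu> \<in> S \<Longrightarrow> f \<mu> \<in> wsp sc br Hd UNIV \<mu>" using f by (auto simp: wsp_def)
  qed
qed

section \<open>Triangular decomposition by words\<close>

lemma ep_em_off:
  assumes ij: "i < l" "j < l" "i \<noteq> j"
  shows "br (ep i) (em j) = 0"
proof (rule ccontr)
  assume nz: "br (ep i) (em j) \<noteq> 0"
  \<comment> \<open>Entry 1 at i and -1 at j: mixed signs, which \<open>D_sign\<close>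
    forbids.\<close>
  let ?n = "\<lambda>k. (if k = i then 1 else 0) - (if k = j then 1 else (0::int))"
  have "br (ep i) (em j) \<in> L (al i + - al j)" by (rule L_br[OF ep_L em_L]) fact+
  then have R: "al i + - al j \<in> R" using RI nz Hs_add Hs_uminus al_Hs ij by blast
  moreover have e: "al i + - al j = Z ?n"
    unfolding Z_diff using Z_single1 ij by simp
  ultimately have "Z ?n \<in> D" using R_Z_D[of "Z ?n"] by simp
  then show False using D_sign[of ?n] ij by fastforce
qed

lemma ep_em_span: "i < l \<Longrightarrow> j < l \<Longrightarrow> br (ep i) (em j) \<in> span G0"
  using ep_em[of i] ep_em_off[of i j]
  by (cases "i = j") (auto simp: G0_def span_zero intro!: span_base)

lemma em_ep_span: "i < l \<Longrightarrow> j < l \<Longrightarrow> br (em i) (ep j) \<in> span G0"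
  using ep_em_span[of j i] br_anti[of "em i" "ep j"] span_neg by metis

lemma Z_fsc_single: "i < l \<Longrightarrow> fsc (of_int s) (al i) = Z (\<lambda>j. if j = i then s else 0)"
  by (simp add: Z_single)

text \<open>The sign s lets one proof serve words in \<open>ep\<close> (s = 1) and in
  \<open>em\<close> (s = -1); the weight only counts letters.\<close>

lemma word_L:
  assumes u: "\<And>j. j < l \<Longrightarrow> u j \<in> L (fsc (of_int s) (al j))"
    and "is \<noteq> []" "set is \<subseteq> {..<l}"
  shows "wd u is \<in> L (Z (\<lambda>j. s * int (count_list is j)))"
  using assms(2,3)
proof (induction "is" rule: induct_list012)
  case (2 i)
  have "Z (\<lambda>j. s * int (count_list [i] j)) = fsc (of_int s) (al i)"
    using 2 by (auto simp: Z_fsc_single intro!: Z_cong)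
  then show ?case using u[of i] 2 by simp
next
  case (3 i j "is")
  have e: "Z (\<lambda>k. s * int (count_list (i # j # is) k))
      = fsc (of_int s) (al i) + Z (\<lambda>k. s * int (count_list (j # is) k))"
    using 3(4) by (simp add: Z_fsc_single Z_add[symmetric]) (intro Z_cong, simp add: algebra_simps)
  have "br (u i) (wd u (j # is)) \<in> L (fsc (of_int s) (al i) + Z (\<lambda>k. s * int (count_list (j # is) k)))"
    by (rule L_br[OF u 3(2)]) (use 3(4) in auto)
  then show ?case unfolding e[symmetric] by (simp only: word.simps)
qed simp

lemma words_base: "i < l \<Longrightarrow> u i \<in> words u"
  unfolding words_def by (intro CollectI exI[of _ "[i]"]) auto

text \<open>By the Jacobi identity an opposite generator either meets the first letter, giving an
  element of H that acts on the remaining word by a scalar, or passes on to the shorter word, where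
  induction applies.\<close>

lemma word_br:
  assumes u: "\<And>j. j < l \<Longrightarrow> u j \<in> L (fsc (of_int s) (al j))"
    and vu: "\<And>j. j < l \<Longrightarrow> br v (u j) \<in> span G0"
    and "is \<noteq> []" "set is \<subseteq> {..<l}"
  shows "br v (wd u is) \<in> span (G0 \<union> words u)"
  using assms(3,4)
proof (induction "is" rule: induct_list012)
  case (2 i)
  then show ?case using vu[of i] span_mono[of G0 "G0 \<union> words u"] by auto
next
  case (3 i j "is")
  let ?w = "wd u (j # is)"
  have i: "i < l" and js: "set (j # is) \<subseteq> {..<l}" using 3(4) by auto
  have w: "?w \<in> words u" using js unfolding words_def by blast
  have "br v (u i) \<in> H" using vu[OF i] span_minimal[OF G0_H H_subspace] by blast
  then have "br (br v (u i)) ?w \<in> span (words u)"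
    using LD[OF word_L[OF u _ js]] by (simp add: span_scale span_base[OF w])
  moreover have "br (u i) (br v ?w) \<in> span (words u)"
  proof (rule span_stable)
    show "br v ?w \<in> span (G0 \<union> words u)" using 3(2) js by simp
    fix t assume t: "t \<in> G0 \<union> words u"
    show "br (u i) t \<in> span (words u)"
    proof (cases "t \<in> G0")
      case True
      then have tH: "t \<in> H" using G0_H by blast
      have "u i \<in> words u" by (rule words_base[OF i])
      then have "br t (u i) \<in> span (words u)"
        using LD[OF u[OF i] tH] by (simp add: span_scale span_base)
      then show ?thesis using br_anti[of "u i" t] span_neg by metis
    next
      case False
      then obtain ks where ks: "t = wd u ks" "ks \<noteq> []" "set ks \<subseteq> {..<l}" using t words_def by auto
      then obtain k ks' where k: "ks = k # ks'" by (cases ks) auto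
      have "wd u (i # k # ks') \<in> words u" using ks(3) i unfolding words_def k by (intro CollectI exI[of _ "i # k # ks'"]) auto
      then show ?thesis using ks(1) k by (simp add: span_base)
    qed
  qed
  ultimately have "br (br v (u i)) ?w + br (u i) (br v ?w) \<in> span (words u)" by (rule span_add)
  then show ?case using span_mono[of "words u" "G0 \<union> words u"] br_br[of v "u i" ?w] by auto
qed simp

lemma ep_L': "i < l \<Longrightarrow> ep i \<in> L (fsc (of_int 1) (al i))"
  and em_L': "i < l \<Longrightarrow> em i \<in> L (fsc (of_int (- 1)) (al i))"
  using ep_L em_L by simp_all

lemma word_Cons: "is \<noteq> [] \<Longrightarrow> wd u (i # is) = br (u i) (wd u is)"
  by (cases "is") auto

lemma words_step:
  assumes "i < l" "t \<in> words u"
  shows "br (u i) t \<in> words u"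
proof -
  obtain ks where ks: "t = wd u ks" "ks \<noteq> []" "set ks \<subseteq> {..<l}" using assms words_def by auto
  then show ?thesis
    using assms(1) word_Cons[OF ks(2), of u i] unfolding words_def
    by (intro CollectI exI[of _ "i # ks"]) auto
qed

lemma T0_stable:
  assumes i: "i < l" and t: "t \<in> T0"
  shows "br (ep i) t \<in> span T0" "br (em i) t \<in> span T0"
proof -
  \<comment> \<open>Stated for generic families u and v because the argument is used once more with
    \<open>ep\<close> and \<open>em\<close> exchanged.\<close>
  have step: "br (u i) t \<in> span T0"
    if u: "u i \<in> L (fsc (of_int s) (al i))" and v: "\<And>j. j < l \<Longrightarrow> v j \<in> L (fsc (of_int s') (al j))"
      and uv: "\<And>j. j < l \<Longrightarrow> br (u i) (v j) \<in> span G0" and T0: "T0 = G0 \<union> words u \<union> words v"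
    for u v s s'
  proof -
    consider "t \<in> G0" | "t \<in> words u" | "t \<in> words v" using t T0 by blast
    then show ?thesis
    proof cases
      case 1
      then have "br t (u i) \<in> span (words u)"
        using LD[OF u, of t] G0_H words_base[OF i] by (auto simp: span_scale span_base)
      then have "br (u i) t \<in> span (words u)" using br_anti[of "u i" t] span_neg by metis
      then show ?thesis using span_mono[of "words u" T0] T0 by blast
    next
      case 2
      then show ?thesis using words_step[OF i] T0 by (blast intro: span_base)
    next
      case 3
      then obtain ks where "t = wd v ks" "ks \<noteq> []" "set ks \<subseteq> {..<l}" using words_def by auto
      then show ?thesis
        using word_br[OF v uv, of ks] span_mono[of "G0 \<union> words v" T0] T0 by blast
    qed
  qed
  show "br (ep i) t \<in> span T0"
    by (rule step[where u = ep and v = em, OF ep_L'[OF i] em_L' ep_em_span[OF i] T0_def])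
  show "br (em i) t \<in> span T0"
    by (rule step[where u = em and v = ep, OF em_L'[OF i] ep_L' em_ep_span[OF i]]) (auto simp: T0_def)
qed

text \<open>The stabiliser of \<open>span T0\<close> is a subalgebra containing the generators,
  hence all of \<open>gd\<close>. Therefore the part of \<open>gd\<close> inside
  \<open>span T0\<close> is closed under the bracket, and it contains the generators too.\<close>

lemma gd_span: "gd \<subseteq> span T0"
proof -
  let ?N = "{x. \<forall>m\<in>span T0. br x m \<in> span T0}"
  let ?S = "{ep i | i. i < l} \<union> {em i | i. i < l}"
  have "lsubalg sc br ?N"
    unfolding lsubalg_def
  proof (intro conjI ballI)
    show "subspace ?N"
      unfolding subspace_def by (auto simp: br_add_left br_scale_left span_zero span_add span_scale)
    fix x y assume x: "x \<in> ?N" and y: "y \<in> ?N"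
    have "br (br x y) m = br x (br y m) - br y (br x m)" for m
      using br_br[of x y m] by simp
    then show "br x y \<in> ?N" using x y by (auto intro!: span_diff)
  qed
  moreover have "?S \<subseteq> ?N"
    using T0_stable span_stable by (auto intro: span_stable[where S = T0])
  ultimately have gN: "gd \<subseteq> ?N" unfolding gdot_def by (rule gen_subalg_least)
  have "lsubalg sc br (gd \<inter> span T0)"
    unfolding lsubalg_def using gN gd_br gd_subspace by (auto intro!: subspace_inter)
  moreover have "?S \<subseteq> gd \<inter> span T0"
    using ep_gd em_gd words_base by (auto simp: T0_def intro!: span_base)
  ultimately have "gd \<subseteq> gd \<inter> span T0" unfolding gdot_def by (rule gen_subalg_least)
  then show ?thesis by blast
qed

lemma T0_hom:
  assumes "t \<in> T0"
  shows "\<exists>n. t \<in> L (Z n)"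
proof -
  have "t \<in> L (Z (\<lambda>_. 0))" if "t \<in> G0"
    using that G0_H H_L0 Z_zero by auto
  moreover have "\<exists>n. t \<in> L (Z n)" if "t \<in> words ep"
    using that word_L[OF ep_L'] unfolding words_def by blast
  moreover have "\<exists>n. t \<in> L (Z n)" if "t \<in> words em"
    using that word_L[OF em_L'] unfolding words_def by blast
  ultimately show ?thesis using assms T0_def by blast
qed

lemma gd_L_span:
  assumes "x \<in> gd" "x \<in> L \<beta>" "\<beta> \<in> Hs"
  shows "x \<in> span (T0 \<inter> L \<beta>)"
  by (rule span_hom_L[OF _ _ assms(2,3)]) (use T0_hom Z_Hs assms gd_span in blast)+

text \<open>Independence of the base forces every letter to be i. A word with i repeated is 0
  because the innermost bracket is that of an element with itself, so only the one-letter word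
  survives.\<close>

lemma word_L_mult:
  assumes u: "\<And>j. j < l \<Longrightarrow> u j \<in> L (fsc (of_int s) (al j))" and s: "s \<noteq> 0"
    and ks: "ks \<noteq> []" "set ks \<subseteq> {..<l}" and i: "i < l"
    and L: "wd u ks \<in> L (fsc (of_int k) (al i))" and nz: "wd u ks \<noteq> 0"
  shows "k = s \<and> wd u ks = u i"
proof -
  have "Z (\<lambda>j. s * int (count_list ks j)) = fsc (of_int k) (al i)"
    using L_unique[OF word_L[OF u ks] L Z_Hs _ nz] Hs_fsc al_Hs[OF i] by blast
  then have e: "Z (\<lambda>j. s * int (count_list ks j)) = Z (\<lambda>j. if j = i then k else 0)"
    using Z_fsc_single[OF i] by simp
  have c: "s * int (count_list ks j) = (if j = i then k else 0)" if "j < l" for j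
    using Z_inj[OF e that] .
  have "set ks \<subseteq> {i}"
  proof
    fix j assume j: "j \<in> set ks"
    then have "count_list ks j \<noteq> 0" by (simp add: count_list_0_iff)
    then show "j \<in> {i}" using c[of j] j ks(2) s by (auto split: if_splits)
  qed
  then have r: "ks = replicate (length ks) i" by (metis replicate_length_same singletonD subsetD)
  show ?thesis
  proof (cases "length ks = 1")
    case True
    then have "ks = [i]" using r by simp
    then show ?thesis using c[OF i] by simp
  next
    case False
    have z: "wd u (replicate (Suc (Suc n)) i) = 0" for n
      by (induction n) auto
    have "length ks = Suc (Suc (length ks - 2))" using False ks(1) by (cases ks; cases "tl ks") auto
    then have "wd u ks = 0" using r z by metis
    then show ?thesis using nz by simp
  qed
qed

lemma T0_L_mult:
  assumes t: "t \<in> T0" and i: "i < l" and L: "t \<in> L (fsc (of_int k) (al i))" and nz: "t \<noteq> 0"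
  shows "(k = 0 \<and> t \<in> G0) \<or> (k = 1 \<and> t = ep i) \<or> (k = - 1 \<and> t = em i)"
proof -
  have kH: "fsc (of_int k) (al i) \<in> Hs" using Hs_fsc al_Hs[OF i] by blast
  consider "t \<in> G0" | "t \<in> words ep" | "t \<in> words em" using t T0_def by blast
  then show ?thesis
  proof cases
    case 1
    then have "t \<in> L 0" using G0_H H_L0 by blast
    then have "fsc (of_int k) (al i) = 0" using L_unique[OF L _ kH _ nz] by simp
    then have "Z (\<lambda>j. if j = i then k else 0) = Z (\<lambda>_. 0)" using Z_fsc_single[OF i] Z_zero by simp
    from Z_inj[OF this i] show ?thesis using 1 by simp
  next
    case 2
    then obtain ks where "t = wd ep ks" "ks \<noteq> []" "set ks \<subseteq> {..<l}" using words_def by auto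
    then show ?thesis using word_L_mult[OF ep_L' _ _ _ i, of ks k] L nz by auto
  next
    case 3
    then obtain ks where "t = wd em ks" "ks \<noteq> []" "set ks \<subseteq> {..<l}" using words_def by auto
    then show ?thesis using word_L_mult[OF em_L' _ _ _ i, of ks k] L nz by auto
  qed
qed

lemma gd_L0: "x \<in> gd \<Longrightarrow> x \<in> L 0 \<Longrightarrow> x \<in> Hd"
proof -
  assume x: "x \<in> gd" "x \<in> L 0"
  have "T0 \<inter> L 0 \<subseteq> span G0"
  proof
    fix t assume t: "t \<in> T0 \<inter> L 0"
    show "t \<in> span G0"
    proof (cases "t = 0")
      case False
      then show ?thesis using T0_L_mult[of t 0 0] t l_pos by (auto intro: span_base)
    qed (simp add: span_zero)
  qed
  then have "span (T0 \<inter> L 0) \<subseteq> span G0" by (intro span_minimal subspace_span)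
  then show "x \<in> Hd" using gd_L_span[OF x] Hd_eq by auto
qed

text \<open>Supplies the base cases of all later descents inside \<open>gd\<close>.\<close>

lemma gd_L_mult:
  assumes x: "x \<in> gd" "x \<in> L (fsc (of_int k) (al i))" and i: "i < l" and k: "k \<noteq> 0"
  shows "(k = 1 \<and> x \<in> span {ep i}) \<or> (k = - 1 \<and> x \<in> span {em i}) \<or> x = 0"
proof -
  let ?S = "T0 \<inter> L (fsc (of_int k) (al i))"
  have xS: "x \<in> span ?S" by (rule gd_L_span[OF x]) (simp add: Hs_fsc al_Hs i)
  have S: "t = 0 \<or> (k = 1 \<and> t = ep i) \<or> (k = - 1 \<and> t = em i)" if "t \<in> ?S" for t
    using T0_L_mult[of t i k] that i k by auto
  have "span ?S \<subseteq> span (if k = 1 then {ep i} else if k = - 1 then {em i} else {})"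
  proof (rule span_minimal[OF subsetI subspace_span])
    fix t assume "t \<in> ?S"
    from S[OF this] show "t \<in> span (if k = 1 then {ep i} else if k = - 1 then {em i} else {})"
      by (auto intro: span_base simp: span_zero)
  qed
  then show ?thesis using xS by (auto split: if_splits)
qed

lemma H_stable_pr:
  assumes M: "subspace M" "\<And>h x. h \<in> H \<Longrightarrow> x \<in> M \<Longrightarrow> br h x \<in> M" and x: "x \<in> M"
  shows "pr \<alpha> x \<in> M"
proof (cases "\<alpha> \<in> supp x")
  case True
  have "\<forall>\<mu>\<in>supp x. pr \<mu> x \<in> M"
  proof (rule components_in_stable_subspace[OF M])
    show "\<And>\<mu> \<nu>. \<mu> \<in> supp x \<Longrightarrow> \<nu> \<in> supp x \<Longrightarrow> (\<And>h. h \<in> H \<Longrightarrow> \<mu> h = \<nu> h) \<Longrightarrow> \<mu> = \<nu>"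
      using supp_Hs by (intro Hs_eqI) blast+
  qed (use x pr_L supp_fin sum_pr in auto)
  then show ?thesis using True by blast
qed (use subspace_0[OF M(1)] in auto)

lemma gd_H_stable: "h \<in> H \<Longrightarrow> x \<in> gd \<Longrightarrow> br h x \<in> gd"
  unfolding gdot_def
proof (rule gen_subalg_stable_ad)
  fix s assume h: "h \<in> H" and s: "s \<in> {ep i | i. i < l} \<union> {em i | i. i < l}"
  then consider i where "i < l" "s = ep i" | i where "i < l" "s = em i" by blast
  then show "br h s \<in> gen_subalg sc br ({ep i | i. i < l} \<union> {em i | i. i < l})"
    unfolding gdot_def[symmetric]
  proof cases
    case 1 show "br h s \<in> gd"
      unfolding 1(2) LD[OF ep_L[OF 1(1)] h] by (rule subspace_scale[OF gd_subspace ep_gd[OF 1(1)]])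
  next
    case 2 show "br h s \<in> gd"
      unfolding 2(2) LD[OF em_L[OF 2(1)] h] by (rule subspace_scale[OF gd_subspace em_gd[OF 2(1)]])
  qed
qed

lemma gd_pr: "x \<in> gd \<Longrightarrow> pr \<alpha> x \<in> gd"
  using H_stable_pr[OF gd_subspace gd_H_stable] .

lemma gd_supp:
  assumes x: "x \<in> gd" and \<beta>: "\<beta> \<in> supp x"
  shows "\<beta> \<in> D"
proof -
  have "pr \<beta> x \<in> span (T0 \<inter> L \<beta>)"
    by (rule span_hom) (use T0_hom Z_Hs x gd_span in blast)+
  moreover have "pr \<beta> x \<noteq> 0" using \<beta> by simp
  ultimately obtain t where t: "t \<in> T0" "t \<in> L \<beta>" "t \<noteq> 0"
    using span_minimal[of "T0 \<inter> L \<beta>" "{0}"] by (auto simp: subspace_def)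
  obtain n where "t \<in> L (Z n)" using T0_hom t by blast
  then have "\<beta> = Z n" using L_unique[OF t(2) _ supp_Hs[OF \<beta>] Z_Hs t(3)] by blast
  then show ?thesis using R_Z_D[OF supp_R[OF \<beta>]] by simp
qed

section \<open>Weights of the generated subalgebra\<close>

definition "GW = {\<beta>\<in>Hs. \<exists>x\<in>gd \<inter> L \<beta>. x \<noteq> 0}"

lemma GW_R: "\<beta> \<in> GW \<Longrightarrow> \<beta> \<in> R"
  using RI unfolding GW_def by blast

lemma GW_D: "\<beta> \<in> GW \<Longrightarrow> \<beta> \<in> D"
proof -
  assume "\<beta> \<in> GW"
  then obtain x where x: "x \<in> gd" "x \<in> L \<beta>" "x \<noteq> 0" "\<beta> \<in> Hs" unfolding GW_def by blast
  then have "pr \<beta> x = x" using pr_hom[OF x(2,4), of \<beta>] by simp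
  then show ?thesis using gd_supp[OF x(1)] x(3) by simp
qed

lemma simple_reflection_weight_map:
  assumes i: "i < l" and \<beta>: "\<beta> \<in> Hs" and k: "cart \<beta> (al i) = of_int k"
  shows "\<exists>T. weight_map gd T \<beta> (refl (al i) \<beta>)"
  using reflection_weight_map[OF al_RX[OF i] ep_L[OF i] em_L[OF i] ep_em[OF i] \<beta> k]
    weight_map_mono[of "{ep i, em i}" _ \<beta> _ gd] ep_gd[OF i] em_gd[OF i] by blast

text \<open>The reflection map is built from brackets with \<open>ep i\<close> and
  \<open>em i\<close>, so it maps \<open>gd\<close> into itself.\<close>

lemma GW_refl:
  assumes \<beta>: "\<beta> \<in> GW" and i: "i < l"
  shows "refl (al i) \<beta> \<in> GW"
proof -
  have bH: "\<beta> \<in> Hs" using \<beta> GW_def by blast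
  obtain k where k: "cart \<beta> (al i) = of_int k" using cart_int[OF al_RX[OF i] GW_R[OF \<beta>]] by blast
  obtain T where "weight_map gd T \<beta> (refl (al i) \<beta>)"
    using simple_reflection_weight_map[OF i bH k] by blast
  note T = weight_mapD[OF this]
  obtain x where x: "x \<in> gd" "x \<in> L \<beta>" "x \<noteq> 0" using \<beta> GW_def by blast
  have "T x \<in> gd" using T(3)[of gd x] gd_br x(1) by blast
  then show ?thesis
    using T(4,5) x refl_Hs[OF al_Hs[OF i] bH] unfolding GW_def by blast
qed

lemma refl_refl: "i < l \<Longrightarrow> \<beta> \<in> Hs \<Longrightarrow> refl (al i) (refl (al i) \<beta>) = \<beta>"
proof -
  assume i: "i < l" and \<beta>: "\<beta> \<in> Hs"
  have "cart (refl (al i) \<beta>) (al i) = - cart \<beta> (al i)"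
    unfolding refl_def using \<beta> al_Hs[OF i] cart_self[OF al_RX[OF i]]
    by (simp add: cart_diff Hs_fsc cart_fsc)
  then show ?thesis by (simp add: refl_def)
qed

lemma refl_fsc: "\<beta> \<in> Hs \<Longrightarrow> refl \<alpha> (fsc c \<beta>) = fsc c (refl \<alpha> \<beta>)"
  unfolding refl_def cart_fsc by (auto simp: fsc_def fun_eq_iff algebra_simps)

lemma al_GW: "i < l \<Longrightarrow> al i \<in> GW" and uminus_al_GW: "i < l \<Longrightarrow> - al i \<in> GW"
  unfolding GW_def using ep_gd ep_L ep_nz em_gd em_L em_nz al_Hs Hs_uminus by blast+

text \<open>Reflections carry weights of \<open>gd\<close> to weights, so descent reduces the claim
  to simple roots and their doubles, up to sign; the second alternative accounts for a non-reduced
  \<open>D\<close>.\<close>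

lemma D0_GW:
  assumes "\<beta> \<in> D - {0}"
  shows "\<beta> \<in> GW \<or> (\<exists>\<nu>\<in>GW. \<beta> = fsc 2 \<nu>)"
proof (rule descent[OF assms, of "\<lambda>\<beta>. \<beta> \<in> GW \<or> (\<exists>\<nu>\<in>GW. \<beta> = fsc 2 \<nu>)"])
  fix i assume i: "i < l"
  have "- fsc 2 (al i) = fsc 2 (- al i)" by (auto simp: fsc_def fun_eq_iff)
  then show "- fsc 2 (al i) \<in> GW \<or> (\<exists>\<nu>\<in>GW. - fsc 2 (al i) = fsc 2 \<nu>)"
    using uminus_al_GW[OF i] by blast
next
  fix i \<beta> assume i: "i < l" and \<beta>: "\<beta> \<in> D - {0}"
    and r: "refl (al i) \<beta> \<in> GW \<or> (\<exists>\<nu>\<in>GW. refl (al i) \<beta> = fsc 2 \<nu>)"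
  have bH: "\<beta> \<in> Hs" using \<beta> D_Hs by blast
  show "\<beta> \<in> GW \<or> (\<exists>\<nu>\<in>GW. \<beta> = fsc 2 \<nu>)"
  proof (cases "refl (al i) \<beta> \<in> GW")
    case True
    then show ?thesis using GW_refl[OF True i] refl_refl[OF i bH] by simp
  next
    case False
    then obtain \<nu> where \<nu>: "\<nu> \<in> GW" "refl (al i) \<beta> = fsc 2 \<nu>" using r by blast
    then have "\<beta> = fsc 2 (refl (al i) \<nu>)"
      using refl_refl[OF i bH] refl_fsc[of \<nu> "al i" 2] GW_def by auto
    then show ?thesis using GW_refl[OF \<nu>(1) i] by blast
  qed
qed (use al_GW uminus_al_GW in blast)+

text \<open>The property is invariant under reflections, and at a simple root
  \<open>gd_L_mult\<close> rules out every multiple other than 0, 1 and -1.\<close>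

lemma GW_no_multiple:
  assumes \<beta>: "\<beta> \<in> D - {0}" and k: "k \<ge> 2"
  shows "fsc (of_int k) \<beta> \<notin> GW"
proof -
  have mult: "fsc (of_int k) (al i) \<notin> GW" if "i < l" "k \<ge> 2 \<or> k \<le> - 2" for i k
    using gd_L_mult[OF _ _ that(1), of _ k] that(2) unfolding GW_def by force
  have "\<forall>k\<ge>2. fsc (of_int k) \<beta> \<notin> GW"
  proof (rule descent[OF \<beta>, of "\<lambda>\<beta>. \<forall>k\<ge>2. fsc (of_int k) \<beta> \<notin> GW"])
    fix i assume i: "i < l"
    have neg: "fsc a (- \<gamma>) = fsc (- a) \<gamma>" for a :: 'k and \<gamma> :: "'l \<Rightarrow> 'k"
      by (auto simp: fsc_def fun_eq_iff)
    show "\<forall>k\<ge>2. fsc (of_int k) (al i) \<notin> GW" using mult[OF i] by blast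
    show "\<forall>k\<ge>2. fsc (of_int k) (fsc 2 (al i)) \<notin> GW" "\<forall>k\<ge>2. fsc (of_int k) (- al i) \<notin> GW"
      "\<forall>k\<ge>2. fsc (of_int k) (- fsc 2 (al i)) \<notin> GW"
      using mult[OF i, of "k * 2" for k] mult[OF i, of "- k" for k] mult[OF i, of "- (k * 2)" for k]
      unfolding neg by simp_all
  next
    fix i \<beta> assume i: "i < l" and \<beta>: "\<beta> \<in> D - {0}" and r: "\<forall>k\<ge>2. fsc (of_int k) (refl (al i) \<beta>) \<notin> GW"
    then show "\<forall>k\<ge>2. fsc (of_int k) \<beta> \<notin> GW"
      using GW_refl[OF _ i] refl_fsc[of \<beta> "al i"] D_Hs by (metis DiffD1)
  qed
  then show ?thesis using k by blast
qed

text \<open>A nonzero element of \<open>D\<close> is a weight of \<open>gd\<close> or twice one,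
  while a nonzero weight is never twice an element of \<open>D\<close>.\<close>

lemma Rred_iff: "\<mu> \<in> Rred D \<longleftrightarrow> \<mu> = 0 \<or> (\<mu> \<noteq> 0 \<and> \<mu> \<in> GW)"
proof (cases "\<mu> = 0")
  case True
  then show ?thesis by (simp add: Rred_def)
next
  case nz: False
  define \<nu> where "\<nu> = (\<lambda>h. \<mu> h / 2)"
  have \<mu>\<nu>: "\<mu> = fsc 2 \<nu>" by (auto simp: \<nu>_def fsc_def fun_eq_iff)
  have \<nu>0: "\<nu> \<noteq> 0" using nz \<mu>\<nu> by auto
  have uniq: "\<rho> = \<nu>" if "\<mu> = fsc 2 \<rho>" for \<rho>
    using that by (auto simp: \<nu>_def fsc_def fun_eq_iff)
  have "\<mu> \<in> Rred D \<longleftrightarrow> \<mu> \<in> D \<and> \<nu> \<notin> D" using nz by (auto simp: Rred_def \<nu>_def)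
  also have "\<dots> \<longleftrightarrow> \<mu> \<in> GW"
  proof
    assume "\<mu> \<in> D \<and> \<nu> \<notin> D"
    then show "\<mu> \<in> GW" using D0_GW[of \<mu>] nz uniq GW_D by blast
  next
    assume G: "\<mu> \<in> GW"
    have "\<nu> \<notin> D"
    proof
      assume "\<nu> \<in> D"
      then have \<nu>D: "\<nu> \<in> D - {0}" using \<nu>0 by simp
      then show False using GW_no_multiple[of \<nu> 2] G \<mu>\<nu> by simp
    qed
    then show "\<mu> \<in> D \<and> \<nu> \<notin> D" using GW_D[OF G] by blast
  qed
  finally show ?thesis using nz by blast
qed

text \<open>The detour through \<open>gd\<close> produces actual roots: its weights are roots of the
  ambient algebra.\<close>

lemma D_red_cases: "\<mu> \<in> D - {0} \<Longrightarrow> \<mu> \<in> R \<or> (\<exists>\<nu>\<in>RX. dot \<nu> = \<nu> \<and> \<mu> = fsc 2 \<nu>)"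
proof -
  assume \<mu>: "\<mu> \<in> D - {0}"
  consider "\<mu> \<in> GW" | \<nu> where "\<nu> \<in> GW" "\<mu> = fsc 2 \<nu>" using D0_GW[OF \<mu>] by blast
  then show ?thesis
  proof cases
    case 1 then show ?thesis using GW_R by blast
  next
    case 2
    then have R: "\<nu> \<in> R" and d: "dot \<nu> = \<nu>" using GW_R GW_D D_Z Z_in_R by auto
    have "\<nu> \<noteq> 0" using \<mu> 2 by auto
    then have "\<nu> \<in> RX" using dot_eq_0[OF R] d R by (auto simp: RX_iff R0_iff)
    then show ?thesis using 2 d by blast
  qed
qed

text \<open>The reflection map embeds a weight space of \<open>gd\<close> into the reflected one,
  which is at most a line by the descent hypothesis.\<close>

lemma gd_one_dim:
  assumes "\<beta> \<in> D - {0}"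
  shows "\<exists>y\<in>gd. gd \<inter> L \<beta> \<subseteq> span {y}"
proof (rule descent[OF assms, of "\<lambda>\<beta>. \<exists>y\<in>gd. gd \<inter> L \<beta> \<subseteq> span {y}"])
  fix i assume i: "i < l"
  show "\<exists>y\<in>gd. gd \<inter> L (al i) \<subseteq> span {y}"
    using gd_L_mult[of _ 1 i] i ep_gd[OF i] span_zero by (intro bexI[of _ "ep i"]) auto
  show "\<exists>y\<in>gd. gd \<inter> L (- al i) \<subseteq> span {y}"
    using gd_L_mult[of _ "- 1" i] i em_gd[OF i] span_zero by (intro bexI[of _ "em i"]) auto
  show "\<exists>y\<in>gd. gd \<inter> L (fsc 2 (al i)) \<subseteq> span {y}"
    using gd_L_mult[of _ 2 i] i subspace_0[OF gd_subspace] span_zero by (intro bexI[of _ 0]) auto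
  show "\<exists>y\<in>gd. gd \<inter> L (- fsc 2 (al i)) \<subseteq> span {y}"
    using gd_L_mult[of _ "- 2" i] i subspace_0[OF gd_subspace] span_zero by (intro bexI[of _ 0]) auto
next
  fix i \<beta> assume i: "i < l" and \<beta>: "\<beta> \<in> D - {0}"
    and "\<exists>y\<in>gd. gd \<inter> L (refl (al i) \<beta>) \<subseteq> span {y}"
  then obtain y where y: "gd \<inter> L (refl (al i) \<beta>) \<subseteq> span {y}" by blast
  obtain k where k: "cart \<beta> (al i) = of_int k" using D0_cart_int[OF \<beta> i] by blast
  have bH: "\<beta> \<in> Hs" using \<beta> D_Hs by blast
  obtain T where "weight_map gd T \<beta> (refl (al i) \<beta>)"
    using simple_reflection_weight_map[OF i bH k] by blast
  note T = weight_mapD[OF this]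
  have Ty: "\<exists>c. T v = sc c y" if "v \<in> gd \<inter> L \<beta>" for v
  proof -
    have "T v \<in> gd" using T(3)[of gd v] gd_br that by blast
    then have "T v \<in> span {y}" using y T(4) that by blast
    then show ?thesis by (auto simp: span_singleton)
  qed
  show "\<exists>y\<in>gd. gd \<inter> L \<beta> \<subseteq> span {y}"
  proof (cases "gd \<inter> L \<beta> \<subseteq> {0}")
    case True
    then show ?thesis using subspace_0[OF gd_subspace] span_zero by blast
  next
    case False
    then obtain v where v: "v \<in> gd" "v \<in> L \<beta>" "v \<noteq> 0" by blast
    obtain c where c: "T v = sc c y" using Ty v by blast
    then have c0: "c \<noteq> 0" using T(5)[OF v(2)] v(3) by auto
    have "u \<in> span {v}" if u: "u \<in> gd \<inter> L \<beta>" for u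
    proof -
      obtain d where d: "T u = sc d y" using Ty u by blast
      have "T (u + sc (- (d / c)) v) = 0"
        unfolding T(1,2) c d using c0 by simp
      moreover have "u + sc (- (d / c)) v \<in> L \<beta>"
        using u v by (intro subspace_add subspace_scale L_subspace) auto
      ultimately have "u + sc (- (d / c)) v = 0" using T(5) by blast
      then have "u = sc (d / c) v" by simp
      then show ?thesis by (auto simp: span_singleton)
    qed
    then show ?thesis using v(1) by blast
  qed
qed

section \<open>Finite dimension and split simplicity\<close>

lemma gd_fin_dim: "\<exists>S. finite S \<and> span S = gd"
proof -
  have "\<forall>\<beta>. \<exists>y. \<beta> \<in> D - {0} \<longrightarrow> y \<in> gd \<and> gd \<inter> L \<beta> \<subseteq> span {y}" using gd_one_dim by blast
  then obtain y where y: "\<And>\<beta>. \<beta> \<in> D - {0} \<Longrightarrow> y \<beta> \<in> gd \<and> gd \<inter> L \<beta> \<subseteq> span {y \<beta>}" by metis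
  let ?S = "y ` (D - {0}) \<union> G0"
  have "finite G0" unfolding G0_def by simp
  then have "finite ?S" using D_finite by simp
  moreover have "span ?S = gd"
  proof
    show "span ?S \<subseteq> gd"
      by (rule span_minimal) (use y hc_gd gd_subspace in \<open>auto simp: G0_def\<close>)
    show "gd \<subseteq> span ?S"
    proof
      fix x assume x: "x \<in> gd"
      have "pr \<beta> x \<in> span ?S" if \<beta>: "\<beta> \<in> supp x" for \<beta>
      proof (cases "\<beta> = 0")
        case True
        then have "pr \<beta> x \<in> span G0" using gd_L0[OF gd_pr[OF x], of 0] pr_L[of 0] Hd_eq by auto
        then show ?thesis using span_mono[of G0 ?S] by blast
      next
        case False
        then have D: "\<beta> \<in> D - {0}" using gd_supp[OF x \<beta>] by simp
        then have "pr \<beta> x \<in> span {y \<beta>}" using y gd_pr[OF x] pr_L by blast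
        moreover have "span {y \<beta>} \<subseteq> span ?S" using D by (intro span_mono) auto
        ultimately show ?thesis by blast
      qed
      then have "(\<Sum>\<beta>\<in>supp x. pr \<beta> x) \<in> span ?S" by (intro span_sum)
      then show "x \<in> span ?S" unfolding sum_pr .
    qed
  qed
  ultimately show ?thesis by blast
qed

lemma wsp_gd:
  assumes \<mu>: "\<mu> \<in> range Z"
  shows "wsp sc br Hd gd \<mu> = gd \<inter> L \<mu>"
proof
  show "gd \<inter> L \<mu> \<subseteq> wsp sc br Hd gd \<mu>" using Hd_H by (auto simp: wsp_def)
  show "wsp sc br Hd gd \<mu> \<subseteq> gd \<inter> L \<mu>"
  proof
    fix x assume "x \<in> wsp sc br Hd gd \<mu>"
    then have x: "x \<in> gd" and w: "\<And>h. h \<in> Hd \<Longrightarrow> br h x = sc (\<mu> h) x" by (auto simp: wsp_def)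
    have "\<beta> = \<mu>" if \<beta>: "\<beta> \<in> supp x" for \<beta>
    proof (rule Hd_separates[OF D_Z[OF gd_supp[OF x \<beta>]] \<mu>])
      fix h assume h: "h \<in> Hd"
      have "sc (\<beta> h) (pr \<beta> x) = sc (\<mu> h) (pr \<beta> x)"
        using pr_br_H[of h \<beta> x] w[OF h] h Hd_H by (auto simp: pr_scale)
      then show "\<beta> h = \<mu> h" using \<beta> by simp
    qed
    then have "(\<Sum>\<beta>\<in>supp x. pr \<beta> x) \<in> L \<mu>"
      using pr_L by (intro subspace_sum L_subspace) blast
    then show "x \<in> gd \<inter> L \<mu>" using x sum_pr by simp
  qed
qed

text \<open>A nonzero ideal contains a weight vector. From weight 0, nondegeneracy on
  \<open>Hd\<close> leads to a simple root vector; any other weight is carried to a simple root by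
  the reflection maps, which preserve ideals. Either way a coroot enters the ideal, and
  irreducibility of the base spreads it over all simple roots.\<close>

lemma gd_ideal:
  assumes M: "subspace M" "M \<subseteq> gd" and ideal: "\<And>x y. x \<in> gd \<Longrightarrow> y \<in> M \<Longrightarrow> br x y \<in> M" and nz: "M \<noteq> {0}"
  shows "M = gd"
proof -
  have sc_M: "x \<in> M" if "sc c x \<in> M" "c \<noteq> 0" for c x
    using subspace_scale[OF M(1) that(1), of "inverse c"] that(2) by simp
  have ideal': "br y x \<in> M" if "x \<in> gd" "y \<in> M" for x y
    using ideal[OF that] br_anti[of y x] subspace_neg[OF M(1)] by simp
  obtain x where x: "x \<in> M" "x \<noteq> 0" using nz subspace_0[OF M(1)] by blast
  have comp: "\<forall>\<beta>\<in>supp x. pr \<beta> x \<in> M"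
  proof (rule components_in_stable_subspace[OF M(1)])
    show "\<And>h x. h \<in> Hd \<Longrightarrow> x \<in> M \<Longrightarrow> br h x \<in> M" using ideal Hd_gd by blast
    show "\<And>\<mu> \<nu>. \<mu> \<in> supp x \<Longrightarrow> \<nu> \<in> supp x \<Longrightarrow> (\<And>h. h \<in> Hd \<Longrightarrow> \<mu> h = \<nu> h) \<Longrightarrow> \<mu> = \<nu>"
      by (rule Hd_separates) (use D_Z gd_supp x M(2) in blast)+
    show "\<And>\<mu>. \<mu> \<in> supp x \<Longrightarrow> pr \<mu> x \<in> wsp sc br Hd UNIV \<mu>"
      using LD[OF pr_L] Hd_H by (auto simp: wsp_def)
  qed (use supp_fin sum_pr x in auto)
  obtain \<beta> where \<beta>: "\<beta> \<in> supp x" using sum_pr[of x] x(2) by (metis (no_types, lifting) sum.neutral)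
  have h_of_e: "hc (al i) \<in> M" if "i < l" "ep i \<in> M" for i
    using ideal'[OF em_gd[OF that(1)] that(2)] ep_em[OF that(1)] by simp
  have h_of_f: "hc (al i) \<in> M" if "i < l" "em i \<in> M" for i
    using ideal[OF ep_gd[OF that(1)] that(2)] ep_em[OF that(1)] by simp
  have bh: "br h (ep i) = sc (al i h) (ep i)" "br h (em i) = sc (- al i h) (em i)" if "i < l" "h \<in> H" for i h
    using LD[OF ep_L[OF that(1)] that(2)] LD[OF em_L[OF that(1)] that(2)] by simp_all
  have hex: "\<exists>i<l. hc (al i) \<in> M"
  proof (cases "\<beta> = 0")
    case True
    let ?h = "pr \<beta> x"
    have h: "?h \<in> Hd" using gd_L0[of ?h] gd_pr x M(2) pr_L[of \<beta>] True by auto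
    have "?h \<noteq> 0" using \<beta> by simp
    then obtain i where i: "i < l" "al i ?h \<noteq> 0" using Hd_nondeg[OF h] by blast
    have "br ?h (ep i) \<in> M" using ideal'[OF ep_gd[OF i(1)]] comp \<beta> by blast
    then have "ep i \<in> M" using sc_M[of "al i ?h" "ep i"] bh(1)[OF i(1), of ?h] h Hd_H i(2) by auto
    then show ?thesis using h_of_e i(1) by blast
  next
    case False
    then have D0: "\<beta> \<in> D - {0}" using gd_supp[of x \<beta>] \<beta> x M(2) by blast
    have base: "hc (al i) \<in> M" if i: "i < l" and k: "k = 1 \<or> k = - 1" and z: "z \<in> M" "z \<in> L (fsc (of_int k) (al i))" "z \<noteq> 0" for i k z
    proof -
      have zg: "z \<in> gd" using z(1) M(2) by blast
      from gd_L_mult[OF zg z(2) i] k z(3)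
      consider "z \<in> span {ep i}" | "z \<in> span {em i}" by auto
      then show ?thesis
      proof cases
        case 1
        then obtain c where "z = sc c (ep i)" by (auto simp: span_singleton)
        then show ?thesis using sc_M[of c "ep i"] z h_of_e[OF i] by auto
      next
        case 2
        then obtain c where "z = sc c (em i)" by (auto simp: span_singleton)
        then show ?thesis using sc_M[of c "em i"] z h_of_f[OF i] by auto
      qed
    qed
    \<comment> \<open>Doubles of simple roots are not weights of \<open>gd\<close>, so these base
      cases of the descent are vacuous.\<close>
    have no2: "z = 0" if i: "i < l" and k: "k = 2 \<or> k = - 2" and z: "z \<in> M" "z \<in> L (fsc (of_int k) (al i))" for i k z
      using gd_L_mult[OF _ z(2) i] k z(1) M(2) by auto
    have "(\<exists>z\<in>M \<inter> L \<beta>. z \<noteq> 0) \<longrightarrow> (\<exists>i<l. hc (al i) \<in> M)"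
    proof (rule descent[OF D0, of "\<lambda>\<beta>. (\<exists>z\<in>M \<inter> L \<beta>. z \<noteq> 0) \<longrightarrow> (\<exists>i<l. hc (al i) \<in> M)"])
      fix i assume i: "i < l"
      show "(\<exists>z\<in>M \<inter> L (al i). z \<noteq> 0) \<longrightarrow> (\<exists>i<l. hc (al i) \<in> M)"
        using base[OF i, of 1] i by auto
      show "(\<exists>z\<in>M \<inter> L (- al i). z \<noteq> 0) \<longrightarrow> (\<exists>i<l. hc (al i) \<in> M)"
        using base[OF i, of "- 1"] i by auto
      show "(\<exists>z\<in>M \<inter> L (fsc 2 (al i)). z \<noteq> 0) \<longrightarrow> (\<exists>i<l. hc (al i) \<in> M)"
        using no2[OF i, of 2] by auto
      show "(\<exists>z\<in>M \<inter> L (- fsc 2 (al i)). z \<noteq> 0) \<longrightarrow> (\<exists>i<l. hc (al i) \<in> M)"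
        using no2[OF i, of "- 2"] by auto
    next
      fix i \<beta> assume i: "i < l" and \<beta>: "\<beta> \<in> D - {0}"
        and r: "(\<exists>z\<in>M \<inter> L (refl (al i) \<beta>). z \<noteq> 0) \<longrightarrow> (\<exists>i<l. hc (al i) \<in> M)"
      obtain k where k: "cart \<beta> (al i) = of_int k" using D0_cart_int[OF \<beta> i] by blast
      have bH: "\<beta> \<in> Hs" using \<beta> D_Hs by blast
      obtain T where "weight_map gd T \<beta> (refl (al i) \<beta>)"
        using simple_reflection_weight_map[OF i bH k] by blast
      note T = weight_mapD[OF this]
      show "(\<exists>z\<in>M \<inter> L \<beta>. z \<noteq> 0) \<longrightarrow> (\<exists>i<l. hc (al i) \<in> M)"
      proof
        assume "\<exists>z\<in>M \<inter> L \<beta>. z \<noteq> 0"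
        then obtain z where z: "z \<in> M" "z \<in> L \<beta>" "z \<noteq> 0" by blast
        have "T z \<in> M" using T(3)[OF ideal z(1)] .
        then show "\<exists>i<l. hc (al i) \<in> M" using r T(4,5) z by blast
      qed
    qed
    then show ?thesis using comp \<beta> pr_L by blast
  qed
  \<comment> \<open>A coroot that pairs nontrivially with \<open>al j\<close> multiplies
    \<open>ep j\<close> and \<open>em j\<close> by nonzero scalars.\<close>
  have e_f: "ep j \<in> M \<and> em j \<in> M" if "i < l" "hc (al i) \<in> M" "j < l" "ip (al j) (al i) \<noteq> 0" for i j
  proof -
    have c: "al j (hc (al i)) \<noteq> 0"
      using that al_RX[of i] by (simp add: apply_hc al_Hs cart_def RX_iff)
    have h: "hc (al i) \<in> H" using hc_H al_Hs that by blast
    have "br (hc (al i)) (ep j) \<in> M" "br (hc (al i)) (em j) \<in> M"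
      using ideal' ep_gd em_gd that by blast+
    then show ?thesis
      using sc_M[OF _ c, of "ep j"] sc_M[of "- al j (hc (al i))" "em j"] c bh[OF that(3) h] by simp
  qed
  let ?I = "{i. i < l \<and> hc (al i) \<in> M}"
  have "?I = {..<l}"
  proof (rule base_irreducible)
    show "ip (al i) (al j) = 0" if i: "i \<in> ?I" and j: "j < l" "j \<notin> ?I" for i j
    proof (rule ccontr)
      assume "ip (al i) (al j) \<noteq> 0"
      then have "ip (al j) (al i) \<noteq> 0" using ip_sym by metis
      then have "ep j \<in> M" using e_f i j by blast
      then show False using h_of_e j by blast
    qed
  qed (use hex in auto)
  then have "hc (al i) \<in> M" if "i < l" for i using that by blast
  then have "ep i \<in> M \<and> em i \<in> M" if "i < l" for i
    using e_f[of i i] that al_RX[OF that] RX_iff by blast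
  then have "gd \<subseteq> M"
    unfolding gdot_def
    by (intro gen_subalg_least) (use M ideal in \<open>auto simp: lsubalg_def\<close>)
  then show ?thesis using M(2) by blast
qed

lemma gd_split_simple: "split_simple_pair sc br gd Hd (Rred D)"
  unfolding split_simple_pair_def
proof (intro conjI)
  show "lsubalg sc br gd" by (rule gd_lsubalg)
  show "\<exists>S. finite S \<and> span S = gd" by (rule gd_fin_dim)
  show "\<exists>x\<in>gd. \<exists>y\<in>gd. br x y \<noteq> 0"
    using ep_gd[OF l_pos] em_gd[OF l_pos] ep_em[OF l_pos] hc_al_nz[OF l_pos] by metis
  show "\<forall>I. subspace I \<and> I \<subseteq> gd \<and> (\<forall>x\<in>gd. \<forall>y\<in>I. br x y \<in> I) \<longrightarrow> I = {0} \<or> I = gd"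
    using gd_ideal by blast
  have ab: "br x y = 0" if "x \<in> Hd" "y \<in> Hd" for x y
    using H_abelian Hd_H that by blast
  then show "lsubalg sc br Hd"
    unfolding lsubalg_def using Hd_subspace subspace_0 by auto
  show "Hd \<subseteq> gd" by (rule Hd_gd)
  have "lcs sc br Hd 1 = {0}"
  proof -
    have "{br x y | x y. x \<in> Hd \<and> y \<in> Hd} = {0}"
      using ab subspace_0[OF Hd_subspace] by (auto intro!: exI[of _ 0])
    then show ?thesis by simp
  qed
  then show "\<exists>n. lcs sc br Hd n = {0}" by blast
  show "{x \<in> gd. \<forall>y\<in>Hd. br x y \<in> Hd} = Hd"
  proof
    show "Hd \<subseteq> {x \<in> gd. \<forall>y\<in>Hd. br x y \<in> Hd}"
      using Hd_gd ab subspace_0[OF Hd_subspace] by auto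
    show "{x \<in> gd. \<forall>y\<in>Hd. br x y \<in> Hd} \<subseteq> Hd"
    proof
      fix x assume "x \<in> {x \<in> gd. \<forall>y\<in>Hd. br x y \<in> Hd}"
      then have x: "x \<in> gd" and n: "\<And>y. y \<in> Hd \<Longrightarrow> br x y \<in> Hd" by auto
      \<comment> \<open>A component of nonzero weight would survive the bracket with some h in
        \<open>Hd\<close>, but that bracket lies in \<open>Hd\<close> and so has weight 0.\<close>
      have "\<beta> = 0" if \<beta>: "\<beta> \<in> supp x" for \<beta>
      proof (rule ccontr)
        assume b0: "\<beta> \<noteq> 0"
        have zZ: "0 \<in> range Z" using Z_zero by (metis rangeI)
        obtain h where h: "h \<in> Hd" "\<beta> h \<noteq> 0"
          using Hd_separates[OF D_Z[OF gd_supp[OF x \<beta>]] zZ] b0 by auto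
        have hH: "h \<in> H" using h Hd_H by blast
        have "br h x \<in> Hd" using n[OF h(1)] br_anti[of h x] subspace_neg[OF Hd_subspace] by simp
        then have "pr \<beta> (br h x) = 0" using pr_hom[of "br h x" 0 \<beta>] H_L0 Hd_H b0 by auto
        then show False using pr_br_H[OF hH, of \<beta> x] h(2) \<beta> by simp
      qed
      then have "(\<Sum>\<beta>\<in>supp x. pr \<beta> x) \<in> L 0"
        using pr_L by (intro subspace_sum L_subspace) blast
      then show "x \<in> Hd" using gd_L0[OF x] sum_pr by simp
    qed
  qed
  have RredZ: "\<mu> \<in> range Z" if "\<mu> \<in> Rred D" for \<mu>
    using that Rred_iff[of \<mu>] GW_D[of \<mu>] D_Z[of \<mu>] zero_D by auto
  show "is_dsum (wsp sc br Hd gd) (Rred D) gd"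
  proof (rule Hd_dsum[OF gd_subspace])
    fix v \<alpha> assume v: "v \<in> gd" and \<alpha>: "\<alpha> \<in> supp v"
    have "\<alpha> \<in> GW" using gd_pr[OF v] pr_L \<alpha> supp_Hs[OF \<alpha>] unfolding GW_def by blast
    moreover have "dot \<alpha> = \<alpha>" by (rule Z_in_R[OF D_Z[OF gd_supp[OF v \<alpha>]] supp_R[OF \<alpha>]])
    ultimately show "dot \<alpha> \<in> Rred D \<and> pr \<alpha> v \<in> gd" using Rred_iff gd_pr[OF v] by simp
  qed (use RredZ in blast)
  show "\<forall>\<mu>\<in>Rred D. \<mu> \<noteq> 0 \<longrightarrow> wsp sc br Hd gd \<mu> \<noteq> {0}"
  proof (intro ballI impI)
    fix \<mu> assume \<mu>: "\<mu> \<in> Rred D" "\<mu> \<noteq> 0"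
    then have "\<mu> \<in> GW" using Rred_iff by blast
    then show "wsp sc br Hd gd \<mu> \<noteq> {0}" unfolding wsp_gd[OF RredZ[OF \<mu>(1)]] GW_def by auto
  qed
qed

end

subsection \<open>Integral spans\<close>

lemma zspan_base: "s \<in> S \<Longrightarrow> s \<in> zspan S"
  unfolding zspan_def by (auto intro!: exI[of _ "{s}"] exI[of _ "\<lambda>_. 1"])

lemma zspan_zero: "0 \<in> zspan S"
  unfolding zspan_def by (auto simp: fun_eq_iff intro!: exI[of _ "{}"])

lemma zspan_uminus: "v \<in> zspan S \<Longrightarrow> - v \<in> zspan S"
proof -
  assume "v \<in> zspan S"
  then obtain T c where T: "finite T" "T \<subseteq> S" "v = (\<lambda>h. \<Sum>s\<in>T. of_int (c s) * s h)"
    unfolding zspan_def by blast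
  then have "- v = (\<lambda>h. \<Sum>s\<in>T. of_int (- c s) * s h)" by (auto simp: fun_eq_iff sum_negf)
  then show ?thesis unfolding zspan_def using T by (intro CollectI exI[of _ T] exI[of _ "\<lambda>s. - c s"]) simp
qed

lemma zspan_add: "v \<in> zspan S \<Longrightarrow> w \<in> zspan S \<Longrightarrow> v + w \<in> zspan S"
proof -
  assume "v \<in> zspan S" "w \<in> zspan S"
  then obtain T c U d where T: "finite T" "T \<subseteq> S" "v = (\<lambda>h. \<Sum>s\<in>T. of_int (c s) * s h)"
    and U: "finite U" "U \<subseteq> S" "w = (\<lambda>h. \<Sum>s\<in>U. of_int (d s) * s h)"
    unfolding zspan_def by blast
  let ?e = "\<lambda>s. (if s \<in> T then c s else 0) + (if s \<in> U then d s else 0)"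
  have "(v + w) h = (\<Sum>s\<in>T \<union> U. of_int (?e s) * s h)" for h
  proof -
    have "(\<Sum>s\<in>T \<union> U. of_int (?e s) * s h)
        = (\<Sum>s\<in>T \<union> U. if s \<in> T then of_int (c s) * s h else 0) + (\<Sum>s\<in>T \<union> U. if s \<in> U then of_int (d s) * s h else 0)"
      unfolding sum.distrib[symmetric] by (intro sum.cong) (auto simp: distrib_right)
    also have "(\<Sum>s\<in>T \<union> U. if s \<in> T then of_int (c s) * s h else 0) = (\<Sum>s\<in>T. of_int (c s) * s h)"
      using T(1) U(1) by (intro sum.mono_neutral_cong_right) auto
    also have "(\<Sum>s\<in>T \<union> U. if s \<in> U then of_int (d s) * s h else 0) = (\<Sum>s\<in>U. of_int (d s) * s h)"
      using T(1) U(1) by (intro sum.mono_neutral_cong_right) auto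
    finally show ?thesis using T(3) U(3) by simp
  qed
  then have "v + w = (\<lambda>h. \<Sum>s\<in>T \<union> U. of_int (?e s) * s h)" by (rule ext)
  then show ?thesis
    unfolding zspan_def using T U by (intro CollectI exI[of _ "T \<union> U"] exI[of _ ?e]) simp
qed

lemma zspan_minimal:
  fixes S M :: "('l \<Rightarrow> 'k::ring_1) set"
  assumes "S \<subseteq> M" "0 \<in> M" "\<And>v w. v \<in> M \<Longrightarrow> w \<in> M \<Longrightarrow> v + w \<in> M" "\<And>v. v \<in> M \<Longrightarrow> - v \<in> M"
  shows "zspan S \<subseteq> M"
proof
  fix v assume "v \<in> zspan S"
  then obtain T c where T: "finite T" "T \<subseteq> S" "v = (\<lambda>h. \<Sum>s\<in>T. of_int (c s) * s h)"
    unfolding zspan_def by blast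
  have int: "(\<lambda>h. of_int k * s h) \<in> M" if s: "s \<in> M" for k and s :: "'l \<Rightarrow> 'k"
  proof (induction k rule: int_induct[of _ 0])
    case base
    then show ?case using assms(2) by (simp add: zero_fun_def)
  next
    case (step1 k)
    have "(\<lambda>h. of_int (k + 1) * s h) = (\<lambda>h. of_int k * s h) + s"
      by (auto simp: fun_eq_iff distrib_right)
    then show ?case using assms(3)[OF step1.IH s] by metis
  next
    case (step2 k)
    have "(\<lambda>h. of_int (k - 1) * s h) = (\<lambda>h. of_int k * s h) + - s"
      by (auto simp: fun_eq_iff left_diff_distrib)
    then show ?case using assms(3)[OF step2.IH assms(4)[OF s]] by metis
  qed
  have "(\<lambda>h. \<Sum>s\<in>T. of_int (c s) * s h) \<in> M"
    using T(1,2)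
  proof (induction T rule: finite_induct)
    case empty
    have "(\<lambda>h. \<Sum>s\<in>{}. of_int (c s) * s h) = (0 :: 'l \<Rightarrow> 'k)" by auto
    then show ?case using assms(2) by metis
  next
    case (insert s T)
    have "(\<lambda>h. \<Sum>s\<in>insert s T. of_int (c s) * s h) = (\<lambda>h. of_int (c s) * s h) + (\<lambda>h. \<Sum>s\<in>T. of_int (c s) * s h)"
      using insert.hyps by (auto simp: fun_eq_iff)
    then show ?case
      using assms(3)[OF int[of s "c s"] insert.IH] insert.prems assms(1) by (metis insert_subset subsetD)
  qed
  then show "v \<in> M" using T(3) by simp
qed

subsection \<open>The gradings of the core\<close>

context based_toral_lie
begin

abbreviation "Lc \<equiv> lcore sc br B H"
abbreviation "Lam \<equiv> lLam sc br B H"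
abbreviation "Ls \<equiv> Lsig sc br H D"
abbreviation "W \<equiv> wsp sc br Hd Lc"

section \<open>Roots modulo the lattice of isotropic roots\<close>

lemma R0_Lam: "\<delta> \<in> R0 \<Longrightarrow> \<delta> \<in> Lam"
  unfolding lLam_def by (rule zspan_base)

lemma Lam_rad_Hs: "Lam \<subseteq> rad \<inter> Hs"
  unfolding lLam_def
  by (rule zspan_minimal) (use R0_rad R0_iff R_Hs in \<open>auto simp: rad_add rad_uminus Hs_add Hs_uminus\<close>)

lemma Lam_rad: "\<sigma> \<in> Lam \<Longrightarrow> \<sigma> \<in> rad" and Lam_Hs: "\<sigma> \<in> Lam \<Longrightarrow> \<sigma> \<in> Hs"
  using Lam_rad_Hs by blast+

text \<open>The difference is itself an isotropic root. When r is nonisotropic and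
  \<open>dot r\<close> is a root, the Cartan number of r against it is 2 and one step down the
  string is allowed; when \<open>dot r = fsc 2 \<nu>\<close>, the Cartan number against
  \<open>\<nu>\<close> is 4 and two steps arrive at \<open>r - dot r\<close>.\<close>

lemma diff_dot_Lam:
  assumes r: "r \<in> R"
  shows "r - dot r \<in> Lam"
proof (cases "r \<in> R0")
  case True
  then show ?thesis using dot_eq_0[OF r] R0_Lam by simp
next
  case False
  then have rX: "r \<in> RX" using r by (simp add: RX_iff R0_iff)
  have d: "dot r \<in> D - {0}" using rX D0_iff by blast
  have "r - dot r \<in> R"
    using D_red_cases[OF d]
  proof
    assume dR: "dot r \<in> R"
    have n: "ip (dot r) (dot r) = ip r r" "ip r (dot r) = ip r r" using ip_dot[OF r r] by auto
    then have "dot r \<in> RX" using dR rX by (simp add: RX_iff)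
    then show ?thesis
      using diff_R[of "dot r" r 2] r n rX by (simp add: cart_def RX_iff)
  next
    assume "\<exists>\<nu>\<in>RX. dot \<nu> = \<nu> \<and> dot r = fsc 2 \<nu>"
    then obtain \<nu> where \<nu>: "\<nu> \<in> RX" "dot r = fsc 2 \<nu>" by blast
    have "ip r \<nu> = 2 * ip \<nu> \<nu>"
      using ip_dot(2)[OF r, of \<nu>] \<nu> RX_Hs[OF \<nu>(1)] by (simp add: RX_iff ip_fsc)
    then have "cart r \<nu> = of_nat 4" using \<nu>(1) by (simp add: cart_def RX_iff)
    then have "r - fsc (of_nat 2) \<nu> \<in> R" by (rule string_down[OF \<nu>(1) r]) simp
    then show ?thesis unfolding \<nu>(2) by simp
  qed
  moreover have "ip (r - dot r) (r - dot r) = 0"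
    using dot_rad[OF r] calculation by (simp add: rad_iff)
  ultimately show ?thesis using R0_Lam by (simp add: R0_iff)
qed

lemma dot_add_Lam: "\<mu> \<in> range Z \<Longrightarrow> \<sigma> \<in> Lam \<Longrightarrow> \<mu> + \<sigma> \<in> R \<Longrightarrow> dot (\<mu> + \<sigma>) = \<mu>"
  by (rule dot_eqI) (auto simp: Lam_rad)

lemma Ls_iff:
  assumes \<sigma>: "\<sigma> \<in> Lam"
  shows "x \<in> Ls \<sigma> \<longleftrightarrow> (\<forall>\<alpha>\<in>supp x. \<alpha> - \<sigma> \<in> D)"
proof
  let ?S = "\<Union>\<mu>\<in>D. L (\<mu> + \<sigma>)"
  assume "x \<in> Ls \<sigma>"
  then have x: "x \<in> span ?S" unfolding Lsig_def .
  have S: "\<exists>\<gamma>\<in>Hs. s \<in> L \<gamma>" if "s \<in> ?S" for s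
    using that D_Hs Lam_Hs[OF \<sigma>] Hs_add by blast
  show "\<forall>\<alpha>\<in>supp x. \<alpha> - \<sigma> \<in> D"
  proof
    fix \<alpha> assume \<alpha>: "\<alpha> \<in> supp x"
    have "pr \<alpha> x \<in> span (?S \<inter> L \<alpha>)" using span_hom[OF S x] .
    moreover have "pr \<alpha> x \<noteq> 0" using \<alpha> by simp
    ultimately obtain t where t: "t \<in> ?S" "t \<in> L \<alpha>" "t \<noteq> 0"
      using span_minimal[of "?S \<inter> L \<alpha>" "{0}"] by (auto simp: subspace_def)
    then obtain \<mu> where \<mu>: "\<mu> \<in> D" "t \<in> L (\<mu> + \<sigma>)" by blast
    then have "\<alpha> = \<mu> + \<sigma>"
      using L_unique[OF t(2) _ supp_Hs[OF \<alpha>] _ t(3)] D_Hs Lam_Hs[OF \<sigma>] Hs_add by blast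
    then show "\<alpha> - \<sigma> \<in> D" using \<mu> by simp
  qed
next
  assume s: "\<forall>\<alpha>\<in>supp x. \<alpha> - \<sigma> \<in> D"
  have "pr \<alpha> x \<in> Ls \<sigma>" if "\<alpha> \<in> supp x" for \<alpha>
  proof -
    have "pr \<alpha> x \<in> L (\<alpha> - \<sigma> + \<sigma>)" using pr_L by simp
    then show ?thesis unfolding Lsig_def using s that by (blast intro: span_base)
  qed
  then have "(\<Sum>\<alpha>\<in>supp x. pr \<alpha> x) \<in> Ls \<sigma>"
    unfolding Lsig_def by (rule span_sum)
  then show "x \<in> Ls \<sigma>" unfolding sum_pr .
qed

section \<open>The core and its weight spaces\<close>

lemma Lc_lsubalg: "lsubalg sc br Lc"
  unfolding lcore_def by (rule gen_subalg_lsubalg)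

lemma Lc_subspace: "subspace Lc" and Lc_br: "x \<in> Lc \<Longrightarrow> y \<in> Lc \<Longrightarrow> br x y \<in> Lc"
  using Lc_lsubalg lsubalg_subspace lsubalg_br by blast+

lemma L_Lc: "\<alpha> \<in> RX \<Longrightarrow> x \<in> L \<alpha> \<Longrightarrow> x \<in> Lc"
  unfolding lcore_def by (rule gen_subalg_base) blast

lemma gd_Lc: "gd \<subseteq> Lc"
  unfolding gdot_def
  by (rule gen_subalg_least[OF Lc_lsubalg])
    (use L_Lc[OF al_RX ep_L] L_Lc[OF RX_uminus[OF al_RX] em_L] in blast)

lemma Lc_H_stable: "h \<in> H \<Longrightarrow> x \<in> Lc \<Longrightarrow> br h x \<in> Lc"
  unfolding lcore_def
proof (rule gen_subalg_stable_ad)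
  fix s assume h: "h \<in> H" and "s \<in> (\<Union>\<alpha>\<in>RX. L \<alpha>)"
  then obtain \<alpha> where \<alpha>: "\<alpha> \<in> RX" "s \<in> L \<alpha>" by blast
  have "br h s \<in> Lc"
    unfolding LD[OF \<alpha>(2) h] by (rule subspace_scale[OF Lc_subspace L_Lc[OF \<alpha>]])
  then show "br h s \<in> gen_subalg sc br (\<Union>\<alpha>\<in>RX. L \<alpha>)" unfolding lcore_def .
qed

lemma Lc_pr: "x \<in> Lc \<Longrightarrow> pr \<alpha> x \<in> Lc"
  using H_stable_pr[OF Lc_subspace Lc_H_stable] .

lemma W_iff:
  assumes \<mu>: "\<mu> \<in> range Z"
  shows "x \<in> W \<mu> \<longleftrightarrow> x \<in> Lc \<and> (\<forall>\<alpha>\<in>supp x. dot \<alpha> = \<mu>)"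
proof
  assume "x \<in> W \<mu>"
  then have x: "x \<in> Lc" and w: "\<And>h. h \<in> Hd \<Longrightarrow> br h x = sc (\<mu> h) x" by (auto simp: wsp_def)
  have "dot \<alpha> = \<mu>" if \<alpha>: "\<alpha> \<in> supp x" for \<alpha>
  proof (rule Hd_separates[OF dot_Z[OF supp_R[OF \<alpha>]] \<mu>])
    fix h assume h: "h \<in> Hd"
    have "sc (\<alpha> h) (pr \<alpha> x) = sc (\<mu> h) (pr \<alpha> x)"
      using pr_br_H[of h \<alpha> x] w[OF h] h Hd_H by (auto simp: pr_scale)
    then show "dot \<alpha> h = \<mu> h" using \<alpha> dot_restrict[OF supp_R[OF \<alpha>] h] by simp
  qed
  then show "x \<in> Lc \<and> (\<forall>\<alpha>\<in>supp x. dot \<alpha> = \<mu>)" using x by blast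
next
  assume x: "x \<in> Lc \<and> (\<forall>\<alpha>\<in>supp x. dot \<alpha> = \<mu>)"
  have "br h x = sc (\<mu> h) x" if h: "h \<in> Hd" for h
  proof -
    have "br h (\<Sum>\<alpha>\<in>supp x. pr \<alpha> x) = (\<Sum>\<alpha>\<in>supp x. sc (\<mu> h) (pr \<alpha> x))"
      unfolding br_sum_right
    proof (rule sum.cong[OF refl])
      fix \<alpha> assume \<alpha>: "\<alpha> \<in> supp x"
      have "br h (pr \<alpha> x) = sc (\<alpha> h) (pr \<alpha> x)" using LD[OF pr_L] h Hd_H by blast
      then show "br h (pr \<alpha> x) = sc (\<mu> h) (pr \<alpha> x)"
        using dot_restrict[OF supp_R[OF \<alpha>] h] x \<alpha> by simp
    qed
    then show ?thesis by (simp add: scale_sum_right[symmetric] sum_pr)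
  qed
  then show "x \<in> W \<mu>" using x by (auto simp: wsp_def)
qed

lemma L_W:
  assumes "\<alpha> \<in> R" "x \<in> L \<alpha>" "x \<in> Lc"
  shows "x \<in> W (dot \<alpha>)"
  using assms pr_hom[OF assms(2) R_Hs[OF assms(1)]] unfolding W_iff[OF dot_Z[OF assms(1)]] by auto

lemma W_br: "x \<in> W \<mu> \<Longrightarrow> y \<in> W \<nu> \<Longrightarrow> br x y \<in> W (\<mu> + \<nu>)"
  by (auto simp: wsp_def Lc_br br_br[of _ x y] br_scale_left br_scale_right scale_left_distrib)

lemma W_outside: "\<mu> \<in> range Z \<Longrightarrow> \<mu> \<notin> D \<Longrightarrow> x \<in> W \<mu> \<Longrightarrow> x = 0"
proof -
  assume \<mu>: "\<mu> \<in> range Z" "\<mu> \<notin> D" and x: "x \<in> W \<mu>"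
  have "\<alpha> \<notin> supp x" for \<alpha>
  proof
    assume \<alpha>: "\<alpha> \<in> supp x"
    then have "\<mu> = dot \<alpha>" using x W_iff[OF \<mu>(1), of x] by auto
    then show False using \<mu>(2) D_iff[of \<mu>] supp_R[OF \<alpha>] by blast
  qed
  then have "supp x = {}" by blast
  then have "(\<Sum>\<alpha>\<in>supp x. pr \<alpha> x) = 0" by (simp only: sum.empty)
  then show "x = 0" unfolding sum_pr .
qed

lemma range_Z_add: "\<mu> \<in> range Z \<Longrightarrow> \<nu> \<in> range Z \<Longrightarrow> \<mu> + \<nu> \<in> range Z"
  using Z_add[symmetric] by auto

lemma range_Z_zero: "0 \<in> range Z"
  using Z_zero by (metis rangeI)

text \<open>The span of \<open>?G\<close> and the nonzero weight spaces is a subalgebra containing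
  the generators of the core, hence the core itself. Comparing the parts of weight 0 then leaves
  only \<open>?G\<close>.\<close>

lemma W_zero_eq:
  "W 0 = span {br x y | x y \<mu>. \<mu> \<in> D - {0} \<and> x \<in> W \<mu> \<and> y \<in> W (- \<mu>)}" (is "_ = span ?G")
proof
  have G0: "?G \<subseteq> W 0"
  proof
    fix g assume "g \<in> ?G"
    then obtain x y \<mu> where "g = br x y" "x \<in> W \<mu>" "y \<in> W (- \<mu>)" by blast
    then show "g \<in> W 0" using W_br[of x \<mu> y "- \<mu>"] by simp
  qed
  have sW0: "subspace (W 0)" by (rule wsp_subspace[OF Lc_subspace])
  show GW: "span ?G \<subseteq> W 0" by (rule span_minimal[OF G0 sW0])
  let ?V = "\<Union>\<mu>\<in>D - {0}. W \<mu>"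
  let ?U = "?G \<union> ?V"
  have VV: "br s t \<in> span ?U" if s: "s \<in> ?V" and t: "t \<in> ?V" for s t
  proof -
    obtain \<mu> where \<mu>: "\<mu> \<in> D - {0}" "s \<in> W \<mu>" using s by blast
    obtain \<nu> where \<nu>: "\<nu> \<in> D - {0}" "t \<in> W \<nu>" using t by blast
    show ?thesis
    proof (cases "\<mu> + \<nu> = 0")
      case True
      then have "\<nu> = - \<mu>" by (simp add: eq_neg_iff_add_eq_0 add.commute)
      then have "br s t \<in> ?G" using \<mu> \<nu> by blast
      then show ?thesis by (blast intro: span_base)
    next
      case False
      have st: "br s t \<in> W (\<mu> + \<nu>)" using W_br \<mu> \<nu> by blast
      show ?thesis
      proof (cases "\<mu> + \<nu> \<in> D")
        case True
        then have "br s t \<in> ?V" using st False by blast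
        then show ?thesis by (blast intro: span_base)
      next
        case notD: False
        have "\<mu> + \<nu> \<in> range Z" using range_Z_add[OF D_Z D_Z, of \<mu> \<nu>] \<mu>(1) \<nu>(1) by simp
        then have "br s t = 0" by (rule W_outside[OF _ notD st])
        then show ?thesis by (simp only: span_zero)
      qed
    qed
  qed
  have GV: "br s t \<in> span ?U" if s: "s \<in> ?G" and t: "t \<in> ?V" for s t
  proof -
    obtain \<nu> where \<nu>: "\<nu> \<in> D - {0}" "t \<in> W \<nu>" using t by blast
    have "s \<in> W 0" using G0 s by (rule subsetD)
    then have "br s t \<in> W \<nu>" using W_br[of s 0 t \<nu>] \<nu> by simp
    then have "br s t \<in> ?V" using \<nu> by blast
    then show ?thesis by (blast intro: span_base)
  qed
  \<comment> \<open>An element of weight 0 acts as a derivation on the bracket of x and y and keeps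
    the weights of both factors.\<close>
  have GG: "br s t \<in> span ?U" if s: "s \<in> ?G" and t: "t \<in> ?G" for s t
  proof -
    obtain x y \<mu> where t': "t = br x y" "\<mu> \<in> D - {0}" "x \<in> W \<mu>" "y \<in> W (- \<mu>)" using t by blast
    have s0: "s \<in> W 0" using G0 s by (rule subsetD)
    have "br s x \<in> W \<mu>" "br s y \<in> W (- \<mu>)" using W_br[OF s0] t' by fastforce+
    then have "br (br s x) y \<in> ?G" "br x (br s y) \<in> ?G" using t' by blast+
    then have "br (br s x) y + br x (br s y) \<in> span ?U" by (intro span_add span_base) blast+
    then show ?thesis unfolding t'(1) br_br[of s x y] .
  qed
  have VG: "br s t \<in> span ?U" if "s \<in> ?V" "t \<in> ?G" for s t
    by (subst br_anti) (rule span_neg[OF GV[OF that(2,1)]])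
  have UU: "br s t \<in> span ?U" if s: "s \<in> ?U" and t: "t \<in> ?U" for s t
    using s
  proof
    assume "s \<in> ?G"
    from t show ?thesis by (rule UnE) (rule GG[OF \<open>s \<in> ?G\<close>] GV[OF \<open>s \<in> ?G\<close>], assumption)+
  next
    assume "s \<in> ?V"
    from t show ?thesis by (rule UnE) (rule VG[OF \<open>s \<in> ?V\<close>] VV[OF \<open>s \<in> ?V\<close>], assumption)+
  qed
  have "lsubalg sc br (span ?U)"
    unfolding lsubalg_def by (intro conjI ballI subspace_span) (rule span_span_br[OF UU])
  moreover have "L \<alpha> \<subseteq> span ?U" if \<alpha>: "\<alpha> \<in> RX" for \<alpha>
  proof
    fix x assume x: "x \<in> L \<alpha>"
    have "dot \<alpha> \<in> D - {0}" using D0_iff \<alpha> by blast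
    moreover have "x \<in> W (dot \<alpha>)" using L_W[OF _ x L_Lc[OF \<alpha> x]] \<alpha> RX_iff by blast
    ultimately have "x \<in> ?V" by blast
    then show "x \<in> span ?U" by (blast intro: span_base)
  qed
  ultimately have LcU: "Lc \<subseteq> span ?U"
    unfolding lcore_def by (intro gen_subalg_least) auto
  show "W 0 \<subseteq> span ?G"
  proof
    fix x assume x: "x \<in> W 0"
    then have "x \<in> span ?U" using LcU by (auto simp: wsp_def)
    then obtain a b where ab: "a \<in> span ?G" "b \<in> span ?V" "x = a + b"
      unfolding span_Un by blast
    have "a \<in> W 0" using GW ab(1) by (rule subsetD)
    then have b0: "b \<in> W 0" using subspace_diff[OF sW0 x, of a] ab(3) by simp
    \<comment> \<open>b has weight 0 but is a combination of vectors of nonzero weight, so all its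
      components vanish.\<close>
    have "subspace {b. \<forall>\<alpha>. \<alpha> \<in> R \<and> dot \<alpha> = 0 \<longrightarrow> pr \<alpha> b = 0}"
      by (auto simp: subspace_def pr_add pr_scale)
    moreover have "?V \<subseteq> {b. \<forall>\<alpha>. \<alpha> \<in> R \<and> dot \<alpha> = 0 \<longrightarrow> pr \<alpha> b = 0}"
      using W_iff D_Z by fastforce
    ultimately have "pr \<alpha> b = 0" if "\<alpha> \<in> R" "dot \<alpha> = 0" for \<alpha>
      using span_minimal[of ?V] ab(2) that by blast
    then have "supp b = {}" using b0 supp_R unfolding W_iff[OF range_Z_zero] by blast
    then have "(\<Sum>\<alpha>\<in>supp b. pr \<alpha> b) = 0" by (simp only: sum.empty)
    then have "b = 0" unfolding sum_pr .
    then show "x \<in> span ?G" using ab by simp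
  qed
qed

lemma core_root_graded: "root_graded sc br Lc gd Hd D"
  unfolding root_graded_def
proof (intro conjI)
  show "is_dsum W D Lc"
    by (rule Hd_dsum[OF Lc_subspace]) (use D_Z D_iff supp_R Lc_pr in blast)+
qed (fact Lc_lsubalg gd_split_simple gd_Lc W_zero_eq)+

lemma core_group_graded: "group_graded sc br Lc gd (\<lambda>\<sigma>. Lc \<inter> Ls \<sigma>) Lam"
  unfolding group_graded_def
proof (intro conjI ballI)
  show sub: "subspace (Lc \<inter> Ls \<sigma>)" for \<sigma>
    unfolding Lsig_def by (intro subspace_inter Lc_subspace subspace_span)
  show "is_dsum (\<lambda>\<sigma>. Lc \<inter> Ls \<sigma>) Lam Lc"
  proof (rule is_dsum_regroup)
    fix v assume v: "v \<in> Lc"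
    \<comment> \<open>The degree of a root component is what remains of the root after its
      representative is removed; several roots may share it.\<close>
    have "\<alpha> - dot \<alpha> \<in> Lam \<and> pr \<alpha> v \<in> Lc \<inter> Ls (\<alpha> - dot \<alpha>)" if \<alpha>: "\<alpha> \<in> supp v" for \<alpha>
    proof -
      have R: "\<alpha> \<in> R" by (rule supp_R[OF \<alpha>])
      have "\<beta> = \<alpha>" if "\<beta> \<in> supp (pr \<alpha> v)" for \<beta>
        using pr_hom[OF pr_L R_Hs[OF R], of \<beta> v] that by (auto split: if_splits)
      moreover have "\<alpha> - (\<alpha> - dot \<alpha>) \<in> D" using D_iff[of "dot \<alpha>"] R by auto
      ultimately have "pr \<alpha> v \<in> Ls (\<alpha> - dot \<alpha>)"
        unfolding Ls_iff[OF diff_dot_Lam[OF R]] by blast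
      then show ?thesis using diff_dot_Lam[OF R] Lc_pr[OF v] by blast
    qed
    then show "\<exists>T (g :: ('l \<Rightarrow> 'k) \<Rightarrow> 'l) \<phi>. finite T \<and> (\<forall>t\<in>T. \<phi> t \<in> Lam \<and> g t \<in> Lc \<inter> Ls (\<phi> t)) \<and> v = sum g T"
      by (intro exI[of _ "supp v"] exI[of _ "\<lambda>\<alpha>. pr \<alpha> v"] exI[of _ "\<lambda>\<alpha>. \<alpha> - dot \<alpha>"])
        (use supp_fin sum_pr in auto)
  next
    fix S f assume S: "finite S" "S \<subseteq> Lam" and f: "\<And>i. i \<in> S \<Longrightarrow> f i \<in> Lc \<inter> Ls i" and s: "sum f S = 0"
    show "\<forall>\<sigma>\<in>S. f \<sigma> = 0"
    proof (rule ballI, rule ccontr)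
      fix \<sigma> assume \<sigma>: "\<sigma> \<in> S" and nz: "f \<sigma> \<noteq> 0"
      then obtain \<alpha> where \<alpha>: "\<alpha> \<in> supp (f \<sigma>)"
        using sum_pr[of "f \<sigma>"] by (metis (no_types, lifting) sum.neutral)
      have \<sigma>D: "\<alpha> - \<sigma> \<in> D" using f[OF \<sigma>] Ls_iff \<sigma> S(2) \<alpha> by blast
      \<comment> \<open>If \<open>\<alpha>\<close> occurred in two degrees, both
        \<open>\<alpha> - \<sigma>\<close> and \<open>\<alpha> - \<tau>\<close> would equal
        \<open>dot \<alpha>\<close>.\<close>
      have "pr \<alpha> (f \<tau>) = 0" if \<tau>: "\<tau> \<in> S - {\<sigma>}" for \<tau>
      proof (rule ccontr)
        assume "pr \<alpha> (f \<tau>) \<noteq> 0"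
        then have \<tau>D: "\<alpha> - \<tau> \<in> D" using f[of \<tau>] Ls_iff[of \<tau>] \<tau> S(2) by blast
        have d: "dot \<alpha> = \<alpha> - \<rho>" if "\<rho> \<in> S" "\<alpha> - \<rho> \<in> D" for \<rho>
          using dot_eqI[OF supp_R[OF \<alpha>] D_Z[OF that(2)]] Lam_rad that(1) S(2) by auto
        have "\<alpha> - \<sigma> = \<alpha> - \<tau>" using d[OF \<sigma> \<sigma>D] d[OF _ \<tau>D] \<tau> by simp
        then show False using \<tau> by simp
      qed
      then have "(\<Sum>\<tau>\<in>S. pr \<alpha> (f \<tau>)) = pr \<alpha> (f \<sigma>)"
        using S(1) \<sigma> by (simp add: sum.remove)
      then show False using s pr_sum[of \<alpha> f S] \<alpha> by simp
    qed
  qed (use sub in auto)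
  show "gd \<subseteq> Lc \<inter> Ls 0"
  proof -
    have "0 \<in> Lam" unfolding lLam_def by (rule zspan_zero)
    then show ?thesis using gd_Lc gd_supp Ls_iff[of 0] by auto
  qed
  fix \<sigma> \<tau> x y assume \<sigma>: "\<sigma> \<in> Lam" and \<tau>: "\<tau> \<in> Lam" and x: "x \<in> Lc \<inter> Ls \<sigma>" and y: "y \<in> Lc \<inter> Ls \<tau>"
  have st: "\<sigma> + \<tau> \<in> Lam" using \<sigma> \<tau> unfolding lLam_def by (rule zspan_add)
  have "br x y \<in> Ls (\<sigma> + \<tau>)"
    unfolding Lsig_def
  proof (rule span_span_br)
    show "x \<in> span (\<Union>\<mu>\<in>D. L (\<mu> + \<sigma>))" "y \<in> span (\<Union>\<mu>\<in>D. L (\<mu> + \<tau>))"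
      using x y unfolding Lsig_def by auto
    fix s t assume "s \<in> (\<Union>\<mu>\<in>D. L (\<mu> + \<sigma>))" "t \<in> (\<Union>\<mu>\<in>D. L (\<mu> + \<tau>))"
    then obtain \<mu> \<nu> where \<mu>: "\<mu> \<in> D" "s \<in> L (\<mu> + \<sigma>)" and \<nu>: "\<nu> \<in> D" "t \<in> L (\<nu> + \<tau>)" by blast
    have e: "\<mu> + \<sigma> + (\<nu> + \<tau>) = \<mu> + \<nu> + (\<sigma> + \<tau>)" by (simp only: ac_simps)
    have b: "br s t \<in> L (\<mu> + \<nu> + (\<sigma> + \<tau>))" using L_br[OF \<mu>(2) \<nu>(2)] unfolding e .
    have Zmn: "\<mu> + \<nu> \<in> range Z" by (rule range_Z_add[OF D_Z[OF \<mu>(1)] D_Z[OF \<nu>(1)]])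
    show "br s t \<in> span (\<Union>\<mu>\<in>D. L (\<mu> + (\<sigma> + \<tau>)))"
    proof (cases "br s t = 0")
      case False
      \<comment> \<open>A nonzero bracket exhibits a root with representative
        \<open>\<mu> + \<nu>\<close>, which puts this sum into \<open>D\<close>.\<close>
      then have R: "\<mu> + \<nu> + (\<sigma> + \<tau>) \<in> R"
        using RI[OF b] range_Z_Hs[OF Zmn] Lam_Hs[OF st] Hs_add by blast
      then have "\<mu> + \<nu> \<in> D" using dot_add_Lam[OF Zmn st R] D_iff by metis
      then show ?thesis using b by (blast intro: span_base)
    qed (simp add: span_zero)
  qed
  then show "br x y \<in> Lc \<inter> Ls (\<sigma> + \<tau>)" using Lc_br x y by blast
next
  let ?S = "{\<sigma> \<in> Lam. Lc \<inter> Ls \<sigma> \<noteq> {0}}"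
  have "zspan ?S \<subseteq> Lam"
    by (rule zspan_minimal) (auto simp: lLam_def zspan_zero zspan_add zspan_uminus)
  moreover have "zspan R0 \<subseteq> zspan ?S"
  proof (rule zspan_minimal)
    have supp: "\<alpha> - dot \<alpha> \<in> ?S" if \<alpha>: "\<alpha> \<in> RX" for \<alpha>
    proof -
      have R: "\<alpha> \<in> R" using \<alpha> RX_iff by blast
      obtain x where x: "x \<in> L \<alpha>" "x \<noteq> 0" using R_ex[OF R] by blast
      have "dot \<alpha> \<in> D" using D_iff R by blast
      moreover have "x \<in> L (dot \<alpha> + (\<alpha> - dot \<alpha>))" using x by simp
      ultimately have "x \<in> Ls (\<alpha> - dot \<alpha>)" unfolding Lsig_def by (blast intro: span_base)
      then show ?thesis using L_Lc[OF \<alpha> x(1)] x(2) diff_dot_Lam[OF R] by blast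
    qed
    show "R0 \<subseteq> zspan ?S"
    proof
      fix \<delta> assume \<delta>: "\<delta> \<in> R0"
      \<comment> \<open>\<open>\<alpha>\<close> and \<open>\<alpha> + \<delta>\<close> are both
        nonisotropic with the same representative, so \<open>\<delta>\<close> is the difference of
        two degrees that occur in the core.\<close>
      obtain \<alpha> where \<alpha>: "\<alpha> \<in> RX" "\<alpha> + \<delta> \<in> R" using R0_nonisolated \<delta> by blast
      have aR: "\<alpha> \<in> R" using \<alpha> RX_iff by blast
      have d: "dot (\<alpha> + \<delta>) = dot \<alpha>"
      proof (rule dot_eqI[OF \<alpha>(2) dot_Z[OF aR]])
        have "\<alpha> - dot \<alpha> + \<delta> \<in> rad"
          using Lam_rad Lam_Hs diff_dot_Lam[OF aR] R0_Lam[OF \<delta>] by (intro rad_add) auto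
        then show "\<alpha> + \<delta> - dot \<alpha> \<in> rad" by (simp add: algebra_simps)
      qed
      have "\<alpha> + \<delta> \<in> RX"
        using \<alpha> dot_eq_0[OF \<alpha>(2)] dot_eq_0[OF aR] d by (auto simp: RX_iff R0_iff)
      from supp[OF this] have "\<alpha> + \<delta> - dot \<alpha> \<in> ?S" unfolding d .
      then have "\<alpha> + \<delta> - dot \<alpha> + - (\<alpha> - dot \<alpha>) \<in> zspan ?S"
        using supp[OF \<alpha>(1)] by (intro zspan_add zspan_uminus zspan_base)
      then show "\<delta> \<in> zspan ?S" by simp
    qed
  qed (auto intro: zspan_zero zspan_add zspan_uminus)
  ultimately show "zspan ?S = Lam" unfolding lLam_def by blast
qed

text \<open>The weight fixes the representative of each root in the support and the degree fixes the
  rest, so x lies in the single root space of \<open>\<mu> + \<sigma>\<close>. The axiom for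
  nonisotropic roots then yields y, and the bracket differs from \<open>tee \<mu>\<close> by
  \<open>tee \<sigma>\<close>.\<close>

lemma core_division:
  assumes \<mu>: "\<mu> \<in> D - {0}" and \<sigma>: "\<sigma> \<in> Lam" and x: "x \<in> Lc \<inter> Ls \<sigma> \<inter> W \<mu>" "x \<noteq> 0"
  shows "\<exists>y\<in>Lc \<inter> Ls (- \<sigma>) \<inter> W (- \<mu>). br x y - tee \<mu> \<in> lcenter br Lc"
proof -
  let ?\<alpha> = "\<mu> + \<sigma>"
  have \<mu>Z: "\<mu> \<in> range Z" and \<mu>H: "\<mu> \<in> Hs" using \<mu> D_Z D_Hs by auto
  have \<sigma>H: "\<sigma> \<in> Hs" using Lam_Hs[OF \<sigma>] .
  have "\<alpha> = ?\<alpha>" if \<alpha>: "\<alpha> \<in> supp x" for \<alpha>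
  proof -
    have "dot \<alpha> = \<mu>" using x(1) \<alpha> W_iff[OF \<mu>Z] by blast
    moreover have a: "\<alpha> - \<sigma> \<in> D" using x(1) \<alpha> Ls_iff[OF \<sigma>] by blast
    moreover have "dot \<alpha> = \<alpha> - \<sigma>"
      by (rule dot_eqI[OF supp_R[OF \<alpha>] D_Z[OF a]]) (simp add: Lam_rad[OF \<sigma>])
    ultimately show ?thesis by (simp add: algebra_simps)
  qed
  then have sx: "supp x \<subseteq> {?\<alpha>}" by blast
  then have "pr ?\<alpha> x = x" using sum_pr_superset[of "{?\<alpha>}" x] by simp
  then have xL: "x \<in> L ?\<alpha>" using pr_L[of ?\<alpha> x] by simp
  have R: "?\<alpha> \<in> R" using RI[OF xL x(2)] \<mu>H \<sigma>H Hs_add by blast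
  have dot: "dot ?\<alpha> = \<mu>" by (rule dot_add_Lam[OF \<mu>Z \<sigma> R])
  then have \<alpha>X: "?\<alpha> \<in> RX" using dot_eq_0[OF R] R \<mu> by (simp add: RX_iff R0_iff)
  then obtain y where y: "y \<in> L (- ?\<alpha>)" "br x y = tee ?\<alpha>" using root_divX xL x(2) by blast
  have yc: "y \<in> Lc" by (rule L_Lc[OF RX_uminus[OF \<alpha>X] y(1)])
  have yW: "y \<in> W (- \<mu>)" using L_W[OF R_uminus[OF R] y(1) yc] uminus_dot[OF R] dot by simp
  have "- \<mu> \<in> D" using D0_uminus[OF \<mu>] by blast
  moreover have "y \<in> L (- \<mu> + - \<sigma>)" using y(1) by simp
  ultimately have yS: "y \<in> Ls (- \<sigma>)" unfolding Lsig_def by (blast intro: span_base)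
  have e: "br x y - tee \<mu> = tee \<sigma>" unfolding y(2) using \<mu>H \<sigma>H by (simp add: tee_add)
  have "tee \<mu> \<in> Hd"
  proof -
    obtain n where n: "\<mu> = Z n" using \<mu>Z by blast
    have "tee \<mu> = (\<Sum>i<l. sc (of_int (n i)) (tee (al i)))"
      unfolding n zcomb_def by (rule tee_sum) (simp add: al_Hs)
    then show ?thesis
      using tee_Hd by (auto intro!: subspace_sum subspace_scale Hd_subspace)
  qed
  then have "tee \<mu> \<in> Lc" using Hd_gd gd_Lc by blast
  \<comment> \<open>A difference of two elements of the core: the bracket of x and y, and
    \<open>tee \<mu>\<close>.\<close>
  then have "tee \<sigma> \<in> Lc"
    unfolding e[symmetric] using Lc_br yc x(1) by (intro subspace_diff[OF Lc_subspace]) auto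
  \<comment> \<open>\<open>tee \<sigma>\<close> acts on the root space of \<open>\<beta>\<close> by
    the product of \<open>\<beta>\<close> with the radical element \<open>\<sigma>\<close>, which is
    0.\<close>
  moreover have "br (tee \<sigma>) z = 0" for z
  proof -
    have "br (tee \<sigma>) (pr \<beta> z) = 0" if \<beta>: "\<beta> \<in> supp z" for \<beta>
    proof -
      have "\<beta> (tee \<sigma>) = ip \<beta> \<sigma>" using ip_eq1[OF supp_Hs[OF \<beta>] \<sigma>H] by simp
      also have "\<dots> = 0" using Lam_rad[OF \<sigma>] supp_R[OF \<beta>] ip_sym[of \<beta> \<sigma>] by (simp add: rad_iff)
      finally show ?thesis using LD[OF pr_L tee_H[OF \<sigma>H], of \<beta> z] by simp
    qed
    then have "br (tee \<sigma>) (\<Sum>\<beta>\<in>supp z. pr \<beta> z) = 0" unfolding br_sum_right by (rule sum.neutral[OF ballI])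
    then show ?thesis unfolding sum_pr .
  qed
  ultimately have "br x y - tee \<mu> \<in> lcenter br Lc" unfolding e lcenter_def by blast
  then show ?thesis using yc yW yS by blast
qed

lemma core_division_graded:
  "division_graded sc br B H Lc gd Hd D (\<lambda>\<sigma>. Lc \<inter> Ls \<sigma>) Lam"
  unfolding division_graded_def
  using core_root_graded core_group_graded core_division by blast

end

theorem theorem2p9:
  fixes sc :: "'k::field_char_0 \<Rightarrow> 'l::ab_group_add \<Rightarrow> 'l"
    and br :: "'l \<Rightarrow> 'l \<Rightarrow> 'l" and B :: "'l \<Rightarrow> 'l \<Rightarrow> 'k" and H :: "'l set"
    and l :: nat and al :: "nat \<Rightarrow> 'l \<Rightarrow> 'k" and ep em :: "nat \<Rightarrow> 'l"
  assumes "classT sc br B H"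
    and "std_base sc br B H l al"
    and "chev_gens sc br B H l al ep em"
  shows "division_graded sc br B H (lcore sc br B H) (gdot sc br l ep em) (Hdot sc B H l al)
           (Rdot sc br B H l al)
           (\<lambda>\<sigma>. lcore sc br B H \<inter> Lsig sc br H (Rdot sc br B H l al) \<sigma>)
           (lLam sc br B H)"
proof -
  have "module sc" using assms(1) unfolding classT_def is_lie_def by blast
  then have "vector_space sc" unfolding module_def vector_space_def .
  then interpret based_toral_lie sc br B H l al ep em
    using assms by (intro based_toral_lie.intro toral_lie.intro toral_lie_axioms.intro based_toral_lie_axioms.intro)
  show ?thesis by (rule core_division_graded)
qed

end
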